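(* For every integer $n\geqslant 4$, the minimum distance of the Fermat function field lattice $\Lambda_n$ satisfies $d(\Lambda_n)>\sqrt{2\gamma}=\sqrt{2(n-1)}$, where $\gamma=n-1$ is the gonality of the Fermat function field $F_n$.
   Context: Let $n\geqslant 4$. $\mathcal F_n$ is the Fermat curve $X^n+Y^n=Z^n$ over $K=\mathbb C$ (a non-singular plane curve), and $F_n=\mathbb C(x,y)$ with $x^n+y^n=1$ is its function field ($x=X/Z$, $y=Y/Z$). Let $\zeta$ be a primitive $n$-th root of unity and $\varepsilon$ a primitive $n$-th root of $-1$. The set $\mathcal P$ consists of the $3n$ points of $\mathcal F_n$ having exactly one zero coordinate: $a_j=(0:\zeta^j:1)$, $b_j=(\zeta^j:0:1)$, $c_j=(\varepsilon\zeta^j:1:0)$, $j=0,\dots,n-1$; points of $\mathcal F_n$ are identified with places of $F_n$. Let $\mathcal O_{\mathcal P}^*$ be the multiplicative group of those $z\in F_n^*$ all of whose zeros and poles lie in $\mathcal P$. The lattice $\Lambda_n\subset\mathbb R^{3n}$ is the image of the homomorphism $\mathcal O_{\mathcal P}^*\to\mathbb Z^{3n}$, $z\mapsto (v_P(z))_{P\in\mathcal P}$, where $v_P$ is the discrete valuation at $P$. The minimum distance is $d(\Lambda)=\min_{0\neq v\in\Lambda}\|v\|$ (Euclidean norm). The gonality $\gamma$ of $F_n$ is the minimum degree of a non-constant function in $F_n$ (the degree of a function being the degree of its zero divisor); it is known that $\gamma=n-1$. *)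

theory Defs
  imports "HOL-Analysis.Analysis" "HOL-Computational_Algebra.Computational_Algebra"
begin

section \<open>Function fields over the complex numbers\<close>

text \<open>
  A function field is a set \<^term>\<open>F\<close> inside an ambient type of class field, so that it can depend
  on the exponent of the Fermat curve.  The constant field is the image of an embedding \<open>\<iota>\<close>
  of the complex numbers.
\<close>

definition is_subring :: "'a::field set \<Rightarrow> bool" where
  "is_subring R \<longleftrightarrow> 1 \<in> R \<and> (\<forall>a\<in>R. \<forall>b\<in>R. a - b \<in> R \<and> a * b \<in> R)"

definition is_subfield :: "'a::field set \<Rightarrow> bool" where
  "is_subfield L \<longleftrightarrow> is_subring L \<and> (\<forall>a\<in>L. inverse a \<in> L)"

definition field_embedding :: "(complex \<Rightarrow> 'a::field) \<Rightarrow> bool" where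
  "field_embedding \<iota> \<longleftrightarrow>
     \<iota> 1 = 1 \<and> (\<forall>a b. \<iota> (a + b) = \<iota> a + \<iota> b) \<and> (\<forall>a b. \<iota> (a * b) = \<iota> a * \<iota> b)"

definition transcendental_over :: "(complex \<Rightarrow> 'a::field) \<Rightarrow> 'a \<Rightarrow> bool" where
  "transcendental_over \<iota> x \<longleftrightarrow> (\<forall>p. p \<noteq> 0 \<longrightarrow> poly (map_poly \<iota> p) x \<noteq> 0)"

text \<open>The field generated over the constants by a set of elements.\<close>

definition adjoin :: "(complex \<Rightarrow> 'a::field) \<Rightarrow> 'a set \<Rightarrow> 'a set" where
  "adjoin \<iota> S = is_subfield hull (range \<iota> \<union> S)"


subsection \<open>Places and valuations\<close>

definition valuation_ring :: "(complex \<Rightarrow> 'a::field) \<Rightarrow> 'a set \<Rightarrow> 'a set \<Rightarrow> bool" where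
  "valuation_ring \<iota> F R \<longleftrightarrow>
     is_subring R \<and> range \<iota> \<subset> R \<and> R \<subset> F \<and> (\<forall>z\<in>F. z \<in> R \<or> inverse z \<in> R)"

definition units_in :: "'a::field set \<Rightarrow> 'a set" where
  "units_in R = {u \<in> R. u \<noteq> 0 \<and> inverse u \<in> R}"

text \<open>A place is the maximal ideal of a valuation ring, i.e. the set of its non-units.\<close>

definition place :: "(complex \<Rightarrow> 'a::field) \<Rightarrow> 'a set \<Rightarrow> 'a set \<Rightarrow> bool" where
  "place \<iota> F P \<longleftrightarrow> (\<exists>R. valuation_ring \<iota> F R \<and> P = R - units_in R)"

text \<open>The valuation ring is recovered from its place as the set of all \<open>z\<close> with
  \<open>z = 0\<close> or \<open>1/z \<notin> P\<close>.\<close>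

definition ring_of_place :: "'a::field set \<Rightarrow> 'a set \<Rightarrow> 'a set" where
  "ring_of_place F P = {z \<in> F. z = 0 \<or> inverse z \<notin> P}"

definition prime_element :: "'a::field set \<Rightarrow> 'a set \<Rightarrow> 'a \<Rightarrow> bool" where
  "prime_element F P t \<longleftrightarrow> P = (\<lambda>w. t * w) ` ring_of_place F P"

text \<open>Only meaningful for \<open>z \<noteq> 0\<close>; the value at 0 (conventionally infinity) is never used.\<close>

definition val :: "'a::field set \<Rightarrow> 'a set \<Rightarrow> 'a \<Rightarrow> int" where
  "val F P z = (THE k. \<exists>t u. prime_element F P t \<and> u \<in> units_in (ring_of_place F P) \<and>
                            z = t powi k * u)"


subsection \<open>Degree and gonality\<close>

text \<open>The degree of the zero divisor.  Every place has degree one, because the constant field is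
  algebraically closed.\<close>

definition fun_degree :: "(complex \<Rightarrow> 'a::field) \<Rightarrow> 'a set \<Rightarrow> 'a \<Rightarrow> nat" where
  "fun_degree \<iota> F z = (\<Sum>P | place \<iota> F P \<and> val F P z > 0. nat (val F P z))"

definition gonality :: "(complex \<Rightarrow> 'a::field) \<Rightarrow> 'a set \<Rightarrow> nat" where
  "gonality \<iota> F = (LEAST d. \<exists>z \<in> F - range \<iota>. d = fun_degree \<iota> F z)"


section \<open>Function field lattices\<close>

definition S_units :: "(complex \<Rightarrow> 'a::field) \<Rightarrow> 'a set \<Rightarrow> 'a set set \<Rightarrow> 'a set" where
  "S_units \<iota> F S = {z \<in> F. z \<noteq> 0 \<and> (\<forall>P. place \<iota> F P \<longrightarrow> val F P z \<noteq> 0 \<longrightarrow> P \<in> S)}"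

text \<open>A vector of the Euclidean space with coordinates indexed by the finite set \<open>S\<close> is
  represented by a function vanishing outside \<open>S\<close>.\<close>

definition function_field_lattice ::
    "(complex \<Rightarrow> 'a::field) \<Rightarrow> 'a set \<Rightarrow> 'a set set \<Rightarrow> ('a set \<Rightarrow> real) set" where
  "function_field_lattice \<iota> F S =
     (\<lambda>z P. if P \<in> S then real_of_int (val F P z) else 0) ` S_units \<iota> F S"

definition min_distance :: "'i set \<Rightarrow> ('i \<Rightarrow> real) set \<Rightarrow> real" where
  "min_distance S \<Lambda> = (LEAST r. \<exists>v\<in>\<Lambda>. v \<noteq> (\<lambda>_. 0) \<and> r = L2_set v S)"


section \<open>The Fermat curve\<close>

text \<open>The data \<open>F = \<complex>(x, y)\<close> with \<open>x ^ n + y ^ n = 1\<close>.  Since the polynomial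
  \<open>X ^ n + Y ^ n - 1\<close> is irreducible, \<open>F\<close> is determined up to isomorphism once \<open>x\<close> is
  transcendental.\<close>

definition fermat_function_field ::
    "nat \<Rightarrow> (complex \<Rightarrow> 'a::field) \<Rightarrow> 'a \<Rightarrow> 'a \<Rightarrow> 'a set \<Rightarrow> bool" where
  "fermat_function_field n \<iota> x y F \<longleftrightarrow>
     field_embedding \<iota> \<and> transcendental_over \<iota> x \<and> x ^ n + y ^ n = 1 \<and> F = adjoin \<iota> {x, y}"

text \<open>Such data exist for every exponent, e.g. inside the field of formal Laurent series.\<close>

lemma fermat_function_field_exists:
  assumes "n > 0"
  shows "\<exists>(y :: complex fls) F. fermat_function_field n fls_const fls_X y F"
proof -
  obtain k where k: "n = Suc k" using assms by (cases n) auto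
  define a :: "complex fps" where "a = 1 - fps_X ^ n"
  have a0: "a $ 0 = 1" by (simp add: a_def k)
  have "fps_radical (\<lambda>_ _. 1) (Suc k) a ^ Suc k = a"
    using power_radical[of a "\<lambda>_ _. 1" k] by (simp add: a0)
  then obtain b where b: "b ^ n = a" using k by blast
  have "fls_X ^ n + fps_to_fls b ^ n = fps_to_fls (fps_X ^ n + b ^ n)"
    by (simp add: fps_to_fls_power)
  also have "\<dots> = 1" by (simp add: b a_def)
  finally have eq: "fls_X ^ n + fps_to_fls b ^ n = 1" .
  have "poly (map_poly fls_const p) fls_X = fps_to_fls (fps_of_poly p)" for p :: "complex poly"
    by (induction p)
       (simp_all add: map_poly_pCons fps_of_poly_pCons fls_times_fps_to_fls)
  then have "transcendental_over fls_const (fls_X :: complex fls)"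
    by (simp add: transcendental_over_def)
  moreover have "field_embedding (fls_const :: complex \<Rightarrow> complex fls)"
    by (simp add: field_embedding_def fls_plus_const)
  ultimately show ?thesis using eq unfolding fermat_function_field_def by blast
qed

text \<open>The place \<open>P\<close> corresponds to the point \<open>(a : b : c)\<close> of the projective plane if a
  suitable multiple \<open>(t x, t y, t)\<close> of the generic point \<open>(x : y : 1)\<close> reduces to
  \<open>(a, b, c)\<close> modulo \<open>P\<close>.\<close>

definition centred_at ::
    "(complex \<Rightarrow> 'a::field) \<Rightarrow> 'a \<Rightarrow> 'a \<Rightarrow> 'a set \<Rightarrow> 'a set \<Rightarrow> complex \<times> complex \<times> complex \<Rightarrow> bool" where
  "centred_at \<iota> x y F P = (\<lambda>(a, b, c). (a, b, c) \<noteq> (0, 0, 0) \<and>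
     (\<exists>t\<in>F. t * x - \<iota> a \<in> P \<and> t * y - \<iota> b \<in> P \<and> t - \<iota> c \<in> P))"

definition primitive_root_of_unity :: "nat \<Rightarrow> complex \<Rightarrow> bool" where
  "primitive_root_of_unity n \<zeta> \<longleftrightarrow> \<zeta> ^ n = 1 \<and> (\<forall>k. 0 < k \<and> k < n \<longrightarrow> \<zeta> ^ k \<noteq> 1)"

text \<open>Homogeneous coordinates of the points of the curve with exactly one zero coordinate,
  where \<open>\<zeta>\<close> is a primitive \<open>n\<close>-th root of unity and \<open>\<epsilon> ^ n = -1\<close>.\<close>

definition fermat_points :: "nat \<Rightarrow> complex \<Rightarrow> complex \<Rightarrow> (complex \<times> complex \<times> complex) set" where
  "fermat_points n \<zeta> \<epsilon> =
     (\<Union>j<n. {(0, \<zeta> ^ j, 1), (\<zeta> ^ j, 0, 1), (\<epsilon> * \<zeta> ^ j, 1, 0)})"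

definition fermat_places ::
    "nat \<Rightarrow> complex \<Rightarrow> complex \<Rightarrow> (complex \<Rightarrow> 'a::field) \<Rightarrow> 'a \<Rightarrow> 'a \<Rightarrow> 'a set \<Rightarrow> 'a set set" where
  "fermat_places n \<zeta> \<epsilon> \<iota> x y F =
     {P. place \<iota> F P \<and> (\<exists>p\<in>fermat_points n \<zeta> \<epsilon>. centred_at \<iota> x y F P p)}"

definition fermat_lattice ::
    "nat \<Rightarrow> complex \<Rightarrow> complex \<Rightarrow> (complex \<Rightarrow> 'a::field) \<Rightarrow> 'a \<Rightarrow> 'a \<Rightarrow> 'a set \<Rightarrow> ('a set \<Rightarrow> real) set" where
  "fermat_lattice n \<zeta> \<epsilon> \<iota> x y F =
     function_field_lattice \<iota> F (fermat_places n \<zeta> \<epsilon> \<iota> x y F)"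

end

theory Submission
  imports Defs
begin

text \<open>
  Write a nonconstant function as \<open>z = p(x, y) / q(x)\<close> in lowest terms, where \<open>p\<close> has
  \<open>y\<close>-degree \<open>k < n\<close>, and let \<open>D\<close> be the larger of the degree of \<open>q\<close> and the total degree of
  \<open>p\<close>.  Over a zero \<open>a\<close> of \<open>q\<close> of order \<open>m\<close>, the polynomial \<open>p(a, Y)\<close> is nonzero of degree at
  most \<open>k\<close>, so at least \<open>n - k\<close> of the \<open>n\<close> points above \<open>a\<close> (suitably counted if they coincide)
  are poles of order \<open>m\<close>; the same happens above infinity.  Hence \<open>z\<close> has at least
  \<open>D (n - k) \<ge> n - 1\<close> poles, which gives the gonality.  Equality forces \<open>D = k\<close> with \<open>k = 1\<close> or
  \<open>k = n - 1\<close>.  In the first case \<open>z\<close> is a linear polynomial, possibly divided by some \<open>x - a\<close>;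
  in the second case the two top coefficients of \<open>p(a, Y)\<close> show that all poles lie on a line
  \<open>y = \<alpha> x + \<beta>\<close>.

  The inequality \<open>v\<^sup>2 \<ge> \<bar>v\<bar>\<close> bounds the squared norm of a lattice vector below by the number of its
  zeros and poles, which is at least \<open>2 (n - 1)\<close>.  Equality would require \<open>n - 1\<close> simple zeros and
  \<open>n - 1\<close> simple poles among the \<open>3 n\<close> points, both collinear.  A line other than the three
  coordinate lines contains at most three of these points, and for \<open>n = 4\<close> at most two.  So the
  zeros lie on one coordinate line and the poles on another, and the explicit form of \<open>z\<close> rules
  this out.
\<close>

text \<open>The field is a subset of an arbitrary type and its places are given by valuation rings,
  so poles can be counted only after every place has been matched with a point. Each point carries a
  pair of Laurent series \<open>(X, Y)\<close> on the curve; substituting them for \<open>x\<close>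
  and \<open>y\<close> embeds the field, and orders become subdegrees. Conversely, a valuation ring
  contains \<open>x\<close> and \<open>y\<close>, or \<open>1/x\<close> and \<open>y/x\<close>, and
  the residues of these two functions name its point.

  Total ramification enters twice. The point \<open>(a : 0 : 1)\<close> is the only one above its
  \<open>x\<close>-coordinate, and \<open>x - a\<close> has order \<open>n\<close> there. So a
  polynomial of \<open>y\<close>-degree below \<open>n\<close> agrees to lowest order with its
  restriction to \<open>x = a\<close>, if that is nonzero. This gives the irreducibility of the
  curve, and it is how coinciding points are counted in a fibre.

  Zeros of \<open>z\<close> are treated as poles of \<open>1/z\<close>, so one estimate serves both.
  In the extremal case there is a formula for \<open>z\<close> if its poles lie on
  \<open>x = 0\<close> or at infinity, but not if they lie on \<open>y = 0\<close>. Zeros and poles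
  cannot both lie on \<open>y = 0\<close>, so one of \<open>z\<close> and \<open>1/z\<close> has a
  formula.\<close>

unbundle no vec_syntax

section \<open>Evaluation of polynomials\<close>

lemma map_poly_add_hom:
  assumes "h 0 = 0" "\<And>a b. h (a + b) = h a + h b"
  shows "map_poly h (p + q) = map_poly h p + map_poly h q"
  by (rule poly_eqI) (simp add: coeff_map_poly assms)

lemma map_poly_mult_hom:
  fixes h :: "'a::comm_semiring_0 \<Rightarrow> 'b::comm_semiring_0"
  assumes "h 0 = 0" "\<And>a b. h (a + b) = h a + h b" "\<And>a b. h (a * b) = h a * h b"
  shows "map_poly h (p * q) = map_poly h p * map_poly h q"
proof (induction p)
  case 0
  then show ?case by simp
next
  case (pCons a p)
  have smult: "map_poly h (smult a q) = smult (h a) (map_poly h q)"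
    by (rule poly_eqI) (simp add: coeff_map_poly assms)
  show ?case
    by (simp add: map_poly_add_hom[OF assms(1,2)] map_poly_pCons assms(1) smult pCons.IH)
qed

definition eval1 :: "(complex \<Rightarrow> 'a::field) \<Rightarrow> 'a \<Rightarrow> complex poly \<Rightarrow> 'a" where
  "eval1 \<iota> x p = poly (map_poly \<iota> p) x"

text \<open>In a \<open>complex poly poly\<close> the outer variable stands for \<open>y\<close> and
  the inner one for \<open>x\<close>, so \<open>degree\<close> is the
  \<open>y\<close>-degree.\<close>

definition eval2 :: "(complex \<Rightarrow> 'a::field) \<Rightarrow> 'a \<Rightarrow> 'a \<Rightarrow> complex poly poly \<Rightarrow> 'a" where
  "eval2 \<iota> x y p = poly (map_poly (eval1 \<iota> x) p) y"

definition specialize :: "complex \<Rightarrow> complex poly poly \<Rightarrow> complex poly" where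
  "specialize a p = map_poly (\<lambda>r. poly r a) p"

lemma coeff_specialize: "coeff (specialize a p) i = poly (coeff p i) a"
  by (simp add: specialize_def coeff_map_poly)

lemma specialize_pCons [simp]: "specialize a (pCons r p) = pCons (poly r a) (specialize a p)"
  by (simp add: specialize_def map_poly_pCons)

lemma specialize_0 [simp]: "specialize a 0 = 0"
  by (simp add: specialize_def)

lemma degree_specialize_le: "degree (specialize a p) \<le> degree p"
  by (simp add: specialize_def map_poly_degree_leq)

text \<open>Every coefficient is divided by \<open>X - a\<close>, with its value at \<open>a\<close>
  as remainder. In particular \<open>X - a\<close> divides \<open>p\<close> as soon as
  \<open>specialize a p\<close> vanishes.\<close>

lemma specialize_split:
  obtains p' where "p = smult [:-a, 1:] p' + map_poly (\<lambda>c. [:c:]) (specialize a p)"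
proof -
  define p' where "p' = map_poly (\<lambda>r. synthetic_div r a) p"
  have "p = smult [:-a, 1:] p' + map_poly (\<lambda>c. [:c:]) (specialize a p)"
  proof (rule poly_eqI)
    fix i
    show "coeff p i = coeff (smult [:-a, 1:] p' + map_poly (\<lambda>c. [:c:]) (specialize a p)) i"
      using synthetic_div_correct'[of a "coeff p i"]
      by (simp add: p'_def coeff_map_poly coeff_specialize)
  qed
  then show thesis by (rule that)
qed

locale constant_field =
  fixes \<iota> :: "complex \<Rightarrow> 'a::field"
  assumes embedding: "field_embedding \<iota>"
begin

lemma \<iota>_1 [simp]: "\<iota> 1 = 1" and \<iota>_add [simp]: "\<iota> (a + b) = \<iota> a + \<iota> b"
  and \<iota>_mult [simp]: "\<iota> (a * b) = \<iota> a * \<iota> b"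
  using embedding by (auto simp: field_embedding_def)

lemma \<iota>_0 [simp]: "\<iota> 0 = 0"
  by (metis \<iota>_add add_0 add_cancel_right_right)

lemma \<iota>_uminus [simp]: "\<iota> (- a) = - \<iota> a"
  using \<iota>_add[of a "- a"] by (simp add: eq_neg_iff_add_eq_0 add.commute del: \<iota>_add)

lemma \<iota>_diff [simp]: "\<iota> (a - b) = \<iota> a - \<iota> b"
  using \<iota>_add[of a "- b"] by (simp del: \<iota>_add)

lemma \<iota>_eq_0_iff [simp]: "\<iota> a = 0 \<longleftrightarrow> a = 0"
proof
  assume "\<iota> a = 0"
  then have "\<not> (\<iota> (a * inverse a) = 1)" by simp
  then show "a = 0" by (metis right_inverse \<iota>_1)
qed simp

lemma \<iota>_inverse [simp]: "\<iota> (inverse a) = inverse (\<iota> a)"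
proof (cases "a = 0")
  case False
  then have "\<iota> a * \<iota> (inverse a) = 1" by (metis right_inverse \<iota>_1 \<iota>_mult)
  then show ?thesis by (metis inverse_unique)
qed simp

lemma \<iota>_power [simp]: "\<iota> (a ^ k) = \<iota> a ^ k"
  by (induction k) auto

lemma eval1_simps [simp]:
  "eval1 \<iota> x 0 = 0" "eval1 \<iota> x 1 = 1"
  "eval1 \<iota> x (pCons a p) = \<iota> a + x * eval1 \<iota> x p"
  "eval1 \<iota> x (p + q) = eval1 \<iota> x p + eval1 \<iota> x q"
  "eval1 \<iota> x (p * q) = eval1 \<iota> x p * eval1 \<iota> x q"
  by (simp_all add: eval1_def map_poly_pCons map_poly_add_hom map_poly_mult_hom)

lemma eval1_smult [simp]: "eval1 \<iota> x (smult c p) = \<iota> c * eval1 \<iota> x p"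
  by (simp add: eval1_def map_poly_smult)

lemma eval1_power [simp]: "eval1 \<iota> x (p ^ k) = eval1 \<iota> x p ^ k"
  by (induction k) auto

lemma eval1_uminus [simp]: "eval1 \<iota> x (- p) = - eval1 \<iota> x p"
  using eval1_smult[of x "-1" p] by simp

lemma eval1_diff [simp]: "eval1 \<iota> x (p - q) = eval1 \<iota> x p - eval1 \<iota> x q"
  using eval1_simps(4)[of x p "- q"] by simp

lemma eval1_prod: "eval1 \<iota> x (prod f A) = (\<Prod>a\<in>A. eval1 \<iota> x (f a))"
  by (induction A rule: infinite_finite_induct) auto

lemma eval1_monom [simp]: "eval1 \<iota> x (monom c k) = \<iota> c * x ^ k"
  by (simp add: eval1_def map_poly_monom poly_monom)

lemma eval2_simps [simp]:
  "eval2 \<iota> x y 0 = 0" "eval2 \<iota> x y 1 = 1"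
  "eval2 \<iota> x y (pCons r p) = eval1 \<iota> x r + y * eval2 \<iota> x y p"
  "eval2 \<iota> x y (p + q) = eval2 \<iota> x y p + eval2 \<iota> x y q"
  "eval2 \<iota> x y (p * q) = eval2 \<iota> x y p * eval2 \<iota> x y q"
  by (simp_all add: eval2_def map_poly_pCons map_poly_add_hom map_poly_mult_hom)

lemma eval2_smult [simp]: "eval2 \<iota> x y (smult c p) = eval1 \<iota> x c * eval2 \<iota> x y p"
proof -
  have "map_poly (eval1 \<iota> x) (smult c p) = smult (eval1 \<iota> x c) (map_poly (eval1 \<iota> x) p)"
    by (rule poly_eqI) (simp add: coeff_map_poly)
  then show ?thesis by (simp add: eval2_def)
qed

lemma eval2_uminus [simp]: "eval2 \<iota> x y (- p) = - eval2 \<iota> x y p"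
  using eval2_smult[of x y "-1" p] by simp

lemma eval2_diff [simp]: "eval2 \<iota> x y (p - q) = eval2 \<iota> x y p - eval2 \<iota> x y q"
  using eval2_simps(4)[of x y p "- q"] by simp

lemma eval2_monom [simp]: "eval2 \<iota> x y (monom c k) = eval1 \<iota> x c * y ^ k"
  by (simp add: eval2_def map_poly_monom poly_monom)

lemma eval2_const_coeffs [simp]: "eval2 \<iota> x y (map_poly (\<lambda>c. [:c:]) p) = eval1 \<iota> y p"
  by (induction p) (simp_all add: map_poly_pCons)

lemma eval2_altdef: "eval2 \<iota> x y p = (\<Sum>i\<le>degree p. eval1 \<iota> x (coeff p i) * y ^ i)"
proof -
  have "p = (\<Sum>i\<le>degree p. monom (coeff p i) i)"
    by (simp add: poly_as_sum_of_monoms)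
  moreover have "eval2 \<iota> x y (\<Sum>i\<in>A. monom (coeff p i) i) = (\<Sum>i\<in>A. eval1 \<iota> x (coeff p i) * y ^ i)" for A
    by (induction A rule: infinite_finite_induct) auto
  ultimately show ?thesis by metis
qed

text \<open>The constants are algebraically closed, so questions about \<open>p(x)\<close> reduce to
  the factors \<open>x - \<iota> a\<close>: when it vanishes here, when it is a unit of a valuation
  ring later.\<close>

lemma eval1_decompose:
  "eval1 \<iota> x p = \<iota> (lead_coeff p) * (\<Prod>a | poly p a = 0. (x - \<iota> a) ^ order a p)"
proof -
  have "eval1 \<iota> x p = eval1 \<iota> x (smult (lead_coeff p) (\<Prod>a | poly p a = 0. [:-a, 1:] ^ order a p))"
    by (simp only: complex_poly_decompose)
  also have "\<dots> = \<iota> (lead_coeff p) * (\<Prod>a | poly p a = 0. (x - \<iota> a) ^ order a p)"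
    by (simp add: eval1_prod)
  finally show ?thesis .
qed

text \<open>A product of factors \<open>x - \<iota> a\<close> vanishes only if one of them does, so
  an element algebraic over the constants is itself constant.\<close>

lemma transcendental_over_iff: "transcendental_over \<iota> x \<longleftrightarrow> x \<notin> range \<iota>"
proof
  assume tr: "transcendental_over \<iota> x"
  show "x \<notin> range \<iota>"
  proof
    assume "x \<in> range \<iota>"
    then obtain c where "x = \<iota> c" by auto
    then have "eval1 \<iota> x [:-c, 1:] = 0" by simp
    then show False using tr unfolding transcendental_over_def eval1_def by (metis pCons_eq_0_iff one_neq_zero)
  qed
next
  assume "x \<notin> range \<iota>"
  then have "x - \<iota> a \<noteq> 0" for a by auto
  then have "eval1 \<iota> x p \<noteq> 0" if "p \<noteq> 0" for p
    using that by (subst eval1_decompose) (simp add: poly_roots_finite)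
  then show "transcendental_over \<iota> x" by (simp add: transcendental_over_def eval1_def)
qed

lemma eval1_nonzero:
  assumes "x \<notin> range \<iota>" "p \<noteq> 0"
  shows "eval1 \<iota> x p \<noteq> 0"
  using assms transcendental_over_iff[of x] by (simp add: transcendental_over_def eval1_def)

end

section \<open>Laurent parametrizations of the points of the curve\<close>

interpretation fls: constant_field fls_const
  by unfold_locales (simp add: field_embedding_def fls_plus_const)

declare fls.\<iota>_mult [simp del] \<comment> \<open>loops with \<open>fls_const_mult_const\<close>\<close>


text \<open>The value of a Laurent series at the centre, as a relation because it does not exist at
  a pole.\<close>

definition reduces :: "complex fls \<Rightarrow> complex \<Rightarrow> bool" where
  "reduces z c \<longleftrightarrow> (\<exists>f. z = fps_to_fls f \<and> f $ 0 = c)"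

lemma reduces_const [simp, intro]: "reduces (fls_const c) c"
  unfolding reduces_def by (rule exI[of _ "fps_const c"]) auto

lemma reduces_0 [simp, intro]: "reduces 0 0" and reduces_1 [simp, intro]: "reduces 1 1"
  using reduces_const[of 0] reduces_const[of 1] by auto

lemma reduces_add [intro]: "reduces z c \<Longrightarrow> reduces w d \<Longrightarrow> reduces (z + w) (c + d)"
  unfolding reduces_def by (metis fps_to_fls_plus fps_add_nth)

lemma reduces_diff [intro]: "reduces z c \<Longrightarrow> reduces w d \<Longrightarrow> reduces (z - w) (c - d)"
  unfolding reduces_def by (metis fps_to_fls_minus fps_sub_nth)

lemma reduces_mult [intro]: "reduces z c \<Longrightarrow> reduces w d \<Longrightarrow> reduces (z * w) (c * d)"
  unfolding reduces_def by (metis fls_times_fps_to_fls fps_mult_nth_0)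

lemma reduces_power [intro]: "reduces z c \<Longrightarrow> reduces (z ^ k) (c ^ k)"
  by (induction k) auto

lemma reduces_sum: "(\<And>i. i \<in> A \<Longrightarrow> reduces (z i) (c i)) \<Longrightarrow> reduces (sum z A) (sum c A)"
  by (induction A rule: infinite_finite_induct) auto

lemma reduces_inverse [intro]:
  assumes "reduces z c" "c \<noteq> 0"
  shows "reduces (inverse z) (inverse c)"
proof -
  obtain f where "z = fps_to_fls f" "f $ 0 = c" using assms by (auto simp: reduces_def)
  then show ?thesis using assms(2)
    by (auto simp: reduces_def fls_inverse_fps_to_fls intro!: exI[of _ "inverse f"])
qed

lemma reduces_unique: "reduces z c \<Longrightarrow> reduces z d \<Longrightarrow> c = d"
  by (auto simp: reduces_def)

lemma reduces_zero_iff: "reduces z 0 \<longleftrightarrow> z = 0 \<or> fls_subdegree z > 0"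
proof
  assume "reduces z 0"
  then obtain f where f: "z = fps_to_fls f" "f $ 0 = 0" by (auto simp: reduces_def)
  then show "z = 0 \<or> fls_subdegree z > 0"
    by (auto simp: fls_subdegree_fls_to_fps) (metis nth_subdegree_nonzero gr0I)
next
  assume *: "z = 0 \<or> fls_subdegree z > 0"
  then have "z = fps_to_fls (fls_regpart z)" by fastforce
  moreover have "fls_regpart z $ 0 = 0" using * by auto
  ultimately show "reduces z 0" unfolding reduces_def by blast
qed

lemma reduces_ex_iff: "(\<exists>c. reduces z c) \<longleftrightarrow> fls_subdegree z \<ge> 0"
  unfolding reduces_def
  by (metis fls_subdegree_fls_to_fps_gt0 fls_regpart_to_fls_trivial)

lemma reduces_nonzero:
  assumes "reduces z c" "c \<noteq> 0"
  shows "z \<noteq> 0" "fls_subdegree z = 0"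
proof -
  show "z \<noteq> 0" using assms reduces_unique reduces_0 by blast
  then show "fls_subdegree z = 0"
    using assms reduces_ex_iff[of z] reduces_zero_iff[of z] reduces_unique[of z] by fastforce
qed

lemma reduces_eval1: "reduces X a \<Longrightarrow> reduces (eval1 fls_const X p) (poly p a)"
  by (induction p) auto

lemma reduces_eval2:
  "reduces X a \<Longrightarrow> reduces Y b \<Longrightarrow> reduces (eval2 fls_const X Y p) (poly (specialize a p) b)"
  by (induction p) (auto intro!: reduces_add reduces_mult reduces_eval1)

text \<open>\<open>Aff a b\<close> is the point \<open>(a : b : 1)\<close> and \<open>Inf f\<close> is the point \<open>(1 : f : 0)\<close>.\<close>

datatype point = Aff complex complex | Inf complex

fun on_curve :: "nat \<Rightarrow> point \<Rightarrow> bool" where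
  "on_curve n (Aff a b) \<longleftrightarrow> a ^ n + b ^ n = 1"
| "on_curve n (Inf f) \<longleftrightarrow> f ^ n = -1"

text \<open>The subdegree conditions prescribe a local parameter: \<open>Y\<close> where
  \<open>b = 0\<close>, since the projection to the \<open>x\<close>-line ramifies there,
  \<open>X - a\<close> at the other affine points and \<open>1/X\<close> at infinity. They exclude
  substitutions such as \<open>T\<close> to \<open>T^2\<close>, which would multiply all
  orders.\<close>

fun parametrizes :: "nat \<Rightarrow> point \<Rightarrow> complex fls \<Rightarrow> complex fls \<Rightarrow> bool" where
  "parametrizes n (Aff a b) X Y \<longleftrightarrow> X ^ n + Y ^ n = 1 \<and> reduces X a \<and> reduces Y b \<and>
     (if b = 0 then fls_subdegree Y = 1 else fls_subdegree (X - fls_const a) = 1)"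
| "parametrizes n (Inf f) X Y \<longleftrightarrow> X ^ n + Y ^ n = 1 \<and> fls_subdegree X = -1 \<and> reduces (Y / X) f"

section \<open>Existence of parametrizations, and orders of polynomials along them\<close>

lemma fps_root_exists:
  fixes a :: "complex fps"
  assumes "n > 0" "a $ 0 = 1"
  obtains r where "r ^ n = a" "r $ 0 = 1"
proof -
  obtain k where k: "n = Suc k" using assms(1) by (cases n) auto
  have "fps_radical (\<lambda>_ _. 1) (Suc k) a ^ Suc k = a"
    using power_radical[of a "\<lambda>_ _. 1" k] by (simp add: assms(2))
  moreover have "fps_radical (\<lambda>_ _. 1) (Suc k) a $ 0 = 1" by simp
  ultimately show thesis using that k by blast
qed

text \<open>One coordinate is chosen as \<open>1/T\<close>, \<open>T\<close> or
  \<open>a + T\<close>. The equation then makes the other one a constant, times \<open>1/T\<close>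
  at infinity, times an \<open>n\<close>-th root of a series with constant term 1.\<close>

lemma parametrization_exists:
  assumes n: "n > 0" and Q: "on_curve n Q"
  shows "\<exists>X Y. parametrizes n Q X Y"
proof (cases Q)
  case (Inf f)
  define g :: "complex fps" where "g = 1 - fps_X ^ n"
  have "g $ 0 = 1" using n by (simp add: g_def)
  with n obtain r where r: "r ^ n = g" "r $ 0 = 1" by (rule fps_root_exists)
  define Y where "Y = fls_const f * fls_X_inv * fps_to_fls r"
  have "fps_to_fls r ^ n = 1 - fls_X ^ n" 
    by (simp add: fps_to_fls_power[symmetric] r(1)) (simp add: g_def fps_to_fls_power)
  then have "Y ^ n = fls_const (f ^ n) * (fls_X_inv ^ n - fls_X_inv ^ n * fls_X ^ n)"
    by (simp only: Y_def power_mult_distrib fls_const_power right_diff_distrib mult_1_right mult.assoc)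
  also have "fls_X_inv ^ n * fls_X ^ n = (1 :: complex fls)"
    by (simp only: fls_inverse_X[symmetric] power_inverse) (rule left_inverse, simp)
  finally have "fls_X_inv ^ n + Y ^ n = 1" using Q Inf by (simp del: fls.\<iota>_power)
  moreover have "Y / fls_X_inv = fls_const f * fps_to_fls r"
  proof -
    have "Y = (fls_const f * fps_to_fls r) * fls_X_inv" by (simp only: Y_def mult_ac)
    moreover have "fls_X_inv * inverse fls_X_inv = (1 :: complex fls)" by (rule right_inverse) simp
    ultimately show ?thesis by (simp only: divide_inverse mult.assoc mult_1_right)
  qed
  moreover have "reduces (fls_const f * fps_to_fls r) (f * 1)"
    using r(2) by (intro reduces_mult reduces_const) (auto simp: reduces_def)
  ultimately have "parametrizes n Q fls_X_inv Y" using Inf by simp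
  then show ?thesis by blast
next
  case (Aff a b)
  show ?thesis
  proof (cases "b = 0")
    case True
    define g :: "complex fps" where "g = 1 - fps_X ^ n"
    have "g $ 0 = 1" using n by (simp add: g_def)
    with n obtain r where r: "r ^ n = g" "r $ 0 = 1" by (rule fps_root_exists)
    define X where "X = fls_const a * fps_to_fls r"
    have "X ^ n = fls_const (a ^ n) * fps_to_fls g"
      by (simp add: X_def power_mult_distrib fps_to_fls_power[symmetric] r(1))
    also have "a ^ n = 1" using Q Aff True n by (simp add: power_0_left)
    finally have "X ^ n + fls_X ^ n = 1"  by (simp add: g_def fps_to_fls_power)
    moreover have "reduces X (a * 1)" unfolding X_def
      using r(2) by (intro reduces_mult reduces_const) (auto simp: reduces_def)
    moreover have "reduces fls_X 0" by (simp add: reduces_zero_iff)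
    ultimately have "parametrizes n Q X fls_X" using Aff True by simp
    then show ?thesis by blast
  next
    case False
    define g :: "complex fps" where "g = fps_const (inverse (b ^ n)) * (1 - (fps_const a + fps_X) ^ n)"
    have "b ^ n = 1 - a ^ n" using Q Aff by (simp add: algebra_simps)
    moreover have "b ^ n \<noteq> 0" using False by simp
    ultimately have "g $ 0 = 1" by (simp add: g_def fps_power_zeroth)
    with n obtain r where r: "r ^ n = g" "r $ 0 = 1" by (rule fps_root_exists)
    define Y where "Y = fps_to_fls (fps_const b * r)"
    have "(fps_const b * r) ^ n = fps_const (b ^ n) * g"
      by (simp only: power_mult_distrib r(1) fps_const_power)
    also have "\<dots> = fps_const (b ^ n * inverse (b ^ n)) * (1 - (fps_const a + fps_X) ^ n)"
      by (simp only: g_def mult.assoc[symmetric] fps_const_mult)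
    also have "b ^ n * inverse (b ^ n) = 1" using False by (intro right_inverse) simp
    finally have "(fps_const b * r) ^ n = 1 - (fps_const a + fps_X) ^ n"
      by (simp only: fps_const_1_eq_1 mult_1_left)
    then have "Y ^ n = 1 - (fls_const a + fls_X) ^ n"
      by (simp only: Y_def fps_to_fls_power[symmetric]) (simp add: fps_to_fls_power)
    moreover have "reduces (fls_const a + fls_X) (a + 0)"
      by (intro reduces_add) (simp_all add: reduces_zero_iff)
    moreover have "reduces Y b" unfolding Y_def reduces_def using r(2)
      by (intro exI[of _ "fps_const b * r"]) simp
    ultimately have "parametrizes n Q (fls_const a + fls_X) Y" using Aff False by simp
    then show ?thesis by blast
  qed
qed

text \<open>The exponent \<open>e\<close> allows two uses: \<open>X\<close> with the ramification
  index at a point, and \<open>Y\<close> with \<open>e = 1\<close> at a ramified point.\<close>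

lemma subdegree_eval1_at:
  assumes X: "reduces X a" and e: "fls_subdegree (X - fls_const a) = int e" "e > 0" and q: "q \<noteq> 0"
  shows "fls_subdegree (eval1 fls_const X q) = int e * int (order a q)" "eval1 fls_const X q \<noteq> 0"
proof -
  obtain q1 where q1: "q = [:-a, 1:] ^ order a q * q1" "\<not> [:-a, 1:] dvd q1"
    using order_decomp[OF q] by blast
  have "poly q1 a \<noteq> 0" using q1(2) by (simp add: poly_eq_0_iff_dvd)
  with reduces_eval1[OF X, of q1]
  have u: "eval1 fls_const X q1 \<noteq> 0" "fls_subdegree (eval1 fls_const X q1) = 0"
    by (auto dest: reduces_nonzero)
  have nz: "X - fls_const a \<noteq> 0" using e by auto
  have "eval1 fls_const X q = (X - fls_const a) ^ order a q * eval1 fls_const X q1"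
    by (subst q1(1)) (simp add: algebra_simps)
  with u nz e show "fls_subdegree (eval1 fls_const X q) = int e * int (order a q)"
    "eval1 fls_const X q \<noteq> 0"
    by (auto simp: fls_subdegree_pow)
qed

text \<open>In Horner form \<open>X q(X)\<close> has a pole, and adding a constant does not change
  its order.\<close>

lemma subdegree_eval1_pole:
  assumes X: "fls_subdegree X = -1" and q: "q \<noteq> 0"
  shows "fls_subdegree (eval1 fls_const X q) = - int (degree q) \<and> eval1 fls_const X q \<noteq> 0"
  using q
proof (induction q)
  case 0
  then show ?case by simp
next
  case (pCons a q)
  show ?case
  proof (cases "q = 0")
    case True
    then show ?thesis using pCons by simp
  next
    case False
    have X0: "X \<noteq> 0" using X by auto
    have *: "fls_subdegree (X * eval1 fls_const X q) = - 1 - int (degree q)"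
      "X * eval1 fls_const X q \<noteq> 0"
      using pCons.IH[OF False] X X0 by auto
    then have "fls_subdegree (X * eval1 fls_const X q + fls_const a) = - 1 - int (degree q)"
      by (subst fls_subdegree_add_eq1) auto
    then have "fls_subdegree (eval1 fls_const X (pCons a q)) = - int (degree (pCons a q))"
      using False by (simp add: add.commute)
    moreover from this have "eval1 fls_const X (pCons a q) \<noteq> 0"
      using False by auto
    ultimately show ?thesis by blast
  qed
qed

lemma parametrizes_equation: "parametrizes n Q X Y \<Longrightarrow> X ^ n + Y ^ n = 1"
  by (cases Q) auto

text \<open>Here \<open>(X - a) h = X^n - a^n = - Y^n\<close>, where \<open>h\<close> reduces to
  \<open>n a^(n-1)\<close> and is a unit, and \<open>Y\<close> has order 1.\<close>

lemma ramified_subdegree: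
  assumes "n > 0" "on_curve n (Aff a 0)" and par: "parametrizes n (Aff a 0) X Y"
  shows "fls_subdegree (X - fls_const a) = int n"
proof -
  have an: "a ^ n = 1" using assms(1,2) by (simp add: power_0_left)
  then have a0: "a \<noteq> 0" using \<open>n > 0\<close> by (auto simp: power_0_left)
  define h where "h = (\<Sum>i<n. fls_const a ^ (n - Suc i) * X ^ i)"
  have "reduces h (\<Sum>i<n. a ^ (n - Suc i) * a ^ i)" unfolding h_def
    using par by (intro reduces_sum reduces_mult reduces_power) auto
  also have "(\<Sum>i<n. a ^ (n - Suc i) * a ^ i) = (\<Sum>i<n. a ^ (n - 1))"
    by (intro sum.cong) (simp_all add: power_add[symmetric])
  finally have "reduces h (of_nat n * a ^ (n - 1))" by simp
  then have h: "h \<noteq> 0" "fls_subdegree h = 0"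
    using reduces_nonzero[of h "of_nat n * a ^ (n - 1)"] a0 \<open>n > 0\<close> by auto
  have "(X - fls_const a) * h = X ^ n - fls_const a ^ n"
    by (simp add: h_def power_diff_sumr2)
  also have "\<dots> = - (Y ^ n)"
  proof -
    have "fls_const a ^ n = 1" by (simp only: fls_const_power[symmetric] an fls_const_1)
    then show ?thesis using parametrizes_equation[OF par] by (simp add: algebra_simps)
  qed
  finally have *: "(X - fls_const a) * h = - (Y ^ n)" .
  have Y: "fls_subdegree Y = 1" using par by simp
  then have "Y \<noteq> 0" by auto
  with * have "X - fls_const a \<noteq> 0" by auto
  then have "fls_subdegree ((X - fls_const a) * h) = fls_subdegree (X - fls_const a)"
    using h by simp
  then show ?thesis using * Y by (simp add: fls_subdegree_pow)
qed

definition ram_index :: "nat \<Rightarrow> complex \<Rightarrow> nat" where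
  "ram_index n b = (if b = 0 then n else 1)"

lemma parametrizes_affine:
  assumes "n > 0" "on_curve n (Aff a b)" "parametrizes n (Aff a b) X Y"
  shows "reduces X a" "reduces Y b" "fls_subdegree (X - fls_const a) = int (ram_index n b)"
    "ram_index n b > 0"
  using assms ramified_subdegree[of n a X Y] by (auto simp: ram_index_def)

text \<open>Some \<open>X - c\<close>, or \<open>X\<close> itself, has nonzero order, while
  constants have order 0. Hence denominators \<open>q(X)\<close> do not vanish when the
  parametrization is substituted into a fraction.\<close>

lemma parametrizes_transcendental:
  assumes "n > 0" "on_curve n Q" "parametrizes n Q X Y"
  shows "X \<notin> range fls_const"
proof
  assume "X \<in> range fls_const"
  then obtain c where c: "X = fls_const c" by blast
  show False
  proof (cases Q)
    case (Aff a b)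
    have "fls_subdegree (X - fls_const a) = int (ram_index n b)" "ram_index n b > 0"
      using parametrizes_affine[OF assms(1) assms(2,3)[unfolded Aff]] by blast+
    moreover have "fls_subdegree (X - fls_const a) = 0"
      unfolding c fls_minus_const by (rule fls_const_subdegree)
    ultimately show False by linarith
  next
    case (Inf f)
    then have "fls_subdegree X = -1" using assms(3) by (simp only: parametrizes.simps)
    moreover have "fls_subdegree X = 0" unfolding c by (rule fls_const_subdegree)
    ultimately show False by linarith
  qed
qed

text \<open>Write \<open>p(X, Y) = s(Y) + (X - a) p'(X, Y)\<close> with
  \<open>s = specialize a p\<close>. The first summand has order at most
  \<open>degree p < n\<close>, the second is 0 or has order at least \<open>n\<close>, so they
  cannot cancel.\<close>

lemma eval2_ramified:
  assumes n: "n > 0" and Q: "on_curve n (Aff a 0)" and par: "parametrizes n (Aff a 0) X Y"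
    and p: "specialize a p \<noteq> 0" "degree p < n"
  shows "eval2 fls_const X Y p \<noteq> 0"
    "fls_subdegree (eval2 fls_const X Y p) = int (order 0 (specialize a p))"
proof -
  let ?s = "specialize a p"
  obtain p' where p': "p = smult [:-a, 1:] p' + map_poly (\<lambda>c. [:c:]) ?s"
    by (rule specialize_split)
  define u where "u = (X - fls_const a) * eval2 fls_const X Y p'"
  define w where "w = eval1 fls_const Y ?s"
  have E: "eval2 fls_const X Y p = w + u"
    by (subst p') (simp add: u_def w_def algebra_simps)
  have Y: "reduces Y 0" "fls_subdegree (Y - fls_const 0) = int 1" using par by auto
  have w: "fls_subdegree w = int (order 0 ?s)" "w \<noteq> 0"
    using subdegree_eval1_at[OF Y _ p(1)] by (auto simp: w_def)
  have "order 0 ?s \<le> degree ?s" by (rule order_degree[OF p(1)])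
  then have lt: "order 0 ?s < n" using p(2) degree_specialize_le[of a p] by linarith
  have u: "u = 0 \<or> fls_subdegree u \<ge> int n"
  proof (cases "u = 0")
    case False
    then have nz: "X - fls_const a \<noteq> 0" "eval2 fls_const X Y p' \<noteq> 0" by (auto simp: u_def)
    have "reduces X a" "reduces Y 0" using par by auto
    then have "fls_subdegree (eval2 fls_const X Y p') \<ge> 0"
      using reduces_eval2 reduces_ex_iff by blast
    then show ?thesis using nz ramified_subdegree[OF n Q par] by (simp add: u_def)
  qed simp
  have "fls_subdegree (w + u) = fls_subdegree w"
  proof (cases "u = 0")
    case False
    then show ?thesis using u lt w by (intro fls_subdegree_add_eq1) auto
  qed simp
  then show "fls_subdegree (eval2 fls_const X Y p) = int (order 0 ?s)" using E w by simp
  have "w + u \<noteq> 0"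
  proof
    assume "w + u = 0"
    then have "u = - w" by (simp add: eq_neg_iff_add_eq_0 add.commute)
    then show False using u w lt by auto
  qed
  then show "eval2 fls_const X Y p \<noteq> 0" using E by simp
qed

text \<open>Factors \<open>X - a\<close> of \<open>p\<close> are split off until
  \<open>eval2_ramified\<close> applies. Total ramification plays the part of Eisenstein's criterion
  for \<open>Y^n + X^n - 1\<close>.\<close>

lemma eval2_ramified_nonzero:
  assumes n: "n > 0" and Q: "on_curve n (Aff a 0)" and par: "parametrizes n (Aff a 0) X Y"
    and p: "p \<noteq> 0" "degree p < n"
  shows "eval2 fls_const X Y p \<noteq> 0"
  using p
\<comment> \<open>Dividing \<open>p\<close> by \<open>X - a\<close> lowers the degree of its leading
  coefficient by one.\<close>
proof (induction "degree (lead_coeff p)" arbitrary: p rule: less_induct)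
  case less
  show ?case
  proof (cases "specialize a p = 0")
    case False
    then show ?thesis using eval2_ramified(1)[OF n Q par] less.prems by blast
  next
    case True
    then obtain p' where p': "p = smult [:-a, 1:] p'"
      using specialize_split[of p a] by auto
    have "p' \<noteq> 0" using p' less.prems by auto
    moreover have "degree p' < n" using p' less.prems by auto
    moreover have "degree (lead_coeff p') < degree (lead_coeff p)"
      using p' \<open>p' \<noteq> 0\<close> by (simp add: degree_mult_eq del: mult_pCons_left)
    ultimately have "eval2 fls_const X Y p' \<noteq> 0" using less.hyps by blast
    moreover have "X - fls_const a \<noteq> 0"
      using ramified_subdegree[OF n Q par] n by auto
    ultimately show ?thesis by (simp add: p' algebra_simps)
  qed
qed

section \<open>The function field\<close>

definition curve_poly :: "nat \<Rightarrow> complex poly poly" where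
  "curve_poly n = monom 1 n + [:monom 1 n - 1:]"

lemma degree_curve_poly: "n > 0 \<Longrightarrow> degree (curve_poly n) = n"
  unfolding curve_poly_def by (subst degree_add_eq_left) (auto simp: degree_monom_eq)

lemma (in constant_field) eval2_curve_poly [simp]:
  "eval2 \<iota> x y (curve_poly n) = x ^ n + y ^ n - 1"
  by (simp add: curve_poly_def algebra_simps)

lemma curve_poly_remainder:
  assumes "n > 0"
  obtains c q r where "c \<noteq> 0" "smult c p = curve_poly n * q + r" "degree r < n"
proof -
  have d: "degree (curve_poly n) = n" "curve_poly n \<noteq> 0"
    using degree_curve_poly[OF assms] assms by auto
  with pseudo_mod[OF d(2), of p] obtain c q where
    "c \<noteq> 0" "smult c p = curve_poly n * q + pseudo_mod p (curve_poly n)" by blast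
  moreover have "degree (pseudo_mod p (curve_poly n)) < n"
    using pseudo_mod(2)[OF d(2), of p] d assms by auto
  ultimately show thesis by (rule that)
qed

locale fermat = constant_field \<iota> for \<iota> :: "complex \<Rightarrow> 'a::field" +
  fixes n :: nat and x y :: 'a
  assumes n_pos: "n > 0" and x_transcendental: "x \<notin> range \<iota>" and equation: "x ^ n + y ^ n = 1"
begin

abbreviation E1 :: "complex poly \<Rightarrow> 'a" where "E1 \<equiv> eval1 \<iota> x"
abbreviation E2 :: "complex poly poly \<Rightarrow> 'a" where "E2 \<equiv> eval2 \<iota> x y"

lemma E1_eq_0_iff [simp]: "E1 q = 0 \<longleftrightarrow> q = 0"
  using eval1_nonzero[OF x_transcendental] by auto

text \<open>This is the independence of \<open>1, y, ..., y^(n-1)\<close> over the rational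
  functions in \<open>x\<close>. For a relation \<open>p\<close>, the pseudo-remainder of the curve
  polynomial by \<open>p\<close> is a relation of smaller degree, hence 0 by induction. So a
  multiple of the curve polynomial factors as \<open>p q\<close> with both degrees below
  \<open>n\<close>. Along a totally ramified point the product vanishes and its factors do
  not.\<close>

lemma E2_nonzero:
  assumes "p \<noteq> 0" "degree p < n"
  shows "E2 p \<noteq> 0"
  using assms
proof (induction "degree p" arbitrary: p rule: less_induct)
  case less
  show ?case
  proof
    assume zero: "E2 p = 0"
    have deg: "degree p > 0"
    proof (rule ccontr)
      assume "\<not> degree p > 0"
      then obtain r where "p = [:r:]" by (metis degree_eq_zeroE gr0I)
      then show False using zero less.prems by simp
    qed
    obtain c q where cq: "c \<noteq> 0" "smult c (curve_poly n) = p * q + pseudo_mod (curve_poly n) p"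
      using pseudo_mod(1)[OF less.prems(1)] by blast
    define r where "r = pseudo_mod (curve_poly n) p"
    have "E2 (smult c (curve_poly n)) = 0" using equation by simp
    then have "E2 r = 0" using cq zero by (simp add: r_def)
    moreover have "r = 0 \<or> degree r < degree p"
      using pseudo_mod(2)[OF less.prems(1)] by (simp add: r_def)
    ultimately have "r = 0" using less.hyps less.prems by fastforce
    then have cq': "smult c (curve_poly n) = p * q" using cq by (simp add: r_def)
    have "curve_poly n \<noteq> 0" using degree_curve_poly[OF n_pos] n_pos by auto
    then have "q \<noteq> 0" using cq' cq by auto
    moreover have "degree q < n"
    proof -
      have "degree (smult c (curve_poly n)) = n" using degree_curve_poly[OF n_pos] cq(1) by simp
      then have "degree p + degree q = n" using cq' less.prems \<open>q \<noteq> 0\<close> by (simp add: degree_mult_eq)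
      then show ?thesis using deg by simp
    qed
    \<comment> \<open>The point \<open>(1 : 0 : 1)\<close> is a totally ramified point that exists
      for every \<open>n\<close>.\<close>
    moreover have Q: "on_curve n (Aff 1 0)" using n_pos by simp
    moreover obtain X Y where par: "parametrizes n (Aff 1 0) X Y"
      using parametrization_exists[OF n_pos Q] by blast
    ultimately have "eval2 fls_const X Y p * eval2 fls_const X Y q \<noteq> 0"
      using eval2_ramified_nonzero[OF n_pos Q par] less.prems by auto
    moreover have "eval2 fls_const X Y (p * q) = 0"
      unfolding cq'[symmetric] using parametrizes_equation[OF par] by simp
    ultimately show False by simp
  qed
qed

text \<open>Up to a nonzero factor in \<open>x\<close>, a relation between \<open>x\<close> and
  \<open>y\<close> is a multiple of the equation of the curve, so it passes to every other solution
  with transcendental \<open>X\<close>.\<close>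

lemma E2_kernel:
  assumes "X \<notin> range fls_const" "X ^ n + Y ^ n = 1" "E2 p = 0"
  shows "eval2 fls_const X Y p = 0"
proof -
  obtain c q r where c: "c \<noteq> 0" "smult c p = curve_poly n * q + r" "degree r < n"
    using curve_poly_remainder[OF n_pos] by blast
  have "E2 (smult c p) = 0" using assms by simp
  then have "E2 r = 0" unfolding c(2) using equation by simp
  then have "r = 0" using E2_nonzero c(3) by blast
  then have "eval2 fls_const X Y (smult c p) = 0" unfolding c(2) using assms(2) by simp
  then show ?thesis using fls.eval1_nonzero[OF assms(1) c(1)] by simp
qed

text \<open>A nonzero multiple of \<open>E2 p\<close> of minimal \<open>y\<close>-degree has
  \<open>y\<close>-degree 0, since dividing the equation of the curve by it lowers the degree further.\<close>

lemma E2_inverse: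
  assumes "E2 p \<noteq> 0"
  obtains s r where "r \<noteq> 0" "E2 p * E2 s = E1 r"
proof -
  define P where "P = (\<lambda>k. \<exists>s r. degree r = k \<and> r \<noteq> 0 \<and> k < n \<and> E2 p * E2 s = E2 r)"
  have "\<exists>k. P k"
  proof -
    obtain c q r where c: "c \<noteq> 0" "smult c p = curve_poly n * q + r" "degree r < n"
      using curve_poly_remainder[OF n_pos] by blast
    have "E2 (smult c p) = E2 r" unfolding c(2) using equation by simp
    then have *: "E2 p * E2 [:c:] = E2 r" by (simp add: mult.commute)
    moreover have "r \<noteq> 0" using * assms c(1) by auto
    ultimately show ?thesis using c unfolding P_def by blast
  qed
  then have "P (LEAST k. P k)" by (rule LeastI_ex)
  then obtain s r where sr: "degree r = (LEAST k. P k)" "r \<noteq> 0" "degree r < n" "E2 p * E2 s = E2 r"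
    unfolding P_def by metis
  have "degree r = 0"
  proof (rule ccontr)
    assume dr: "degree r \<noteq> 0"
    define t where "t = pseudo_mod (curve_poly n) r"
    obtain c q where cq: "c \<noteq> 0" "smult c (curve_poly n) = r * q + t"
      using pseudo_mod(1)[OF sr(2)] unfolding t_def by blast
    have t: "t = 0 \<or> degree t < degree r"
      using pseudo_mod(2)[OF sr(2)] by (simp add: t_def)
    have "E2 (smult c (curve_poly n)) = 0" using equation by simp
    then have "E2 t = - (E2 r * E2 q)" using cq by (simp add: eq_neg_iff_add_eq_0 add.commute)
    also have "\<dots> = E2 p * E2 (- s * q)" using sr(4) by (simp add: algebra_simps)
    finally have *: "E2 p * E2 (- s * q) = E2 t" by simp
    have "t = 0"
    proof (rule ccontr)
      assume "t \<noteq> 0"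
      then have "P (degree t)" using t sr(3) * unfolding P_def by (metis order.strict_trans)
      then show False using t \<open>t \<noteq> 0\<close> sr(1) not_less_Least by fastforce
    qed
    then have "E2 r * E2 q = 0" using \<open>E2 t = - (E2 r * E2 q)\<close> by simp
    then have "E2 q = 0" using E2_nonzero[OF sr(2,3)] by simp
    moreover have "curve_poly n \<noteq> 0" using degree_curve_poly[OF n_pos] n_pos by auto
    then have "q \<noteq> 0" using cq \<open>t = 0\<close> by auto
    moreover have "degree q < n"
    proof -
      have "degree (smult c (curve_poly n)) = n" using degree_curve_poly[OF n_pos] cq(1) by simp
      then have "degree r + degree q = n" using cq \<open>t = 0\<close> sr(2) \<open>q \<noteq> 0\<close> by (simp add: degree_mult_eq)
      then show ?thesis using dr by simp
    qed
    ultimately show False using E2_nonzero by blast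
  qed
  then obtain r' where "r = [:r':]" by (metis degree_eq_zeroE)
  then show thesis using that[of r' s] sr by simp
qed

text \<open>Denominators in \<open>x\<close> alone give a field, because by
  \<open>E2_inverse\<close> every nonzero \<open>p(x, y)\<close> has a multiple that is a nonzero
  polynomial in \<open>x\<close>.\<close>

definition F :: "'a set" where
  "F = {E2 p / E1 q | p q. q \<noteq> 0}"

lemma F_I: "q \<noteq> 0 \<Longrightarrow> E2 p / E1 q \<in> F"
  unfolding F_def by blast

lemma F_E:
  assumes "z \<in> F"
  obtains p q where "q \<noteq> 0" "z = E2 p / E1 q"
  using assms unfolding F_def by blast

lemma E2_in_F [simp, intro]: "E2 p \<in> F" and E1_in_F [simp, intro]: "E1 q \<in> F"
  using F_I[of 1 p] F_I[of 1 "[:q:]"] by simp_all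

lemma F_constants [simp, intro]: "\<iota> c \<in> F" and F_x [simp, intro]: "x \<in> F" and F_y [simp, intro]: "y \<in> F"
  and F_0 [simp, intro]: "0 \<in> F" and F_1 [simp, intro]: "1 \<in> F"
  using E1_in_F[of "[:c:]"] E1_in_F[of "[:0, 1:]"] E2_in_F[of "[:0, 1:]"] E1_in_F[of 0] E1_in_F[of 1]
  by simp_all

lemma F_mult [simp, intro]: "z \<in> F \<Longrightarrow> w \<in> F \<Longrightarrow> z * w \<in> F"
proof -
  assume "z \<in> F" "w \<in> F"
  then obtain p q r s where "q \<noteq> 0" "s \<noteq> 0" "z = E2 p / E1 q" "w = E2 r / E1 s" by (metis F_E)
  then show "z * w \<in> F" using F_I[of "q * s" "p * r"] by simp
qed

lemma F_diff [simp, intro]: "z \<in> F \<Longrightarrow> w \<in> F \<Longrightarrow> z - w \<in> F"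
proof -
  assume "z \<in> F" "w \<in> F"
  then obtain p q r s where *: "q \<noteq> 0" "s \<noteq> 0" "z = E2 p / E1 q" "w = E2 r / E1 s" by (metis F_E)
  have "z - w = E2 (smult s p - smult q r) / E1 (q * s)"
    unfolding *(3,4) using *(1,2) by (subst diff_frac_eq) (simp_all add: mult_ac)
  also have "\<dots> \<in> F" using * by (intro F_I) simp
  finally show "z - w \<in> F" .
qed

lemma F_add [simp, intro]: "z \<in> F \<Longrightarrow> w \<in> F \<Longrightarrow> z + w \<in> F"
  using F_diff[of z "0 - w"] F_diff[of 0 w] by simp

lemma F_inverse [simp, intro]: "z \<in> F \<Longrightarrow> inverse z \<in> F"
proof -
  assume "z \<in> F"
  then obtain p q where *: "q \<noteq> 0" "z = E2 p / E1 q" by (metis F_E)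
  show "inverse z \<in> F"
  proof (cases "E2 p = 0")
    case False
    then obtain s r where sr: "r \<noteq> 0" "E2 p * E2 s = E1 r" by (rule E2_inverse)
    have "E1 r \<noteq> 0" using sr by simp
    then have "E2 s \<noteq> 0" using sr(2) by auto
    have "inverse z = E2 (smult q s) / E1 r"
      using * False \<open>E2 s \<noteq> 0\<close> unfolding *(2) sr(2)[symmetric] by simp
    also have "\<dots> \<in> F" using sr(1) by (rule F_I)
    finally show ?thesis .
  qed (use * in simp)
qed

lemma F_divide [simp, intro]: "z \<in> F \<Longrightarrow> w \<in> F \<Longrightarrow> z / w \<in> F"
  by (simp add: divide_inverse)

lemma F_power [simp, intro]: "z \<in> F \<Longrightarrow> z ^ k \<in> F"
  by (induction k) auto

lemma is_subfield_F: "is_subfield F"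
  by (auto simp: is_subfield_def is_subring_def)

lemma subfield_contains_F:
  assumes L: "is_subfield L" "range \<iota> \<subseteq> L" "x \<in> L" "y \<in> L"
  shows "F \<subseteq> L"
proof
  have d: "a - b \<in> L" and m: "a * b \<in> L" if "a \<in> L" "b \<in> L" for a b
    using L(1) that by (auto simp: is_subfield_def is_subring_def)
  have p: "a + b \<in> L" if "a \<in> L" "b \<in> L" for a b
    using d[OF that(1) d[OF d[OF that(1) that(1)] that(2)]] by simp
  have c: "\<iota> c \<in> L" for c using L(2) by auto
  have zero: "0 \<in> L" using c[of 0] by simp
  have e1: "E1 q \<in> L" for q
    by (induction q) (auto intro!: p m c zero L)
  have "E2 p \<in> L" for p
    by (induction p) (auto intro!: p m e1 zero L)
  moreover have "inverse a \<in> L" if "a \<in> L" for a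
    using L(1) that by (auto simp: is_subfield_def)
  ultimately show "z \<in> L" if "z \<in> F" for z
    using that e1 unfolding F_def by (auto simp: divide_inverse intro!: m)
qed

lemma adjoin_eq_F: "adjoin \<iota> {x, y} = F"
proof
  show "adjoin \<iota> {x, y} \<subseteq> F"
    unfolding adjoin_def by (rule hull_minimal) (auto simp: is_subfield_F)
  show "F \<subseteq> adjoin \<iota> {x, y}"
    unfolding adjoin_def hull_def
  proof (rule Inter_greatest)
    fix L assume "L \<in> {t. is_subfield t \<and> range \<iota> \<union> {x, y} \<subseteq> t}"
    then show "F \<subseteq> L" by (intro subfield_contains_F) auto
  qed
qed

text \<open>The homomorphism over the constants that sends \<open>x\<close> to \<open>X\<close> and
  \<open>y\<close> to \<open>Y\<close>. The choice ranges over all ways to write \<open>z\<close> as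
  a fraction; \<open>E2_kernel\<close> makes the result independent of it.\<close>

definition hom_to :: "complex fls \<Rightarrow> complex fls \<Rightarrow> 'a \<Rightarrow> complex fls" where
  "hom_to X Y z = (SOME w. \<exists>p q. q \<noteq> 0 \<and> z = E2 p / E1 q \<and>
     w = eval2 fls_const X Y p / eval1 fls_const X q)"

lemma hom_to_eq:
  assumes X: "X \<notin> range fls_const" and eq: "X ^ n + Y ^ n = 1" and q: "q \<noteq> 0"
  shows "hom_to X Y (E2 p / E1 q) = eval2 fls_const X Y p / eval1 fls_const X q"
  unfolding hom_to_def
proof (rule some_equality)
  show "\<exists>p' q'. q' \<noteq> 0 \<and> E2 p / E1 q = E2 p' / E1 q' \<and>
    eval2 fls_const X Y p / eval1 fls_const X q = eval2 fls_const X Y p' / eval1 fls_const X q'"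
    using q by blast
next
  fix w assume "\<exists>p' q'. q' \<noteq> 0 \<and> E2 p / E1 q = E2 p' / E1 q' \<and>
    w = eval2 fls_const X Y p' / eval1 fls_const X q'"
  then obtain p' q' where *: "q' \<noteq> 0" "E2 p / E1 q = E2 p' / E1 q'"
    "w = eval2 fls_const X Y p' / eval1 fls_const X q'" by blast
  then have "E2 (smult q' p - smult q p') = 0" using q by (simp add: field_simps)
  from E2_kernel[OF X eq this] have "eval1 fls_const X q' * eval2 fls_const X Y p =
    eval1 fls_const X q * eval2 fls_const X Y p'" by simp
  moreover have "eval1 fls_const X q \<noteq> 0" "eval1 fls_const X q' \<noteq> 0"
    using q * fls.eval1_nonzero[OF X] by auto
  ultimately show "w = eval2 fls_const X Y p / eval1 fls_const X q"
    unfolding *(3) by (subst frac_eq_eq) (auto simp: mult_ac)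
qed

end

section \<open>Laurent expansions\<close>

context fermat
begin

lemma F_uminus [simp, intro]: "z \<in> F \<Longrightarrow> - z \<in> F"
  using F_diff[of 0 z] by simp

definition X_at :: "point \<Rightarrow> complex fls" where
  "X_at Q = fst (SOME (X, Y). parametrizes n Q X Y)"

definition Y_at :: "point \<Rightarrow> complex fls" where
  "Y_at Q = snd (SOME (X, Y). parametrizes n Q X Y)"

lemma parametrizes_at:
  assumes "on_curve n Q"
  shows "parametrizes n Q (X_at Q) (Y_at Q)"
proof -
  have "\<exists>XY. case XY of (X, Y) \<Rightarrow> parametrizes n Q X Y"
    using parametrization_exists[OF n_pos assms] by auto
  then have "case (SOME (X, Y). parametrizes n Q X Y) of (X, Y) \<Rightarrow> parametrizes n Q X Y"
    by (rule someI_ex)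
  then show ?thesis by (simp add: X_at_def Y_at_def split_beta)
qed

definition expansion :: "point \<Rightarrow> 'a \<Rightarrow> complex fls" where
  "expansion Q = hom_to (X_at Q) (Y_at Q)"

text \<open>The zero function gets order 0, the subdegree of the zero series. This is why
  \<open>place_at\<close> below is defined by \<open>reduces\<close>, which puts 0 into the
  place.\<close>

definition ord_at :: "point \<Rightarrow> 'a \<Rightarrow> int" where
  "ord_at Q z = fls_subdegree (expansion Q z)"

definition place_at :: "point \<Rightarrow> 'a set" where
  "place_at Q = {z \<in> F. reduces (expansion Q z) 0}"

context
  fixes Q :: point
  assumes Q: "on_curve n Q"
begin

lemma X_at_transcendental: "X_at Q \<notin> range fls_const"
  by (rule parametrizes_transcendental[OF n_pos Q parametrizes_at[OF Q]])

lemma XY_equation: "X_at Q ^ n + Y_at Q ^ n = 1"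
  by (rule parametrizes_equation[OF parametrizes_at[OF Q]])

lemma expansion_frac:
  "q \<noteq> 0 \<Longrightarrow> expansion Q (E2 p / E1 q) = eval2 fls_const (X_at Q) (Y_at Q) p / eval1 fls_const (X_at Q) q"
  unfolding expansion_def by (rule hom_to_eq[OF X_at_transcendental XY_equation])

lemma expansion_E2 [simp]: "expansion Q (E2 p) = eval2 fls_const (X_at Q) (Y_at Q) p"
  using expansion_frac[of 1 p] by simp

lemma expansion_E1 [simp]: "expansion Q (E1 q) = eval1 fls_const (X_at Q) q"
  using expansion_E2[of "[:q:]"] by simp

lemma expansion_E1_nonzero: "q \<noteq> 0 \<Longrightarrow> eval1 fls_const (X_at Q) q \<noteq> 0"
  by (rule fls.eval1_nonzero[OF X_at_transcendental])

lemma expansion_simps [simp]: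
  "expansion Q (\<iota> c) = fls_const c" "expansion Q x = X_at Q" "expansion Q y = Y_at Q"
  "expansion Q 0 = 0" "expansion Q 1 = 1"
  using expansion_E1[of "[:c:]"] expansion_E1[of "[:0, 1:]"] expansion_E2[of "[:0, 1:]"]
    expansion_E1[of 0] expansion_E1[of 1]
  by (simp_all del: expansion_E1 expansion_E2)

lemma expansion_mult [simp]:
  assumes "z \<in> F" "w \<in> F"
  shows "expansion Q (z * w) = expansion Q z * expansion Q w"
proof -
  obtain p q r s where *: "q \<noteq> 0" "s \<noteq> 0" "z = E2 p / E1 q" "w = E2 r / E1 s"
    using assms by (metis F_E)
  then have "expansion Q (E2 (p * r) / E1 (q * s)) =
    eval2 fls_const (X_at Q) (Y_at Q) (p * r) / eval1 fls_const (X_at Q) (q * s)"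
    by (intro expansion_frac) simp
  then show ?thesis using * by (simp add: expansion_frac)
qed

lemma expansion_diff [simp]:
  assumes "z \<in> F" "w \<in> F"
  shows "expansion Q (z - w) = expansion Q z - expansion Q w"
proof -
  obtain p q r s where *: "q \<noteq> 0" "s \<noteq> 0" "z = E2 p / E1 q" "w = E2 r / E1 s"
    using assms by (metis F_E)
  have "z - w = E2 (smult s p - smult q r) / E1 (q * s)"
    unfolding *(3,4) using *(1,2) by (subst diff_frac_eq) (simp_all add: mult_ac)
  then have "expansion Q (z - w) =
    eval2 fls_const (X_at Q) (Y_at Q) (smult s p - smult q r) / eval1 fls_const (X_at Q) (q * s)"
    using * by (simp only: expansion_frac mult_eq_0_iff de_Morgan_disj not_False_eq_True conj_absorb)
  also have "\<dots> = expansion Q z - expansion Q w"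
    unfolding *(3,4) expansion_frac[OF *(1)] expansion_frac[OF *(2)]
    using expansion_E1_nonzero[OF *(1)] expansion_E1_nonzero[OF *(2)]
    by (subst diff_frac_eq) (simp_all add: mult_ac)
  finally show ?thesis .
qed

lemma expansion_add [simp]:
  assumes "z \<in> F" "w \<in> F"
  shows "expansion Q (z + w) = expansion Q z + expansion Q w"
  using expansion_diff[of z "0 - w"] expansion_diff[of 0 w] assms by simp

lemma expansion_power [simp]: "z \<in> F \<Longrightarrow> expansion Q (z ^ k) = expansion Q z ^ k"
  by (induction k) auto

lemma expansion_eq_0_iff [simp]:
  assumes "z \<in> F"
  shows "expansion Q z = 0 \<longleftrightarrow> z = 0"
proof
  assume *: "expansion Q z = 0"
  show "z = 0"
  proof (rule ccontr)
    assume "z \<noteq> 0"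
    then have "expansion Q (z * inverse z) = 1" by simp
    then show False using * assms by (simp del: right_inverse)
  qed
qed simp

lemma expansion_inverse [simp]:
  assumes "z \<in> F"
  shows "expansion Q (inverse z) = inverse (expansion Q z)"
proof (cases "z = 0")
  case False
  then have "expansion Q z * expansion Q (inverse z) = 1"
    using assms by (simp flip: expansion_mult)
  then show ?thesis by (metis inverse_unique)
qed simp

lemma expansion_divide [simp]:
  "z \<in> F \<Longrightarrow> w \<in> F \<Longrightarrow> expansion Q (z / w) = expansion Q z / expansion Q w"
  by (simp add: divide_inverse)

lemma expansion_sum:
  "(\<And>i. i \<in> A \<Longrightarrow> f i \<in> F) \<Longrightarrow> sum f A \<in> F \<and> expansion Q (sum f A) = (\<Sum>i\<in>A. expansion Q (f i))"
  by (induction A rule: infinite_finite_induct) auto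

lemma ord_mult: "z \<in> F \<Longrightarrow> w \<in> F \<Longrightarrow> z \<noteq> 0 \<Longrightarrow> w \<noteq> 0 \<Longrightarrow> ord_at Q (z * w) = ord_at Q z + ord_at Q w"
  by (simp add: ord_at_def)

lemma ord_inverse: "z \<in> F \<Longrightarrow> ord_at Q (inverse z) = - ord_at Q z"
  using ord_mult[of z "inverse z"] by (cases "z = 0") (simp_all add: ord_at_def)

lemma ord_divide: "z \<in> F \<Longrightarrow> w \<in> F \<Longrightarrow> z \<noteq> 0 \<Longrightarrow> w \<noteq> 0 \<Longrightarrow> ord_at Q (z / w) = ord_at Q z - ord_at Q w"
  by (simp add: divide_inverse ord_mult ord_inverse)

lemma ord_const [simp]: "ord_at Q (\<iota> c) = 0"
  by (simp add: ord_at_def)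

lemma ord_power_int: "z \<in> F \<Longrightarrow> z \<noteq> 0 \<Longrightarrow> ord_at Q (z powi k) = k * ord_at Q z"
  by (cases k rule: int_cases2)
     (simp_all add: power_int_minus ord_inverse ord_at_def fls_subdegree_pow)

lemma place_at_iff: "z \<in> place_at Q \<longleftrightarrow> z \<in> F \<and> (z = 0 \<or> ord_at Q z > 0)"
  by (auto simp: place_at_def reduces_zero_iff ord_at_def)

lemma F_power_int [simp]: "z \<in> F \<Longrightarrow> z powi k \<in> F"
  by (simp add: power_int_def)

context
  fixes t
  assumes t: "t \<in> F" "ord_at Q t = 1"
begin

text \<open>The function \<open>t\<close> of order 1 makes both inclusions strict: \<open>t\<close>
  is a nonconstant element of the ring, and \<open>1/t\<close> lies outside it. Its existence stays
  an assumption until \<open>uniformizer_exists\<close>.\<close>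

lemma place_at_is_place: "place \<iota> F (place_at Q)"
proof -
  define R where "R = {z \<in> F. ord_at Q z \<ge> 0}"
  have t0: "t \<noteq> 0" using t Q by (auto simp: ord_at_def)
  have "is_subring R"
    unfolding is_subring_def
  proof (intro conjI ballI)
    fix a b assume ab: "a \<in> R" "b \<in> R"
    then obtain c d where "reduces (expansion Q a) c" "reduces (expansion Q b) d"
      by (auto simp: R_def ord_at_def reduces_ex_iff[symmetric])
    then have "reduces (expansion Q a - expansion Q b) (c - d)" "reduces (expansion Q a * expansion Q b) (c * d)"
      by auto
    then show "a - b \<in> R" "a * b \<in> R"
      using ab reduces_ex_iff by (auto simp: R_def ord_at_def)
  qed (auto simp: R_def ord_at_def)
  moreover have "range \<iota> \<subseteq> R" by (auto simp: R_def)
  moreover have "t \<in> R" using t by (simp add: R_def)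
  moreover have "t \<notin> range \<iota>" using t by auto
  moreover have "R \<subseteq> F" by (auto simp: R_def)
  moreover have "inverse t \<in> F - R" using t by (simp add: R_def ord_inverse)
  moreover have "\<forall>z\<in>F. z \<in> R \<or> inverse z \<in> R" by (auto simp: R_def ord_inverse)
  ultimately have "valuation_ring \<iota> F R" unfolding valuation_ring_def by blast
  moreover have "place_at Q = R - units_in R"
    by (auto simp: place_at_iff R_def units_in_def ord_inverse) (simp add: ord_at_def)
  ultimately show ?thesis unfolding place_def by blast
qed

lemma ring_of_place_at: "ring_of_place F (place_at Q) = {z \<in> F. ord_at Q z \<ge> 0}"
  by (auto simp: ring_of_place_def place_at_iff ord_inverse) (simp add: ord_at_def)

lemma units_of_place_at: "units_in (ring_of_place F (place_at Q)) = {z \<in> F. z \<noteq> 0 \<and> ord_at Q z = 0}"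
  by (auto simp: ring_of_place_at units_in_def ord_inverse)

lemma prime_element_iff: "prime_element F (place_at Q) s \<longleftrightarrow> s \<in> F \<and> ord_at Q s = 1"
proof
  assume s: "s \<in> F \<and> ord_at Q s = 1"
  then have s0: "s \<noteq> 0" using Q by (auto simp: ord_at_def)
  show "prime_element F (place_at Q) s"
    unfolding prime_element_def
  proof (intro equalityI subsetI)
    fix z assume z: "z \<in> place_at Q"
    then have "z = s * (z / s)" "z / s \<in> ring_of_place F (place_at Q)"
      using s s0 by (cases "z = 0"; auto simp: ring_of_place_at place_at_iff ord_divide; simp add: ord_at_def)+
    then show "z \<in> (\<lambda>w. s * w) ` ring_of_place F (place_at Q)" by blast
  next
    fix z assume "z \<in> (\<lambda>w. s * w) ` ring_of_place F (place_at Q)"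
    then obtain w where "w \<in> F" "ord_at Q w \<ge> 0" "z = s * w" by (auto simp: ring_of_place_at)
    then show "z \<in> place_at Q" using s s0 by (cases "w = 0") (auto simp: place_at_iff ord_mult)
  qed
next
  assume "prime_element F (place_at Q) s"
  then have P: "place_at Q = (\<lambda>w. s * w) ` ring_of_place F (place_at Q)"
    by (simp add: prime_element_def)
  have "1 \<in> ring_of_place F (place_at Q)" by (simp add: ring_of_place_at ord_at_def)
  then have s: "s \<in> place_at Q" by (subst P) force
  have "t \<in> place_at Q" using t by (simp add: place_at_iff)
  then obtain w where w: "w \<in> F" "ord_at Q w \<ge> 0" "t = s * w"
    using P by (auto simp: ring_of_place_at)
  have "t \<noteq> 0" using t by (auto simp: ord_at_def)
  then have "s \<noteq> 0" "w \<noteq> 0" using w by auto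
  then have "ord_at Q s + ord_at Q w = 1" using t w s by (simp add: ord_mult place_at_iff)
  then show "s \<in> F \<and> ord_at Q s = 1" using s w \<open>s \<noteq> 0\<close> by (auto simp: place_at_iff)
qed

lemma val_place_at:
  assumes z: "z \<in> F" "z \<noteq> 0"
  shows "val F (place_at Q) z = ord_at Q z"
  unfolding val_def
proof (rule the_equality)
  let ?k = "ord_at Q z"
  have t0: "t \<noteq> 0" using t Q by (auto simp: ord_at_def)
  have "z = t powi ?k * (z / t powi ?k)" using t0 by simp
  moreover have "z / t powi ?k \<in> units_in (ring_of_place F (place_at Q))"
    using t t0 z by (simp add: units_of_place_at ord_divide ord_power_int)
  ultimately show "\<exists>t u. prime_element F (place_at Q) t \<and>
      u \<in> units_in (ring_of_place F (place_at Q)) \<and> z = t powi ?k * u"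
    using t prime_element_iff by blast
next
  fix k assume "\<exists>t u. prime_element F (place_at Q) t \<and>
      u \<in> units_in (ring_of_place F (place_at Q)) \<and> z = t powi k * u"
  then obtain s u where su: "s \<in> F" "ord_at Q s = 1" "u \<in> F" "u \<noteq> 0" "ord_at Q u = 0" "z = s powi k * u"
    by (auto simp: prime_element_iff units_of_place_at)
  then have "s \<noteq> 0" using Q by (auto simp: ord_at_def)
  then show "k = ord_at Q z" using su by (simp add: ord_mult ord_power_int)
qed

end

end

text \<open>This is \<open>(z^n - b^n) / (z - b)\<close>, expanded so that it visibly lies in every
  ring containing \<open>z\<close> and the constants. Where \<open>z\<close> reduces to
  \<open>b\<close> it reduces to \<open>n b^(n-1)\<close>, which is nonzero for
  \<open>b \<noteq> 0\<close>.\<close>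

definition power_quotient :: "complex \<Rightarrow> 'a \<Rightarrow> 'a" where
  "power_quotient b z = (\<Sum>i<n. \<iota> (b ^ (n - Suc i)) * z ^ i)"

lemma power_quotient: "(z - \<iota> b) * power_quotient b z = z ^ n - \<iota> (b ^ n)"
  by (simp add: power_quotient_def power_diff_sumr2)

lemma reduces_power_quotient:
  assumes "on_curve n Q" "z \<in> F" "reduces (expansion Q z) b"
  shows "reduces (expansion Q (power_quotient b z)) (of_nat n * b ^ (n - 1))"
proof -
  have "expansion Q (power_quotient b z) = (\<Sum>i<n. expansion Q (\<iota> (b ^ (n - Suc i)) * z ^ i))"
    unfolding power_quotient_def using assms by (intro expansion_sum[THEN conjunct2]) auto
  also have "\<dots> = (\<Sum>i<n. fls_const (b ^ (n - Suc i)) * expansion Q z ^ i)"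
    using assms by (simp del: \<iota>_power fls.\<iota>_power)
  finally have "reduces (expansion Q (power_quotient b z)) (\<Sum>i<n. b ^ (n - Suc i) * b ^ i)"
    using assms by (auto intro!: reduces_sum reduces_mult reduces_power)
  also have "(\<Sum>i<n. b ^ (n - Suc i) * b ^ i) = (\<Sum>i<n. b ^ (n - 1))"
    by (intro sum.cong) (simp_all add: power_add[symmetric])
  finally show ?thesis by simp
qed

end

section \<open>Classification of the places\<close>

locale fermat_place = fermat +
  fixes R
  assumes valuation_ring: "valuation_ring \<iota> F R"
begin

definition P :: "'a set" where "P = R - units_in R"

lemma R_facts: "is_subring R" "range \<iota> \<subset> R" "R \<subset> F" "\<forall>z\<in>F. z \<in> R \<or> inverse z \<in> R"
  using valuation_ring by (simp_all add: valuation_ring_def)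

lemma R_1 [simp, intro]: "1 \<in> R" and R_diff [intro]: "z \<in> R \<Longrightarrow> w \<in> R \<Longrightarrow> z - w \<in> R"
  and R_mult [intro]: "z \<in> R \<Longrightarrow> w \<in> R \<Longrightarrow> z * w \<in> R"
  using R_facts(1) by (simp_all add: is_subring_def)

lemma R_subset: "z \<in> R \<Longrightarrow> z \<in> F" and R_const [simp, intro]: "\<iota> c \<in> R"
  and R_total: "z \<in> F \<Longrightarrow> z \<in> R \<or> inverse z \<in> R" and R_neq: "R \<noteq> F"
  using R_facts(2-4) by blast+

lemma R_0 [simp, intro]: "0 \<in> R"
  using R_diff[OF R_1 R_1] by simp

lemma R_uminus [intro]: "z \<in> R \<Longrightarrow> - z \<in> R"
  using R_diff[OF R_0] by fastforce

lemma R_add [intro]: "z \<in> R \<Longrightarrow> w \<in> R \<Longrightarrow> z + w \<in> R"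
  using R_diff[OF _ R_uminus] by fastforce

lemma R_power [intro]: "z \<in> R \<Longrightarrow> z ^ k \<in> R"
  by (induction k) auto

lemma P_R: "z \<in> P \<Longrightarrow> z \<in> R"
  by (simp add: P_def)

lemma P_iff: "z \<in> P \<longleftrightarrow> z \<in> R \<and> (z = 0 \<or> inverse z \<notin> R)"
  by (auto simp: P_def units_in_def)

lemma P_0 [simp, intro]: "0 \<in> P"
  by (simp add: P_iff)

lemma P_mult: 
  assumes "z \<in> P" "w \<in> R"
  shows "z * w \<in> P"
proof (rule ccontr)
  assume *: "z * w \<notin> P"
  then have "inverse (z * w) \<in> R" "z \<noteq> 0" "w \<noteq> 0" using assms by (auto simp: P_iff)
  then have "w * inverse (z * w) \<in> R" using assms by auto
  also have "w * inverse (z * w) = inverse z" using \<open>z \<noteq> 0\<close> \<open>w \<noteq> 0\<close> by (simp add: field_simps)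
  finally show False using assms(1) \<open>z \<noteq> 0\<close> by (simp add: P_iff)
qed

lemma P_mult': "z \<in> R \<Longrightarrow> w \<in> P \<Longrightarrow> z * w \<in> P"
  using P_mult[of w z] by (simp add: mult.commute)

lemma P_uminus: "z \<in> P \<Longrightarrow> - z \<in> P"
  using P_mult'[of "-1" z] by auto

lemma P_add_aux:
  assumes "z \<in> P" "w \<in> P" "w \<noteq> 0" "z / w \<in> R"
  shows "z + w \<in> P"
proof -
  have "w * (z / w + 1) \<in> P" using assms by (intro P_mult) auto
  then show ?thesis using assms(3) by (simp add: algebra_simps)
qed

lemma P_add: 
  assumes "z \<in> P" "w \<in> P"
  shows "z + w \<in> P"
proof (cases "z = 0 \<or> w = 0")
  case False
  have "z / w \<in> R \<or> w / z \<in> R"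
    using R_total[of "z / w"] assms P_R R_subset by auto
  then show ?thesis
    using P_add_aux[of z w] P_add_aux[of w z] False assms by (auto simp: add.commute)
qed (use assms in auto)

lemma P_diff: "z \<in> P \<Longrightarrow> w \<in> P \<Longrightarrow> z - w \<in> P"
  using P_add[OF _ P_uminus] by fastforce

lemma P_const_iff: "\<iota> c \<in> P \<longleftrightarrow> c = 0"
  by (auto simp: P_iff simp flip: \<iota>_inverse)

lemma P_prime: "z * w \<in> P \<Longrightarrow> z \<in> R \<Longrightarrow> w \<in> R \<Longrightarrow> z \<in> P \<or> w \<in> P"
  by (auto simp: P_iff)

lemma inverse_in_R: "z \<in> R \<Longrightarrow> z \<notin> P \<Longrightarrow> inverse z \<in> R"
  by (auto simp: P_iff)

lemma inverse_in_P: "z \<in> F \<Longrightarrow> z \<notin> R \<Longrightarrow> inverse z \<in> P"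
  using R_total[of z] by (auto simp: P_iff)

text \<open>A case of valuation rings being integrally closed: otherwise
  \<open>1 = (1/z)^n z^n\<close> would lie in \<open>P\<close>.\<close>

lemma root_in_R:
  assumes "z \<in> F" "z ^ n \<in> R"
  shows "z \<in> R"
proof (rule ccontr)
  assume "z \<notin> R"
  then have *: "inverse z \<in> P" "z \<noteq> 0" using assms inverse_in_P by auto
  have "inverse z * (inverse z ^ (n - 1) * z ^ n) \<in> P"
    using * assms(2) by (intro P_mult) (auto intro: P_R)
  also have "inverse z * (inverse z ^ (n - 1) * z ^ n) = inverse z ^ n * z ^ n"
    using n_pos by (cases n) auto
  also have "\<dots> = 1" using * by (simp flip: power_mult_distrib)
  finally show False using P_const_iff[of 1] by simp
qed

text \<open>If \<open>z\<close> has no residue among the constants, then all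
  \<open>z - \<iota> a\<close> are units, and so is every product of them. The valuation is then
  trivial on rational functions of \<open>z\<close>.\<close>

lemma residue_or_units:
  assumes z: "z \<in> R" and no: "\<And>a. z - \<iota> a \<notin> P" and p: "p \<noteq> 0"
  shows "eval1 \<iota> z p \<in> R - P"
proof -
  have m: "u * w \<in> R - P" if "u \<in> R - P" "w \<in> R - P" for u w
    using that P_prime by blast
  have one: "1 \<in> R - P" using P_const_iff[of 1] by auto
  have pw: "u ^ k \<in> R - P" if "u \<in> R - P" for u k
    using one m[OF that] by (induction k) auto
  have zR: "z - \<iota> a \<in> R - P" for a using no z by auto
  have "(\<Prod>a\<in>A. (z - \<iota> a) ^ order a p) \<in> R - P" for A
  proof (induction A rule: infinite_finite_induct)
    case (insert a A)
    show ?case unfolding prod.insert[OF insert.hyps] by (rule m[OF pw[OF zR] insert.IH])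
  qed (use one in auto)
  moreover have "\<iota> (lead_coeff p) \<in> R - P" using p P_const_iff by auto
  ultimately show ?thesis by (subst eval1_decompose) (rule m)
qed

text \<open>Without a residue of \<open>z\<close> the element \<open>z^n - c\<close> of
  \<open>P\<close> would be a unit. With residue \<open>b\<close>, both \<open>z^n - c\<close> and
  \<open>z^n - b^n\<close> lie in \<open>P\<close>, and so does the constant
  \<open>b^n - c\<close>.\<close>

lemma residue_of_root:
  assumes z: "z \<in> R" and c: "z ^ n - \<iota> c \<in> P"
  obtains b where "z - \<iota> b \<in> P" "b ^ n = c"
proof -
  have "\<exists>b. z - \<iota> b \<in> P"
  proof (rule ccontr)
    assume no: "\<not> ?thesis"
    have "monom 1 n - [:c:] \<noteq> 0"
    proof
      assume "monom 1 n - [:c:] = 0"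
      then have "degree (monom 1 n :: complex poly) = degree [:c:]" by simp
      then show False using n_pos by (simp add: degree_monom_eq)
    qed
    from residue_or_units[OF z _ this] no have "eval1 \<iota> z (monom 1 n - [:c:]) \<notin> P" by blast
    then show False using c by simp
  qed
  then obtain b where b: "z - \<iota> b \<in> P" by blast
  have "(z - \<iota> b) * power_quotient b z \<in> P"
    unfolding power_quotient_def
  proof (rule P_mult[OF b])
    have "(\<Sum>i\<in>A. \<iota> (b ^ (n - Suc i)) * z ^ i) \<in> R" for A
      using z by (induction A rule: infinite_finite_induct) (auto intro!: R_add R_mult R_power simp del: \<iota>_power)
    then show "(\<Sum>i<n. \<iota> (b ^ (n - Suc i)) * z ^ i) \<in> R" .
  qed
  then have "z ^ n - \<iota> (b ^ n) \<in> P" by (simp only: power_quotient)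
  then have "(z ^ n - \<iota> c) - (z ^ n - \<iota> (b ^ n)) \<in> P" using c by (rule P_diff[rotated])
  then have "\<iota> (b ^ n - c) \<in> P" by simp
  then have "b ^ n = c" by (simp only: P_const_iff) simp
  then show thesis using b that by blast
qed

end

section \<open>Local rings of the points, and their normal form\<close>

context fermat
begin

text \<open>The local ring of \<open>Q\<close>, generated by two functions.  Defining it inductively lets one show by
  rule induction that each element is a constant plus a multiple of the local parameter.\<close>

inductive_set local_ring :: "'a \<Rightarrow> 'a \<Rightarrow> point \<Rightarrow> 'a set" for g h Q where
  const: "\<iota> c \<in> local_ring g h Q"
| gen1: "g \<in> local_ring g h Q"
| gen2: "h \<in> local_ring g h Q"
| add: "u \<in> local_ring g h Q \<Longrightarrow> w \<in> local_ring g h Q \<Longrightarrow> u + w \<in> local_ring g h Q"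
| mult: "u \<in> local_ring g h Q \<Longrightarrow> w \<in> local_ring g h Q \<Longrightarrow> u * w \<in> local_ring g h Q"
| inv: "u \<in> local_ring g h Q \<Longrightarrow> \<not> reduces (expansion Q u) 0 \<Longrightarrow> inverse u \<in> local_ring g h Q"

text \<open>A chart at \<open>Q\<close>: \<open>g - c\<close> is the local parameter,
  \<open>h - d\<close> is a multiple of it inside the local ring, and \<open>g\<close>,
  \<open>h\<close> generate the field. The pairs \<open>(x, y)\<close>, \<open>(y, x)\<close> and
  \<open>(1/x, y/x)\<close> will be such charts. The divisibility clause is the case of the
  generator \<open>h\<close> in the induction of \<open>LR_split\<close>.\<close>

definition local_coordinates :: "point \<Rightarrow> 'a \<Rightarrow> 'a \<Rightarrow> complex \<Rightarrow> complex \<Rightarrow> bool" where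
  "local_coordinates Q g h c d \<longleftrightarrow> on_curve n Q \<and> g \<in> F \<and> h \<in> F \<and> ord_at Q (g - \<iota> c) = 1 \<and>
     reduces (expansion Q h) d \<and> (\<exists>s\<in>local_ring g h Q. h - \<iota> d = (g - \<iota> c) * s) \<and>
     (\<forall>L. is_subfield L \<longrightarrow> range \<iota> \<subseteq> L \<longrightarrow> g \<in> L \<longrightarrow> h \<in> L \<longrightarrow> x \<in> L \<and> y \<in> L)"

context
  fixes Q g h c d
  assumes lc: "local_coordinates Q g h c d"
begin

lemma lc_Q: "on_curve n Q" and lc_F: "g \<in> F" "h \<in> F" and lc_ord: "ord_at Q (g - \<iota> c) = 1"
  and lc_h: "reduces (expansion Q h) d"
  using lc by (auto simp: local_coordinates_def)

abbreviation (input) "LR \<equiv> local_ring g h Q"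

abbreviation (input) "t \<equiv> g - \<iota> c"

lemma t_F: "t \<in> F" and t_nonzero: "t \<noteq> 0"
  using lc_F lc_ord lc_Q by (auto simp: ord_at_def)

lemma LR_uminus: "z \<in> LR \<Longrightarrow> - z \<in> LR"
  using local_ring.mult[OF local_ring.const[of "-1"]] by fastforce

lemma reduces_t: "reduces (expansion Q t) 0"
  using lc_ord by (simp add: reduces_zero_iff ord_at_def)

lemma reduces_g: "reduces (expansion Q g) c"
proof -
  have "reduces (expansion Q g - fls_const c) 0" using reduces_t lc_Q lc_F by simp
  from reduces_add[OF this reduces_const[of c]] show ?thesis by simp
qed

lemma LR_split:
  "z \<in> LR \<Longrightarrow> z \<in> F \<and> (\<exists>a. \<exists>w\<in>LR. reduces (expansion Q z) a \<and> z = \<iota> a + t * w)"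
proof (induction z rule: local_ring.induct)
  case (const a)
  have "\<iota> a = \<iota> a + t * \<iota> 0" by simp
  moreover have "reduces (expansion Q (\<iota> a)) a" using lc_Q by simp
  ultimately show ?case using local_ring.const by blast
next
  case gen1
  have "g = \<iota> c + t * \<iota> 1" by simp
  then show ?case using local_ring.const reduces_g lc_F by blast
next
  case gen2
  obtain s where s: "s \<in> LR" "h - \<iota> d = t * s" using lc by (auto simp: local_coordinates_def)
  then have "h = \<iota> d + t * s" by (simp add: algebra_simps)
  then show ?case using s lc_F lc_h by blast
next
  case (add u w)
  then obtain a b u' w' where *: "u' \<in> LR" "w' \<in> LR" "reduces (expansion Q u) a" "reduces (expansion Q w) b"
    "u = \<iota> a + t * u'" "w = \<iota> b + t * w'" "u \<in> F" "w \<in> F" by blast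
  have "u + w = \<iota> (a + b) + t * (u' + w')" by (subst *(5), subst *(6)) (simp add: algebra_simps)
  moreover have "reduces (expansion Q (u + w)) (a + b)" using * lc_Q by auto
  ultimately show ?case using * local_ring.add by blast
next
  case (mult u w)
  then obtain a b u' w' where *: "u' \<in> LR" "w' \<in> LR" "reduces (expansion Q u) a" "reduces (expansion Q w) b"
    "u = \<iota> a + t * u'" "w = \<iota> b + t * w'" "u \<in> F" "w \<in> F" by blast
  have "u * w = \<iota> (a * b) + t * (\<iota> a * w' + u' * w)" by (subst *(5), subst (1 2) *(6)) (simp add: algebra_simps)
  moreover have "reduces (expansion Q (u * w)) (a * b)" using * lc_Q by auto
  moreover have "\<iota> a * w' + u' * w \<in> LR"
    using * mult.hyps by (intro local_ring.add local_ring.mult local_ring.const)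
  ultimately show ?case using * by blast
next
  case (inv u)
  then obtain a u' where *: "u' \<in> LR" "reduces (expansion Q u) a" "u = \<iota> a + t * u'" "u \<in> F" by blast
  then have a: "a \<noteq> 0" using inv by auto
  have u0: "u \<noteq> 0" using inv.hyps lc_Q by auto
  \<comment> \<open>From \<open>u = a + t u'\<close> follows
    \<open>1/u - 1/a = - t u' / (a u)\<close>.\<close>
  have "inverse u = \<iota> (inverse a) + t * (- (\<iota> (inverse a) * inverse u * u'))"
  proof -
    have "u * (\<iota> (inverse a) + t * (- (\<iota> (inverse a) * inverse u * u'))) =
        \<iota> (inverse a) * (u - (u * inverse u) * (t * u'))"
      by (simp add: algebra_simps)
    also have "u * inverse u = 1" using u0 by simp
    also have "u - 1 * (t * u') = \<iota> a" using *(3) by (simp only: mult_1_left) (metis add_diff_cancel_right')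
    also have "\<iota> (inverse a) * \<iota> a = 1" using a by simp
    finally show ?thesis by (rule inverse_unique)
  qed
  moreover have "reduces (expansion Q (inverse u)) (inverse a)" using * lc_Q a by auto
  moreover have "- (\<iota> (inverse a) * inverse u * u') \<in> LR"
    using * inv.hyps by (intro LR_uminus local_ring.mult local_ring.const local_ring.inv)
  ultimately show ?case using * by blast
qed

lemma LR_F: "z \<in> LR \<Longrightarrow> z \<in> F"
  using LR_split by blast

text \<open>As long as the residue is 0, \<open>LR_split\<close> takes out a factor \<open>t\<close>
  and lowers the order by one. The order stays nonnegative, so this ends at an element with nonzero
  residue.\<close>

lemma LR_normal_form:
  assumes "z \<in> LR" "z \<noteq> 0"
  shows "\<exists>u\<in>LR. \<not> reduces (expansion Q u) 0 \<and> z = t ^ nat (ord_at Q z) * u"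
  using assms
proof (induction "nat (ord_at Q z)" arbitrary: z rule: less_induct)
  case less
  obtain a w where w: "z \<in> F" "w \<in> LR" "reduces (expansion Q z) a" "z = \<iota> a + t * w"
    using LR_split less.prems by blast
  show ?case
  proof (cases "a = 0")
    case False
    then have "ord_at Q z = 0" using w reduces_nonzero by (simp add: ord_at_def)
    moreover have "\<not> reduces (expansion Q z) 0" using w False reduces_unique by blast
    ultimately show ?thesis using less.prems by (intro bexI[of _ z]) auto
  next
    case True
    then have z: "z = t * w" using w by simp
    then have w0: "w \<noteq> 0" "w \<in> F" using less.prems w LR_F by auto
    have "ord_at Q z = 1 + ord_at Q w"
      using w0 t_nonzero t_F lc_ord lc_Q unfolding z by (subst ord_mult) auto
    moreover have "ord_at Q w \<ge> 0"
      using LR_split[OF w(2)] reduces_ex_iff by (auto simp: ord_at_def)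
    ultimately have lt: "nat (ord_at Q z) = Suc (nat (ord_at Q w))" by simp
    then obtain u where "u \<in> LR" "\<not> reduces (expansion Q u) 0" "w = t ^ nat (ord_at Q w) * u"
      using less.hyps[of w] w w0 by auto
    then show ?thesis unfolding lt using z by (intro bexI[of _ u]) (auto simp: mult.assoc)
  qed
qed

definition fractions where "fractions = {a / b | a b. a \<in> LR \<and> b \<in> LR}"

lemma F_fractions: "F \<subseteq> fractions"
proof -
  have one: "1 \<in> LR" using local_ring.const[of 1] by simp
  have LR_fractions: "a \<in> fractions" if "a \<in> LR" for a
    unfolding fractions_def using that one by force
  have "is_subfield fractions"
    unfolding is_subfield_def is_subring_def
  proof (intro conjI ballI)
    show "1 \<in> fractions" using one LR_fractions by blast
  next
    fix u w assume "u \<in> fractions" "w \<in> fractions"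
    then obtain a b a' b' where *: "a \<in> LR" "b \<in> LR" "a' \<in> LR" "b' \<in> LR" "u = a / b" "w = a' / b'"
      unfolding fractions_def by blast
    have "u * w = (a * a') / (b * b')" using * by simp
    then show "u * w \<in> fractions" unfolding fractions_def using * local_ring.mult by blast
    show "u - w \<in> fractions"
    \<comment> \<open>A fraction with denominator 0 is the element 0, so the difference is then the
      other fraction up to sign.\<close>
    proof (cases "b = 0 \<or> b' = 0")
      case True
      then have "u - w = (- a') / b' \<or> u - w = a / b" using * by auto
      then show ?thesis unfolding fractions_def using * LR_uminus by blast
    next
      case False
      then have "u - w = (a * b' + - (a' * b)) / (b * b')" using * by (simp add: diff_frac_eq)
      moreover have "a * b' + - (a' * b) \<in> LR" using * by (intro local_ring.add local_ring.mult LR_uminus)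
      moreover have "b * b' \<in> LR" using * by (intro local_ring.mult)
      ultimately show ?thesis unfolding fractions_def by blast
    qed
  next
    fix u assume "u \<in> fractions"
    then obtain a b where "a \<in> LR" "b \<in> LR" "u = a / b" unfolding fractions_def by blast
    then show "inverse u \<in> fractions" unfolding fractions_def by (simp only: inverse_divide) blast
  qed
  moreover from this have "x \<in> fractions" "y \<in> fractions"
    using lc LR_fractions local_ring.gen1 local_ring.gen2 local_ring.const
    unfolding local_coordinates_def by (metis image_subset_iff)+
  moreover have "range \<iota> \<subseteq> fractions" using LR_fractions local_ring.const by blast
  ultimately show ?thesis by (intro subfield_contains_F)
qed

text \<open>The unit and its inverse both lie in the local ring. Thus a valuation ring containing
  the local ring and \<open>t\<close> is known once the sign of the exponent decides
  membership.\<close>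

lemma F_normal_form:
  assumes "z \<in> F" "z \<noteq> 0"
  obtains u where "u \<in> LR" "inverse u \<in> LR" "u \<noteq> 0" "z = t powi ord_at Q z * u"
proof -
  obtain a b where ab: "a \<in> LR" "b \<in> LR" "z = a / b" using assms(1) F_fractions unfolding fractions_def by blast
  then have nz: "a \<noteq> 0" "b \<noteq> 0" using assms by auto
  obtain u w where u: "u \<in> LR" "\<not> reduces (expansion Q u) 0" "a = t ^ nat (ord_at Q a) * u"
    and w: "w \<in> LR" "\<not> reduces (expansion Q w) 0" "b = t ^ nat (ord_at Q b) * w"
    using LR_normal_form ab nz by metis
  have unz: "u \<noteq> 0" "w \<noteq> 0" using u w lc_Q by auto
  have "ord_at Q a \<ge> 0" "ord_at Q b \<ge> 0"
    using LR_split[OF ab(1)] LR_split[OF ab(2)] reduces_ex_iff by (auto simp: ord_at_def)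
  then have "a = t powi ord_at Q a * u" "b = t powi ord_at Q b * w"
    using u(3) w(3) by (simp_all add: power_int_def)
  then have "z = (t powi ord_at Q a * u) / (t powi ord_at Q b * w)" using ab(3) by simp
  also have "\<dots> = t powi (ord_at Q a - ord_at Q b) * (u * inverse w)"
    using t_nonzero unz by (simp add: power_int_diff divide_inverse mult_ac)
  also have "ord_at Q a - ord_at Q b = ord_at Q z"
    using ab nz LR_F lc_Q by (simp add: ord_divide)
  finally have "z = t powi ord_at Q z * (u * inverse w)" .
  moreover have "u * inverse w \<in> LR" "inverse (u * inverse w) \<in> LR" "u * inverse w \<noteq> 0"
    using u w unz by (simp_all add: mult.commute local_ring.mult local_ring.inv)
  ultimately show thesis using that by blast
qed

end

lemma LR_sum: "(\<And>i. i \<in> A \<Longrightarrow> f i \<in> local_ring g h Q) \<Longrightarrow> sum f A \<in> local_ring g h Q"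
  using local_ring.const[of 0] by (induction A rule: infinite_finite_induct) (auto intro: local_ring.add)

lemma LR_power: "z \<in> local_ring g h Q \<Longrightarrow> z ^ k \<in> local_ring g h Q"
  using local_ring.const[of 1] by (induction k) (auto intro: local_ring.mult)

lemma LR_power_quotient: "z \<in> local_ring g h Q \<Longrightarrow> power_quotient b z \<in> local_ring g h Q"
  unfolding power_quotient_def by (intro LR_sum local_ring.mult LR_power local_ring.const)

end

section \<open>A place with the residues of a point is the place of that point\<close>

context fermat_place
begin

text \<open>By rule induction, elements of the local ring have the same residue modulo
  \<open>P\<close> as at \<open>Q\<close>, so the local ring is contained in \<open>R\<close>. In
  the normal form \<open>t^k u\<close> the unit has no influence, and membership in \<open>R\<close>
  depends only on the sign of \<open>k\<close>.\<close>

lemma place_eq_place_at: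
  assumes lc: "local_coordinates Q g h c d" and g: "g - \<iota> c \<in> P" and h: "h - \<iota> d \<in> P"
  shows "P = place_at Q"
proof -
  let ?t = "g - \<iota> c"
  note Q = lc_Q[OF lc]
  have in_R_of: "z \<in> R" if "z - \<iota> a \<in> P" for z a
    using R_add[OF P_R[OF that] R_const[of a]] by simp
  have LR: "\<exists>a. reduces (expansion Q u) a \<and> u - \<iota> a \<in> P" if "u \<in> local_ring g h Q" for u
    using that
  proof (induction u rule: local_ring.induct)
    case (const a)
    then show ?case using Q by (intro exI[of _ a]) auto
  next
    case gen1
    then show ?case using reduces_g[OF lc] g by blast
  next
    case gen2
    then show ?case using lc_h[OF lc] h by blast
  next
    case (add u w)
    then obtain a b where *: "reduces (expansion Q u) a" "u - \<iota> a \<in> P" "reduces (expansion Q w) b" "w - \<iota> b \<in> P"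
      by blast
    then have "(u - \<iota> a) + (w - \<iota> b) \<in> P" by (intro P_add)
    then have "u + w - \<iota> (a + b) \<in> P" by (simp add: algebra_simps)
    then show ?case using * Q LR_F[OF lc] add by (intro exI[of _ "a + b"]) auto
  next
    case (mult u w)
    then obtain a b where *: "reduces (expansion Q u) a" "u - \<iota> a \<in> P" "reduces (expansion Q w) b" "w - \<iota> b \<in> P"
      by blast
    then have "(u - \<iota> a) * w + \<iota> a * (w - \<iota> b) \<in> P" using in_R_of by (intro P_add P_mult P_mult') auto
    then have "u * w - \<iota> (a * b) \<in> P" by (simp add: algebra_simps)
    then show ?case using * Q LR_F[OF lc] mult by (intro exI[of _ "a * b"]) auto
  next
    case (inv u)
    then obtain a where *: "reduces (expansion Q u) a" "u - \<iota> a \<in> P" by blast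
    then have a: "a \<noteq> 0" using inv.hyps by auto
    have u: "u \<in> R" "u \<noteq> 0" using in_R_of * inv.hyps Q by auto
    have "u \<notin> P"
    proof
      assume "u \<in> P"
      then have "u - (u - \<iota> a) \<in> P" using *(2) by (rule P_diff)
      then show False using a P_const_iff by simp
    qed
    then have "inverse u \<in> R" using u by (intro inverse_in_R)
    then have "(u - \<iota> a) * (- \<iota> (inverse a) * inverse u) \<in> P"
      using *(2) by (intro P_mult R_mult R_uminus R_const)
    also have "(u - \<iota> a) * (- \<iota> (inverse a) * inverse u) = inverse u - \<iota> (inverse a)"
      unfolding \<iota>_inverse using a u by (simp add: field_simps)
    finally show ?case using * Q LR_F[OF lc] inv a by (intro exI[of _ "inverse a"]) auto
  qed
  have LR_R: "u \<in> R" if "u \<in> local_ring g h Q" for u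
    using LR[OF that] in_R_of by blast
  have in_R: "z \<in> R \<longleftrightarrow> ord_at Q z \<ge> 0" if z: "z \<in> F" "z \<noteq> 0" for z
  proof -
    obtain u where u: "u \<in> local_ring g h Q" "inverse u \<in> local_ring g h Q" "u \<noteq> 0" "z = ?t powi ord_at Q z * u"
      using F_normal_form[OF lc z] by metis
    show ?thesis
    proof
      assume "ord_at Q z \<ge> 0"
      then have "?t powi ord_at Q z \<in> R" using P_R[OF g] by (auto simp: power_int_def)
      then show "z \<in> R" using u(1) LR_R by (subst u(4)) (intro R_mult)
    next
      assume zR: "z \<in> R"
      show "ord_at Q z \<ge> 0"
      proof (rule ccontr)
        assume neg: "\<not> ord_at Q z \<ge> 0"
        have "z * inverse u \<in> R" using zR u LR_R by auto
        also have "z * inverse u = ?t powi ord_at Q z"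
          using u(3,4) by (metis mult.assoc mult.right_neutral right_inverse)
        \<comment> \<open>If the order \<open>k\<close> were negative, multiplying
          \<open>t^k\<close> by \<open>t^(-k-1)\<close> would put \<open>1/t\<close> into
          \<open>R\<close>, against \<open>t\<close> being in \<open>P\<close>.\<close>
        finally have "?t powi ord_at Q z * ?t ^ nat (- ord_at Q z - 1) \<in> R"
          using P_R[OF g] by auto
        also have "?t ^ nat (- ord_at Q z - 1) = ?t powi (- ord_at Q z - 1)"
          using neg by (simp add: power_int_def)
        also have "?t powi ord_at Q z * ?t powi (- ord_at Q z - 1) = ?t powi (-1)"
          using t_nonzero[OF lc] by (simp flip: power_int_add)
        finally show False using g t_nonzero[OF lc] by (simp add: P_iff power_int_minus)
      qed
    qed
  qed
  show ?thesis
  proof (intro set_eqI)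
    fix z
    show "z \<in> P \<longleftrightarrow> z \<in> place_at Q"
    proof (cases "z \<in> F \<and> z \<noteq> 0")
      case True
      then show ?thesis using in_R[of z] in_R[of "inverse z"] Q
        by (auto simp: P_iff place_at_iff ord_inverse)
    next
      case False
      then show ?thesis using R_subset Q by (auto simp: P_iff place_at_iff)
    qed
  qed
qed

end

section \<open>Charts at unramified, ramified and infinite points\<close>

context fermat
begin

lemma ord_x_minus:
  assumes "on_curve n (Aff a b)"
  shows "ord_at (Aff a b) (x - \<iota> a) = int (ram_index n b)"
  using parametrizes_affine(3)[OF n_pos assms parametrizes_at[OF assms]] assms
  by (simp add: ord_at_def)

lemma reduces_xy_affine:
  assumes "on_curve n (Aff a b)"
  shows "reduces (expansion (Aff a b) x) a" "reduces (expansion (Aff a b) y) b"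
  using parametrizes_affine(1,2)[OF n_pos assms parametrizes_at[OF assms]] expansion_simps[OF assms]
  by simp_all

lemma ord_y_ramified: "on_curve n (Aff a 0) \<Longrightarrow> ord_at (Aff a 0) y = 1"
  using parametrizes_at[of "Aff a 0"] by (simp add: ord_at_def)

lemma ord_x_infinity: "on_curve n (Inf f) \<Longrightarrow> ord_at (Inf f) x = -1"
  using parametrizes_at[of "Inf f"] by (simp add: ord_at_def)

lemma reduces_slope: "on_curve n (Inf f) \<Longrightarrow> reduces (expansion (Inf f) (y / x)) f"
  using parametrizes_at[of "Inf f"] by simp

lemma x_nonzero: "x \<noteq> 0"
  using x_transcendental \<iota>_0 by (metis rangeI)

text \<open>If \<open>h\<^sup>n - d\<^sup>n\<close> is divisible by the local parameter and \<open>d \<noteq> 0\<close>, then so is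
  \<open>h - d\<close>, because the cofactor \<open>n d\<^sup>n\<^sup>-\<^sup>1\<close> is a unit.\<close>

lemma local_coordinatesI:
  assumes Q: "on_curve n Q" and g: "g \<in> F" and h: "h \<in> F" "reduces (expansion Q h) d" "d \<noteq> 0"
    and t: "ord_at Q (g - \<iota> c) = 1" and s: "s \<in> local_ring g h Q" "h ^ n - \<iota> (d ^ n) = (g - \<iota> c) * s"
    and gen: "\<And>L. is_subfield L \<Longrightarrow> range \<iota> \<subseteq> L \<Longrightarrow> g \<in> L \<Longrightarrow> h \<in> L \<Longrightarrow> x \<in> L \<and> y \<in> L"
  shows "local_coordinates Q g h c d"
proof -
  let ?w = "power_quotient d h"
  have "reduces (expansion Q ?w) (of_nat n * d ^ (n - 1))"
    by (rule reduces_power_quotient[OF Q h(1,2)])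
  moreover have "of_nat n * d ^ (n - 1) \<noteq> 0" using n_pos h(3) by simp
  ultimately have nr: "\<not> reduces (expansion Q ?w) 0" using reduces_unique by blast
  have w: "?w \<in> local_ring g h Q" by (intro LR_power_quotient local_ring.gen2)
  have "?w \<noteq> 0" using nr Q by auto
  have "(h - \<iota> d) * ?w = (g - \<iota> c) * s" using s by (simp only: power_quotient)
  then have "h - \<iota> d = (g - \<iota> c) * (s * inverse ?w)"
    using \<open>?w \<noteq> 0\<close> by (simp add: field_simps)
  moreover have "s * inverse ?w \<in> local_ring g h Q" by (intro local_ring.mult s local_ring.inv w nr)
  ultimately show ?thesis unfolding local_coordinates_def using assms by blast
qed

lemma constants_power: "on_curve n (Aff a b) \<Longrightarrow> \<iota> a ^ n + \<iota> b ^ n = 1"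
  "on_curve n (Inf f) \<Longrightarrow> \<iota> f ^ n = -1"
  by (simp_all flip: \<iota>_power \<iota>_add)

text \<open>The equation turns \<open>y^n - b^n\<close> into \<open>- (x^n - a^n)\<close>, which is
  divisible by \<open>x - a\<close>.\<close>

lemma local_coordinates_unramified:
  assumes Q: "on_curve n (Aff a b)" and b: "b \<noteq> 0"
  shows "local_coordinates (Aff a b) x y a b"
proof (rule local_coordinatesI[OF Q])
  show "ord_at (Aff a b) (x - \<iota> a) = 1" using ord_x_minus[OF Q] b by (simp add: ram_index_def)
  show "- power_quotient a x \<in> local_ring x y (Aff a b)"
    using local_ring.mult[OF local_ring.const[of "-1"] LR_power_quotient[OF local_ring.gen1[of x y]]]
    by simp
  have "y ^ n - \<iota> (b ^ n) = - (x ^ n - \<iota> (a ^ n))"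
    using equation constants_power(1)[OF Q] by (simp add: algebra_simps)
  then show "y ^ n - \<iota> (b ^ n) = (x - \<iota> a) * (- power_quotient a x)"
    by (simp only: power_quotient mult_minus_right)
qed (use b reduces_xy_affine[OF Q] in auto)

lemma local_coordinates_ramified:
  assumes Q: "on_curve n (Aff a 0)"
  shows "local_coordinates (Aff a 0) y x 0 a"
proof (rule local_coordinatesI[OF Q])
  have an: "a ^ n = 1" using Q n_pos by (simp add: power_0_left)
  then show "a \<noteq> 0" using n_pos by (auto simp: power_0_left)
  show "ord_at (Aff a 0) (y - \<iota> 0) = 1" using ord_y_ramified[OF Q] by simp
  show "- (y ^ (n - 1)) \<in> local_ring y x (Aff a 0)"
    using local_ring.mult[OF local_ring.const[of "-1"] LR_power[OF local_ring.gen1[of y x]]]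
    by simp
  have "x ^ n - \<iota> (a ^ n) = - (y ^ n)" unfolding an using equation by (simp add: algebra_simps)
  also have "y ^ n = y * y ^ (n - 1)" using n_pos by (cases n) auto
  finally show "x ^ n - \<iota> (a ^ n) = (y - \<iota> 0) * - (y ^ (n - 1))" by simp
qed (use reduces_xy_affine[OF Q] in auto)

text \<open>Dividing the equation by \<open>x^n\<close> gives \<open>(y/x)^n + 1 = (1/x)^n\<close>,
  so \<open>1/x\<close> divides \<open>(y/x)^n - f^n\<close>.\<close>

lemma local_coordinates_infinity:
  assumes Q: "on_curve n (Inf f)"
  shows "local_coordinates (Inf f) (inverse x) (y / x) 0 f"
proof (rule local_coordinatesI[OF Q])
  have fn: "f ^ n = -1" using Q by simp
  then show "f \<noteq> 0" using n_pos by (auto simp: power_0_left)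
  show "ord_at (Inf f) (inverse x - \<iota> 0) = 1" using ord_x_infinity[OF Q] Q by (simp add: ord_inverse)
  show "inverse x ^ (n - 1) \<in> local_ring (inverse x) (y / x) (Inf f)"
    by (intro LR_power local_ring.gen1)
  have "(y / x) ^ n - \<iota> (f ^ n) = inverse x ^ n"
    unfolding fn using equation x_nonzero by (simp add: power_divide divide_simps) (simp add: add.commute)
  also have "\<dots> = inverse x * inverse x ^ (n - 1)" using n_pos by (cases n) auto
  finally show "(y / x) ^ n - \<iota> (f ^ n) = (inverse x - \<iota> 0) * inverse x ^ (n - 1)" by simp
next
  fix L assume L: "is_subfield L" "inverse x \<in> L" "y / x \<in> L"
  then have "inverse (inverse x) \<in> L" "inverse (inverse x) * (y / x) \<in> L"
    unfolding is_subfield_def is_subring_def by blast+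
  then show "x \<in> L \<and> y \<in> L" using x_nonzero by simp
qed (use reduces_slope[OF Q] in auto)

text \<open>The parameter \<open>g - c\<close> of a chart supplies the function of order 1 assumed
  in the description of \<open>place_at\<close>.\<close>

lemma uniformizer_exists:
  assumes "on_curve n Q"
  obtains t where "t \<in> F" "ord_at Q t = 1"
proof -
  have "\<exists>g h c d. local_coordinates Q g h c d"
    using assms local_coordinates_unramified local_coordinates_ramified local_coordinates_infinity
    by (cases Q) metis+
  then show thesis using that t_F lc_ord by metis
qed

lemma place_place_at: "on_curve n Q \<Longrightarrow> place \<iota> F (place_at Q)"
  using uniformizer_exists place_at_is_place by metis

lemma val_eq_ord: "on_curve n Q \<Longrightarrow> z \<in> F \<Longrightarrow> z \<noteq> 0 \<Longrightarrow> val F (place_at Q) z = ord_at Q z"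
  using uniformizer_exists val_place_at by metis

end

section \<open>Every place belongs to exactly one point\<close>

context fermat_place
begin

text \<open>If \<open>x\<close> lies in \<open>R\<close>, so does its partner \<open>y\<close>. Then
  \<open>x\<close> has a residue \<open>a\<close>, since otherwise all denominators
  \<open>q(x)\<close> would be units and \<open>R\<close> the whole field; and \<open>y\<close> has
  one because \<open>y^n\<close> reduces to \<open>1 - a^n\<close>. If \<open>x\<close> is not in
  \<open>R\<close>, the same works for \<open>y/x\<close>, whose \<open>n\<close>-th power reduces
  to -1.\<close>

lemma P_eq_place_at: "\<exists>Q. on_curve n Q \<and> P = place_at Q"
proof (cases "x \<in> R")
  case True
  have yR: "y \<in> R"
  proof (rule root_in_R)
    have "1 - x ^ n \<in> R" using True by auto
    then show "y ^ n \<in> R" using equation by (metis add_diff_cancel_left')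
  qed auto
  have "\<exists>a. x - \<iota> a \<in> P"
  proof (rule ccontr)
    assume "\<not> ?thesis"
    then have u: "E1 q \<in> R - P" if "q \<noteq> 0" for q
      using residue_or_units[OF True _ that] by blast
    have E1R: "E1 q \<in> R" for q by (induction q) (auto intro: True)
    have E2R: "E2 p \<in> R" for p by (induction p) (auto intro: E1R yR)
    have "F \<subseteq> R"
    proof
      fix z assume "z \<in> F"
      then obtain p q where "q \<noteq> 0" "z = E2 p / E1 q" by (rule F_E)
      then show "z \<in> R" using u[of q] E2R by (auto simp: divide_inverse intro!: R_mult inverse_in_R)
    qed
    then show False using R_neq R_subset by blast
  qed
  then obtain a where a: "x - \<iota> a \<in> P" by blast
  have "power_quotient a x \<in> R"
  proof -
    have "(\<Sum>i\<in>A. \<iota> (a ^ (n - Suc i)) * x ^ i) \<in> R" for A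
      using True by (induction A rule: infinite_finite_induct) (auto intro!: R_add R_mult R_power simp del: \<iota>_power)
    then show ?thesis by (simp only: power_quotient_def)
  qed
  then have "(x - \<iota> a) * power_quotient a x \<in> P" by (rule P_mult[OF a])
  then have "x ^ n - \<iota> (a ^ n) \<in> P" by (simp only: power_quotient)
  then have "- (x ^ n - \<iota> (a ^ n)) \<in> P" by (rule P_uminus)
  also have "- (x ^ n - \<iota> (a ^ n)) = y ^ n - \<iota> (1 - a ^ n)"
    using equation by (simp add: algebra_simps)
  finally obtain b where b: "y - \<iota> b \<in> P" "b ^ n = 1 - a ^ n"
    using residue_of_root[OF yR] by blast
  then have Q: "on_curve n (Aff a b)" by simp
  show ?thesis
  proof (cases "b = 0")
    case True
    then show ?thesis
      using place_eq_place_at[OF local_coordinates_ramified, of a] Q a b by (metis \<iota>_0 diff_zero)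
  next
    case False
    then show ?thesis
      using place_eq_place_at[OF local_coordinates_unramified, of a b] Q a b by metis
  qed
next
  case False
  then have u: "inverse x \<in> P" using inverse_in_P by auto
  have eq: "(y / x) ^ n - \<iota> (-1) = inverse x ^ n"
    using equation x_nonzero by (simp add: power_divide divide_simps) (simp add: add.commute)
  have un: "inverse x ^ n \<in> P"
  proof -
    have "inverse x * inverse x ^ (n - 1) \<in> P" using u by (intro P_mult R_power P_R)
    then show ?thesis using n_pos by (cases n) auto
  qed
  have gR: "y / x \<in> R"
  proof (rule root_in_R)
    have "(y / x) ^ n = inverse x ^ n + \<iota> (-1)" using eq by (simp add: algebra_simps)
    also have "\<dots> \<in> R" using P_R[OF un] by (intro R_add R_const)
    finally show "(y / x) ^ n \<in> R" .
  qed auto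
  obtain f where f: "y / x - \<iota> f \<in> P" "f ^ n = -1"
    using residue_of_root[OF gR] un eq by metis
  then have Q: "on_curve n (Inf f)" by simp
  then show ?thesis using place_eq_place_at[OF local_coordinates_infinity, of f] u f by (metis \<iota>_0 diff_zero)
qed

end

context fermat
begin

lemma place_iff: "place \<iota> F P \<longleftrightarrow> (\<exists>Q. on_curve n Q \<and> P = place_at Q)"
proof
  assume "place \<iota> F P"
  then obtain R where R: "valuation_ring \<iota> F R" "P = R - units_in R" unfolding place_def by blast
  interpret fermat_place \<iota> n x y R by unfold_locales (fact R(1))
  show "\<exists>Q. on_curve n Q \<and> P = place_at Q"
    using P_eq_place_at R(2) unfolding P_def by simp
qed (use place_place_at in blast)

lemma not_reduces_infinity:
  assumes "on_curve n (Inf f)"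
  shows "x - \<iota> a \<notin> place_at (Inf f)"
proof
  assume "x - \<iota> a \<in> place_at (Inf f)"
  then have "reduces (X_at (Inf f) - fls_const a) 0" using assms by (simp add: place_at_def)
  from reduces_add[OF this reduces_const[of a]] have "reduces (X_at (Inf f)) a" by simp
  then have "fls_subdegree (X_at (Inf f)) \<ge> 0" using reduces_ex_iff by blast
  then show False using ord_x_infinity[OF assms] assms by (simp add: ord_at_def)
qed

lemma reduces_in_place_at:
  assumes "on_curve n Q" "z \<in> F" "reduces (expansion Q z) a"
  shows "z - \<iota> b \<in> place_at Q \<longleftrightarrow> b = a"
proof -
  have "reduces (expansion Q (z - \<iota> b)) (a - b)"
    using assms reduces_diff[OF assms(3) reduces_const[of b]] by simp
  then show ?thesis using assms reduces_unique[of "expansion Q (z - \<iota> b)" "a - b" 0]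
    by (auto simp: place_at_def)
qed

text \<open>The place determines the residues of \<open>x\<close> and \<open>y\<close>, or of
  \<open>y/x\<close>, and a point at infinity is recognized by \<open>x\<close> having no
  residue.\<close>

lemma place_at_inj:
  assumes "on_curve n Q" "on_curve n Q'" "place_at Q = place_at Q'"
  shows "Q = Q'"
proof (cases Q)
  case (Aff a b)
  then have 1: "x - \<iota> a \<in> place_at Q'" "y - \<iota> b \<in> place_at Q'"
    using reduces_in_place_at reduces_xy_affine assms by (metis F_x, metis F_y)
  show ?thesis
  proof (cases Q')
    case (Aff a' b')
    then show ?thesis using 1 \<open>Q = Aff a b\<close> reduces_in_place_at reduces_xy_affine assms by (metis F_x F_y)
  next
    case (Inf f)
    then show ?thesis using 1 not_reduces_infinity assms by blast
  qed
next
  case (Inf f)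
  show ?thesis
  proof (cases Q')
    case (Aff a' b')
    then have "x - \<iota> a' \<in> place_at Q"
      using reduces_in_place_at reduces_xy_affine assms by (metis F_x)
    then show ?thesis using Inf not_reduces_infinity assms by blast
  next
    case (Inf f')
    have "y / x \<in> F" by auto
    then show ?thesis using Inf \<open>Q = Inf f\<close> reduces_in_place_at reduces_slope assms by metis
  qed
qed

end

section \<open>Counting the poles of a function\<close>

lemma finite_card_nth_roots:
  "c \<noteq> 0 \<Longrightarrow> n > 0 \<Longrightarrow> finite {b::complex. b ^ n = c} \<and> card {b::complex. b ^ n = c} = n"
  using card_nth_roots[of c n] by (metis card.infinite neq0_conv)

text \<open>Serves the points above \<open>x = a\<close> with \<open>c = 1 - a^n\<close> and those
  at infinity with \<open>c = -1\<close>; \<open>s\<close> is \<open>p\<close> restricted to the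
  fibre.\<close>

lemma fibre_sum_lower_bound:
  fixes s :: "complex poly" and g :: "complex \<Rightarrow> nat"
  assumes "c \<noteq> 0" "n > 0" "s \<noteq> 0" and g: "\<And>b. b ^ n = c \<Longrightarrow> poly s b \<noteq> 0 \<Longrightarrow> g b = m"
  shows "m * (n - degree s) \<le> (\<Sum>b | b ^ n = c. g b)"
proof -
  let ?S = "{b. b ^ n = c}" and ?Z = "{b. poly s b = 0}"
  have S: "finite ?S" "card ?S = n" using finite_card_nth_roots[OF assms(1,2)] by auto
  have "n - degree s \<le> n - card ?Z"
    using card_poly_roots_bound[OF assms(3)] by simp
  also have "\<dots> \<le> card (?S - ?Z)"
    using diff_card_le_card_Diff[of ?Z ?S] poly_roots_finite[OF assms(3)] S by simp
  finally have "m * (n - degree s) \<le> (\<Sum>b\<in>?S - ?Z. m)" by simp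
  also have "\<dots> = (\<Sum>b\<in>?S - ?Z. g b)" using g by (intro sum.cong) auto
  also have "\<dots> \<le> (\<Sum>b\<in>?S. g b)" using S by (intro sum_mono2) auto
  finally show ?thesis .
qed

text \<open>The only polynomial of degree \<open>n - 1\<close> vanishing at all \<open>n\<close>-th roots of
  \<open>b\<^sup>n\<close> other than \<open>b\<close> is, up to a factor, \<open>(Y\<^sup>n - b\<^sup>n) / (Y - b) = Y\<^sup>n\<^sup>-\<^sup>1 + b Y\<^sup>n\<^sup>-\<^sup>2 + \<dots>\<close>.\<close>

lemma coeff_of_deleted_root:
  fixes s :: "complex poly"
  assumes n: "n \<ge> 2" and b: "b \<noteq> 0" and deg: "degree s \<le> n - 1"
    and zeros: "\<And>b'. b' ^ n = b ^ n \<Longrightarrow> b' \<noteq> b \<Longrightarrow> poly s b' = 0"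
  shows "coeff s (n - 2) = b * coeff s (n - 1)"
proof -
  define h where "h = (\<Sum>i<n. monom (b ^ (n - Suc i)) i)"
  have coeff_h: "coeff h j = (if j < n then b ^ (n - Suc j) else 0)" for j
    by (simp add: h_def coeff_sum)
  \<comment> \<open>Subtracting this multiple of \<open>h\<close> cancels the coefficient of
    \<open>Y^(n-1)\<close>, so \<open>r\<close> has degree below \<open>n - 1\<close> but still
    \<open>n - 1\<close> roots.\<close>
  define r where "r = s - smult (coeff s (n - 1)) h"
  have "degree r < n - 1"
  proof -
    have "coeff r j = 0" if "j > n - 2" for j
    proof (cases "j = n - 1")
      case True
      then show ?thesis using n by (simp add: r_def coeff_h)
    next
      case False
      then have "j > n - 1" using that by simp
      then show ?thesis using deg by (simp add: r_def coeff_h coeff_eq_0)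
    qed
    then have "degree r \<le> n - 2" by (simp add: degree_le)
    then show ?thesis using n by simp
  qed
  have "r = 0"
  proof (rule ccontr)
    assume r0: "r \<noteq> 0"
    let ?S = "{b'. b' ^ n = b ^ n}"
    have S: "finite ?S" "card ?S = n" using finite_card_nth_roots[of "b ^ n" n] b n by auto
    have "poly r b' = 0" if "b' \<in> ?S - {b}" for b'
    proof -
      have "(b' - b) * poly h b' = b' ^ n - b ^ n"
        by (simp add: h_def poly_sum poly_monom power_diff_sumr2)
      then have "poly h b' = 0" using that by simp
      then show ?thesis using zeros that by (simp add: r_def)
    qed
    then have "card (?S - {b}) \<le> card {b'. poly r b' = 0}"
      by (intro card_mono poly_roots_finite r0) auto
    also have "\<dots> \<le> degree r" by (rule card_poly_roots_bound[OF r0])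
    finally show False using S \<open>degree r < n - 1\<close> by simp
  qed
  then have "s = smult (coeff s (n - 1)) h" by (simp add: r_def)
  then have "coeff s (n - 2) = coeff s (n - 1) * coeff h (n - 2)" by (metis coeff_smult)
  also have "coeff h (n - 2) = b" using n by (simp add: coeff_h Suc_diff_Suc numeral_2_eq_2)
  finally show ?thesis by (simp add: mult.commute)
qed

text \<open>A point where \<open>s\<close> does not vanish uses up the whole sum \<open>m\<close>,
  so no other point has positive weight. Such a point exists since \<open>s\<close> has at most
  \<open>n - 1\<close> roots, and it must be \<open>b\<close> because
  \<open>g b > 0\<close>.\<close>

lemma fibre_sum_equality:
  fixes s :: "complex poly" and g :: "complex \<Rightarrow> nat"
  assumes n: "n \<ge> 2" and b: "b \<noteq> 0" and s: "s \<noteq> 0" "degree s \<le> n - 1"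
    and g: "\<And>b'. b' ^ n = b ^ n \<Longrightarrow> poly s b' \<noteq> 0 \<Longrightarrow> g b' = m" and gb: "g b > 0"
    and sum: "(\<Sum>b' | b' ^ n = b ^ n. g b') \<le> m"
  shows "coeff s (n - 2) = b * coeff s (n - 1)"
proof (rule coeff_of_deleted_root[OF n b s(2)])
  let ?S = "{b'. b' ^ n = b ^ n}"
  have S: "finite ?S" "card ?S = n" using finite_card_nth_roots[of "b ^ n" n] b n by auto
  have two: "g b' + g b'' \<le> m" if "b' \<in> ?S" "b'' \<in> ?S" "b' \<noteq> b''" for b' b''
  proof -
    have "g b' + g b'' = sum g {b', b''}" using that by simp
    also have "\<dots> \<le> sum g ?S" using that S by (intro sum_mono2) auto
    finally show ?thesis using sum by simp
  qed
  have "\<exists>b'\<in>?S. poly s b' \<noteq> 0"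
  proof (rule ccontr)
    assume "\<not> ?thesis"
    then have "card ?S \<le> card {b'. poly s b' = 0}" by (intro card_mono poly_roots_finite s) auto
    also have "\<dots> \<le> degree s" by (rule card_poly_roots_bound[OF s(1)])
    finally show False using S s n by simp
  qed
  then obtain b0 where b0: "b0 \<in> ?S" "poly s b0 \<noteq> 0" by blast
  then have "b0 = b" using two[of b0 b] g[of b0] gb by fastforce
  fix b' assume b': "b' ^ n = b ^ n" "b' \<noteq> b"
  show "poly s b' = 0"
  proof (rule ccontr)
    assume "poly s b' \<noteq> 0"
    then have "g b' = m" using g b' by simp
    then show False using two[of b' b] b' gb by simp
  qed
qed

text \<open>The value of \<open>r(X) / X^d\<close> at \<open>X = \<infinity>\<close> is the
  coefficient of \<open>X^d\<close>, which is 0 if \<open>d\<close> exceeds the degree.\<close>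

lemma reduces_leading:
  assumes X: "X \<noteq> 0" "reduces (inverse X) 0" and "degree r \<le> d"
  shows "reduces (inverse X ^ d * eval1 fls_const X r) (coeff r d)"
  using assms(3)
proof (induction r arbitrary: d)
  case 0
  then show ?case by simp
next
  case (pCons a r)
  show ?case
  proof (cases d)
    case 0
    then have "r = 0" using pCons.prems by (auto split: if_splits)
    then show ?thesis using 0 by simp
  next
    case (Suc d')
    have "degree r \<le> d'" using pCons.prems Suc by (auto split: if_splits)
    then have IH: "reduces (inverse X ^ d' * eval1 fls_const X r) (coeff r d')" by (rule pCons.IH)
    have "inverse X * X = 1" using X by simp
    then have "inverse X ^ d * eval1 fls_const X (pCons a r) =
      inverse X * (inverse X ^ d' * fls_const a) + inverse X ^ d' * eval1 fls_const X r"
      unfolding Suc by (simp add: algebra_simps)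
    moreover have "reduces (inverse X * (inverse X ^ d' * fls_const a)) (0 * (0 ^ d' * a))"
      by (intro reduces_mult reduces_power reduces_const X)
    ultimately show ?thesis using reduces_add[OF _ IH] Suc by fastforce
  qed
qed

text \<open>The homogeneous part of degree \<open>D\<close> of \<open>p(x, y)\<close>, dehomogenized by \<open>x = 1\<close>.\<close>

definition top_form :: "nat \<Rightarrow> complex poly poly \<Rightarrow> complex poly" where
  "top_form D p = (\<Sum>i\<le>degree p. monom (if i \<le> D then coeff (coeff p i) (D - i) else 0) i)"

lemma coeff_top_form: "coeff (top_form D p) i = (if i \<le> D then coeff (coeff p i) (D - i) else 0)"
  by (cases "i \<le> degree p") (simp_all add: top_form_def coeff_sum coeff_eq_0)

lemma degree_top_form_le: "degree (top_form D p) \<le> degree p"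
  by (intro degree_le) (simp add: coeff_top_form coeff_eq_0)

definition total_degree_le :: "nat \<Rightarrow> complex poly poly \<Rightarrow> bool" where
  "total_degree_le D p \<longleftrightarrow> (\<forall>i. coeff p i \<noteq> 0 \<longrightarrow> i + degree (coeff p i) \<le> D)"

text \<open>Distribute the factor: \<open>p(X, Y) / X^D\<close> is the sum of the terms
  \<open>(p_i(X) / X^(D-i)) (Y/X)^i\<close>, with \<open>p_i\<close> the coefficient of
  \<open>Y^i\<close>.\<close>

lemma reduces_top_form:
  assumes X: "X \<noteq> 0" "reduces (inverse X) 0" and f: "reduces (Y / X) f" and D: "total_degree_le D p"
  shows "reduces (inverse X ^ D * eval2 fls_const X Y p) (poly (top_form D p) f)"
proof -
  have "reduces (inverse X ^ D * (eval1 fls_const X (coeff p i) * Y ^ i)) (coeff (top_form D p) i * f ^ i)" for i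
  proof (cases "coeff p i = 0")
    case True
    then show ?thesis by (simp add: coeff_top_form)
  next
    case False
    then have i: "i \<le> D" "degree (coeff p i) \<le> D - i"
      using D by (auto simp: total_degree_le_def)
    have "inverse X ^ D * (eval1 fls_const X (coeff p i) * Y ^ i)
      = (inverse X ^ (D - i) * eval1 fls_const X (coeff p i)) * (Y / X) ^ i"
    proof -
      have "inverse X ^ D = inverse X ^ (D - i) * inverse X ^ i"
        using i by (simp flip: power_add)
      then show ?thesis by (simp only: divide_inverse power_mult_distrib mult_ac)
    qed
    moreover have "reduces ((inverse X ^ (D - i) * eval1 fls_const X (coeff p i)) * (Y / X) ^ i)
      (coeff (coeff p i) (D - i) * f ^ i)"
      by (intro reduces_mult reduces_leading reduces_power X f i)
    ultimately show ?thesis by (simp only: coeff_top_form i if_True)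
  qed
  then have "reduces (\<Sum>i\<le>degree p. inverse X ^ D * (eval1 fls_const X (coeff p i) * Y ^ i))
    (\<Sum>i\<le>degree p. coeff (top_form D p) i * f ^ i)"
    by (intro reduces_sum) auto
  also have "(\<Sum>i\<le>degree p. inverse X ^ D * (eval1 fls_const X (coeff p i) * Y ^ i)) =
    inverse X ^ D * eval2 fls_const X Y p"
    by (simp add: fls.eval2_altdef sum_distrib_left)
  also have "(\<Sum>i\<le>degree p. coeff (top_form D p) i * f ^ i) = poly (top_form D p) f"
    unfolding poly_altdef using degree_top_form_le[of D p]
    by (intro sum.mono_neutral_right) (auto simp: coeff_eq_0)
  finally show ?thesis .
qed

lemma sum_order_eq_degree:
  fixes q :: "complex poly"
  assumes "q \<noteq> 0"
  shows "(\<Sum>a | poly q a = 0. order a q) = degree q"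
proof -
  have "degree q = degree (smult (lead_coeff q) (\<Prod>a | poly q a = 0. [:-a, 1:] ^ order a q))"
    by (simp only: complex_poly_decompose)
  also have "\<dots> = degree (\<Prod>a | poly q a = 0. [:-a, 1:] ^ order a q)"
    using assms by (simp only: degree_smult_eq leading_coeff_0_iff if_False)
  also have "\<dots> = (\<Sum>a | poly q a = 0. degree ([:-a, 1:] ^ order a q))"
    by (rule degree_prod_eq_sum_degree) auto
  also have "\<dots> = (\<Sum>a | poly q a = 0. order a q)"
    by (simp add: degree_linear_power)
  finally show ?thesis by simp
qed

lemma degree_le_1_E:
  assumes "degree r \<le> 1"
  obtains u w where "r = [:u, w:]"
proof
  show "r = [:coeff r 0, coeff r 1:]"
    using assms by (intro poly_eqI) (auto simp: coeff_pCons coeff_eq_0 split: nat.split)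
qed

section \<open>Poles above the roots of the denominator and above infinity\<close>

context fermat
begin

definition poles :: "'a \<Rightarrow> point set" where
  "poles z = {Q. on_curve n Q \<and> ord_at Q z < 0}"

text \<open>Truncation makes it 0 away from the poles, so sums may run over whole fibres.\<close>

definition pole_order :: "'a \<Rightarrow> point \<Rightarrow> nat" where
  "pole_order z Q = nat (- ord_at Q z)"

definition pole_degree :: "'a \<Rightarrow> nat" where
  "pole_degree z = (\<Sum>Q\<in>poles z. pole_order z Q)"

text \<open>Reduction modulo the curve brings the \<open>y\<close>-degree below \<open>n\<close>.
  Among such representations one with \<open>q\<close> of least degree is in lowest terms, because a
  common factor \<open>X - a\<close> could be cancelled.\<close>

lemma F_reduced:
  assumes "z \<in> F"
  obtains p q where "q \<noteq> 0" "degree p < n" "z = E2 p / E1 q"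
    "\<And>a. poly q a = 0 \<Longrightarrow> specialize a p \<noteq> 0"
proof -
  define good where "good = (\<lambda>q. q \<noteq> 0 \<and> (\<exists>p. degree p < n \<and> z = E2 p / E1 q))"
  obtain p0 q0 where pq0: "q0 \<noteq> 0" "z = E2 p0 / E1 q0" using assms by (rule F_E)
  obtain c q' r where c: "c \<noteq> 0" "smult c p0 = curve_poly n * q' + r" "degree r < n"
    using curve_poly_remainder[OF n_pos] by blast
  have "E2 (smult c p0) = E2 r" unfolding c(2) using equation by simp
  then have "z = E2 r / E1 (c * q0)" using pq0 c(1) by simp (metis E1_eq_0_iff mult_divide_mult_cancel_left)
  then have "good (c * q0)" using c pq0 unfolding good_def by auto
  then obtain q where q: "good q" "\<And>q'. good q' \<Longrightarrow> degree q \<le> degree q'"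
    using ex_has_least_nat[of good "c * q0" degree] by blast
  then obtain p where p: "degree p < n" "z = E2 p / E1 q" "q \<noteq> 0" unfolding good_def by blast
  have "specialize a p \<noteq> 0" if "poly q a = 0" for a
  proof
    assume "specialize a p = 0"
    then obtain p' where p': "p = smult [:-a, 1:] p'" using specialize_split[of p a] by auto
    from that obtain q' where q': "q = [:-a, 1:] * q'" by (auto simp: poly_eq_0_iff_dvd)
    have "q' \<noteq> 0" using q' p by auto
    have "degree p' < n" using p p' by auto
    moreover have "z = E2 p' / E1 q'"
    proof -
      have "E1 [:-a, 1:] \<noteq> 0" by (simp del: eval1_simps)
      then show ?thesis unfolding p(2) p' q' eval2_smult eval1_simps(5) by simp
    qed
    ultimately have "good q'" using \<open>q' \<noteq> 0\<close> unfolding good_def by blast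
    then have "degree q \<le> degree q'" by (rule q(2))
    moreover have "degree q = Suc (degree q')" using q' \<open>q' \<noteq> 0\<close> by (simp add: degree_mult_eq del: mult_pCons_left)
    ultimately show False by simp
  qed
  then show thesis using that p by blast
qed

lemma ord_E1_affine:
  assumes "on_curve n (Aff a b)" "r \<noteq> 0"
  shows "ord_at (Aff a b) (E1 r) = int (ram_index n b) * int (order a r)"
  using parametrizes_affine[OF n_pos assms(1) parametrizes_at[OF assms(1)]] subdegree_eval1_at assms
  by (simp add: ord_at_def)

lemma ord_E1_infinity:
  assumes "on_curve n (Inf f)" "r \<noteq> 0"
  shows "ord_at (Inf f) (E1 r) = - int (degree r)"
  using subdegree_eval1_pole[OF _ assms(2)] ord_x_infinity[OF assms(1)] assms(1)
  by (simp add: ord_at_def)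

lemma reduces_E2_affine:
  assumes "on_curve n (Aff a b)"
  shows "reduces (expansion (Aff a b) (E2 p)) (poly (specialize a p) b)"
  using reduces_eval2 reduces_xy_affine[OF assms] assms by simp

lemma reduces_inverse_x:
  assumes "on_curve n (Inf f)"
  shows "X_at (Inf f) \<noteq> 0" "reduces (inverse (X_at (Inf f))) 0" "reduces (Y_at (Inf f) / X_at (Inf f)) f"
proof -
  show X: "X_at (Inf f) \<noteq> 0" using ord_x_infinity[OF assms] assms by (auto simp: ord_at_def)
  have "ord_at (Inf f) (inverse x) = 1" using ord_x_infinity[OF assms] assms by (simp add: ord_inverse)
  then show "reduces (inverse (X_at (Inf f))) 0" using assms by (simp add: ord_at_def reduces_zero_iff)
  show "reduces (Y_at (Inf f) / X_at (Inf f)) f" using reduces_slope[OF assms] assms by simp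
qed

lemma ord_E2_infinity:
  assumes Q: "on_curve n (Inf f)" and D: "total_degree_le D p"
  shows "ord_at (Inf f) (E2 p) \<ge> - int D"
    "poly (top_form D p) f \<noteq> 0 \<Longrightarrow> ord_at (Inf f) (E2 p) = - int D"
proof -
  let ?X = "X_at (Inf f)" and ?Y = "Y_at (Inf f)"
  note X = reduces_inverse_x[OF Q]
  have X1: "fls_subdegree (inverse ?X ^ D) = int D"
    using ord_x_infinity[OF Q] Q ord_inverse[OF Q F_x] by (simp add: ord_at_def fls_subdegree_pow)
  have red: "reduces (inverse ?X ^ D * eval2 fls_const ?X ?Y p) (poly (top_form D p) f)"
    by (rule reduces_top_form[OF X D])
  have sub: "fls_subdegree (inverse ?X ^ D * eval2 fls_const ?X ?Y p) = int D + ord_at (Inf f) (E2 p)"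
    if "eval2 fls_const ?X ?Y p \<noteq> 0"
    using that X(1) X1 Q by (simp add: ord_at_def)
  have "fls_subdegree (inverse ?X ^ D * eval2 fls_const ?X ?Y p) \<ge> 0"
    using red reduces_ex_iff by blast
  then show "ord_at (Inf f) (E2 p) \<ge> - int D"
    using sub Q by (cases "eval2 fls_const ?X ?Y p = 0") (simp_all add: ord_at_def)
  assume "poly (top_form D p) f \<noteq> 0"
  from reduces_nonzero[OF red this] sub show "ord_at (Inf f) (E2 p) = - int D" by auto
qed

context
  fixes z p q
  assumes z: "z = E2 p / E1 q" and z0: "z \<noteq> 0" and q: "q \<noteq> 0" and deg_p: "degree p < n"
    and reduced: "\<And>a. poly q a = 0 \<Longrightarrow> specialize a p \<noteq> 0"
begin

lemma p_nonzero: "E2 p \<noteq> 0" "p \<noteq> 0"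
  using z z0 by auto

lemma ord_z: "on_curve n Q \<Longrightarrow> ord_at Q z = ord_at Q (E2 p) - ord_at Q (E1 q)"
  unfolding z using p_nonzero q by (simp add: ord_divide)

lemma pole_order_unramified:
  assumes Q: "on_curve n (Aff a b)" and b: "b \<noteq> 0" and s: "poly (specialize a p) b \<noteq> 0"
  shows "pole_order z (Aff a b) = order a q"
proof -
  have "ord_at (Aff a b) (E2 p) = 0"
    using reduces_nonzero(2)[OF reduces_E2_affine[OF Q] s] by (simp add: ord_at_def)
  then show ?thesis
    using ord_z[OF Q] ord_E1_affine[OF Q q] b by (simp add: pole_order_def ram_index_def)
qed

lemma pole_order_ramified:
  assumes Q: "on_curve n (Aff a 0)" and s: "specialize a p \<noteq> 0"
  shows "pole_order z (Aff a 0) = n * order a q - order 0 (specialize a p)"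
proof -
  have "ord_at (Aff a 0) (E2 p) = int (order 0 (specialize a p))"
    using eval2_ramified(2)[OF n_pos Q parametrizes_at[OF Q] s deg_p] Q by (simp add: ord_at_def)
  then have "ord_at (Aff a 0) z = int (order 0 (specialize a p)) - int (n * order a q)"
    using ord_z[OF Q] ord_E1_affine[OF Q q] by (simp add: ram_index_def)
  then show ?thesis unfolding pole_order_def by linarith
qed

lemma ramified_fibre: "a ^ n = 1 \<Longrightarrow> {b. b ^ n = 1 - a ^ n} = {0::complex}"
  using n_pos by (auto simp: power_0_left)

lemma affine_fibre_bound:
  assumes "poly q a = 0"
  shows "order a q * (n - degree p) \<le> (\<Sum>b | b ^ n = 1 - a ^ n. pole_order z (Aff a b))"
proof -
  let ?s = "specialize a p"
  note s = reduced[OF assms]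
  show ?thesis
  proof (cases "a ^ n = 1")
    \<comment> \<open>The fibre is the single point \<open>(a, 0)\<close>. With \<open>m\<close> the
      order of \<open>q\<close> at \<open>a\<close> and \<open>k = degree p\<close>, the pole order
      is at least \<open>n m - k\<close>, which is at least \<open>m (n - k)\<close> because
      \<open>m \<ge> 1\<close>.\<close>
    case True
    have m: "order a q \<ge> 1" using assms q by (simp add: order_root Suc_le_eq)
    have "order 0 ?s \<le> degree p"
      using order_degree[OF s, of 0] degree_specialize_le[of a p] by simp
    also have "\<dots> \<le> order a q * degree p" using m by simp
    finally have "order a q * (n - degree p) \<le> n * order a q - order 0 ?s"
      by (simp add: diff_mult_distrib2 mult.commute)
    then show ?thesis using True pole_order_ramified[OF _ s] n_pos
      by (simp add: ramified_fibre power_0_left)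
  next
    case False
    then have c: "1 - a ^ n \<noteq> 0" by simp
    have "order a q * (n - degree ?s) \<le> (\<Sum>b | b ^ n = 1 - a ^ n. pole_order z (Aff a b))"
    proof (rule fibre_sum_lower_bound[OF c n_pos s])
      fix b assume b: "b ^ n = 1 - a ^ n" "poly ?s b \<noteq> 0"
      then have "b \<noteq> 0" using c n_pos by (auto simp: power_0_left)
      then show "pole_order z (Aff a b) = order a q" using b by (intro pole_order_unramified) auto
    qed
    moreover have "order a q * (n - degree p) \<le> order a q * (n - degree ?s)"
      using degree_specialize_le[of a p] by (intro mult_le_mono2 diff_le_mono2)
    ultimately show ?thesis by (rule order_trans[rotated])
  qed
qed

lemma affine_fibre_equality:
  assumes a: "poly q a = 0" and n2: "n \<ge> 2"
    and sum: "(\<Sum>b | b ^ n = 1 - a ^ n. pole_order z (Aff a b)) \<le> order a q"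
    and Q: "on_curve n (Aff a b)" and pole: "pole_order z (Aff a b) > 0"
  shows "coeff (specialize a p) (n - 2) = b * coeff (specialize a p) (n - 1)"
proof -
  let ?s = "specialize a p"
  note s = reduced[OF a]
  have deg_s: "degree ?s \<le> n - 1" using degree_specialize_le[of a p] deg_p by simp
  have bn: "1 - a ^ n = b ^ n" using Q by (simp add: algebra_simps)
  show ?thesis
  proof (cases "b = 0")
    \<comment> \<open>At a ramified point \<open>n m - order 0 s \<le> m\<close> forces
      \<open>order 0 s \<ge> n - 1\<close>, where \<open>m\<close> is the order of \<open>q\<close>
      at \<open>a\<close>. So \<open>Y^(n-1)\<close> divides \<open>s\<close>, and the coefficient
      of \<open>Y^(n-2)\<close> is 0, as the claim demands for \<open>b = 0\<close>.\<close>
    case True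
    then have "a ^ n = 1" using bn n_pos by (simp add: power_0_left)
    then have "n * order a q - order 0 ?s \<le> order a q"
      using sum pole_order_ramified[OF _ s] n_pos by (simp add: ramified_fibre power_0_left)
    moreover have "order a q \<ge> 1" using a q by (simp add: order_root Suc_le_eq)
    moreover have "(n - 1) * 1 \<le> (n - 1) * order a q" using calculation(2) by (intro mult_le_mono2)
    moreover have "n * order a q = (n - 1) * order a q + order a q"
      using n_pos by (cases n) auto
    ultimately have "n - 1 \<le> order 0 ?s" by linarith
    then have "[:-0, 1:] ^ (n - 1) dvd ?s" using order_1 power_le_dvd by blast
    then obtain r where "?s = [:0, 1:] ^ (n - 1) * r" by auto
    then have "?s = monom 1 (n - 1) * r" by (simp add: monom_altdef)
    then have "coeff ?s (n - 2) = 0" using n2 by (simp add: coeff_monom_mult)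
    then show ?thesis using True by simp
  next
    case False
    show ?thesis
    proof (rule fibre_sum_equality[where g = "\<lambda>b. pole_order z (Aff a b)", OF n2 False s deg_s _ pole])
      show "(\<Sum>b' | b' ^ n = b ^ n. pole_order z (Aff a b')) \<le> order a q" using sum bn by simp
      fix b' assume b': "b' ^ n = b ^ n" "poly ?s b' \<noteq> 0"
      then have "b' \<noteq> 0" using False n_pos by (auto simp: power_0_left)
      then show "pole_order z (Aff a b') = order a q" using b' bn[symmetric]
        by (intro pole_order_unramified) auto
    qed
  qed
qed

context
  fixes D
  assumes D: "total_degree_le D p" "degree q \<le> D" "D = degree q \<or> top_form D p \<noteq> 0"
begin

lemma degree_p_le_D: "degree p \<le> D"
  using D(1) p_nonzero unfolding total_degree_le_def by (metis add_leD1 leading_coeff_0_iff)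

lemma pole_order_infinity:
  assumes Q: "on_curve n (Inf f)"
  shows "pole_order z (Inf f) \<le> D - degree q"
    "poly (top_form D p) f \<noteq> 0 \<Longrightarrow> pole_order z (Inf f) = D - degree q"
  using ord_E2_infinity[OF Q D(1)] ord_z[OF Q] ord_E1_infinity[OF Q q] D(2)
  unfolding pole_order_def by auto

text \<open>Infinity acts as a further root of \<open>q\<close>, of multiplicity
  \<open>D - degree q\<close>; together with the affine roots the multiplicities add up to
  \<open>D\<close>.\<close>

lemma infinite_fibre_bound:
  "(D - degree q) * (n - degree p) \<le> (\<Sum>f | f ^ n = -1. pole_order z (Inf f))"
proof (cases "D = degree q")
  case False
  then have \<tau>: "top_form D p \<noteq> 0" using D by simp
  have "(D - degree q) * (n - degree (top_form D p)) \<le> (\<Sum>f | f ^ n = -1. pole_order z (Inf f))"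
    using pole_order_infinity(2) by (intro fibre_sum_lower_bound n_pos \<tau>) auto
  moreover have "(D - degree q) * (n - degree p) \<le> (D - degree q) * (n - degree (top_form D p))"
    using degree_top_form_le[of D p] by (intro mult_le_mono2 diff_le_mono2)
  ultimately show ?thesis by (rule order_trans[rotated])
qed simp

lemma infinite_fibre_equality:
  assumes n2: "n \<ge> 2" and sum: "(\<Sum>f | f ^ n = -1. pole_order z (Inf f)) \<le> D - degree q"
    and Q: "on_curve n (Inf f)" and pole: "pole_order z (Inf f) > 0"
  shows "coeff (top_form D p) (n - 2) = f * coeff (top_form D p) (n - 1)"
proof (rule fibre_sum_equality[where g = "\<lambda>f. pole_order z (Inf f)", OF n2 _ _ _ _ pole])
  have fn: "f ^ n = -1" using Q by simp
  then show "f \<noteq> 0" using n_pos by (auto simp: power_0_left)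
  show "top_form D p \<noteq> 0" using D pole pole_order_infinity(1)[OF Q] by auto
  show "degree (top_form D p) \<le> n - 1" using degree_top_form_le[of D p] deg_p by simp
  show "(\<Sum>f' | f' ^ n = f ^ n. pole_order z (Inf f')) \<le> D - degree q" using sum fn by simp
  show "pole_order z (Inf f') = D - degree q" if "f' ^ n = f ^ n" "poly (top_form D p) f' \<noteq> 0" for f'
    using that fn by (intro pole_order_infinity) auto
qed

lemma pole_degree_by_fibres:
  "finite (poles z) \<and> pole_degree z = (\<Sum>a | poly q a = 0. \<Sum>b | b ^ n = 1 - a ^ n. pole_order z (Aff a b)) +
     (\<Sum>f | f ^ n = -1. pole_order z (Inf f))"
proof -
  let ?A = "{a. poly q a = 0}" and ?B = "\<lambda>a. {b. b ^ n = 1 - a ^ n}" and ?C = "{f. f ^ n = (-1::complex)}"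
  let ?U = "(\<lambda>(a, b). Aff a b) ` Sigma ?A ?B" and ?V = "Inf ` ?C"
  have fin: "finite ?A" "finite (?B a)" "finite ?C" for a :: complex
  proof -
    show "finite (?B a)"
      using finite_card_nth_roots[of "1 - a ^ n" n] ramified_fibre[of a] n_pos
      by (cases "a ^ n = 1") auto
  qed (use poly_roots_finite[OF q] finite_card_nth_roots[of "-1" n] n_pos in auto)
  have finU: "finite ?U" "finite ?V" using fin by auto
  have sub: "poles z \<subseteq> ?U \<union> ?V"
  proof
    fix Q assume Q: "Q \<in> poles z"
    show "Q \<in> ?U \<union> ?V"
    proof (cases Q)
      case (Aff a b)
      have oc: "on_curve n (Aff a b)" using Q Aff by (simp add: poles_def)
      have "poly q a = 0"
      proof (rule ccontr)
        assume "poly q a \<noteq> 0"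
        then have "ord_at (Aff a b) (E1 q) = 0" using ord_E1_affine[OF oc q] by (simp add: order_root)
        moreover have "ord_at (Aff a b) (E2 p) \<ge> 0"
          using reduces_E2_affine[OF oc] reduces_ex_iff unfolding ord_at_def by blast
        ultimately show False using Q Aff ord_z[OF oc] by (simp add: poles_def)
      qed
      moreover have "b ^ n = 1 - a ^ n" using oc by (simp add: algebra_simps)
      ultimately show ?thesis using Aff by force
    next
      case (Inf f)
      then show ?thesis using Q by (auto simp: poles_def)
    qed
  qed
  have "pole_degree z = (\<Sum>Q\<in>?U \<union> ?V. pole_order z Q)"
    unfolding pole_degree_def
  proof (rule sum.mono_neutral_left)
    show "\<forall>Q\<in>?U \<union> ?V - poles z. pole_order z Q = 0"
      by (auto simp: poles_def pole_order_def algebra_simps)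
  qed (use finU sub in auto)
  also have "\<dots> = (\<Sum>Q\<in>?U. pole_order z Q) + (\<Sum>Q\<in>?V. pole_order z Q)"
    using finU by (intro sum.union_disjoint) auto
  also have "(\<Sum>Q\<in>?V. pole_order z Q) = (\<Sum>f\<in>?C. pole_order z (Inf f))"
    by (subst sum.reindex) (auto simp: inj_on_def)
  also have "(\<Sum>Q\<in>?U. pole_order z Q) = (\<Sum>(a, b)\<in>Sigma ?A ?B. pole_order z (Aff a b))"
    by (subst sum.reindex) (auto simp: inj_on_def intro!: sum.cong)
  also have "\<dots> = (\<Sum>a\<in>?A. \<Sum>b\<in>?B a. pole_order z (Aff a b))"
    using fin by (intro sum.Sigma[symmetric]) auto
  finally show ?thesis using finU sub finite_subset by blast
qed

lemma pole_degree_bound: "D * (n - degree p) \<le> pole_degree z"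
proof -
  have "D * (n - degree p) = ((\<Sum>a | poly q a = 0. order a q) + (D - degree q)) * (n - degree p)"
    using D(2) by (simp add: sum_order_eq_degree[OF q])
  also have "\<dots> = (\<Sum>a | poly q a = 0. order a q * (n - degree p)) + (D - degree q) * (n - degree p)"
    by (simp add: add_mult_distrib sum_distrib_right)
  also have "\<dots> \<le> pole_degree z"
    unfolding pole_degree_by_fibres[THEN conjunct2]
    by (intro add_mono sum_mono affine_fibre_bound infinite_fibre_bound) auto
  finally show ?thesis .
qed

text \<open>If the bound is attained with \<open>y\<close>-degree \<open>n - 1\<close>, then every fibre contributes its
  minimum, and comparing the two top coefficients in \<open>y\<close> shows that all poles lie on one line.\<close>

lemma poles_collinear:
  assumes n2: "n \<ge> 2" and p: "degree p = n - 1" and eq: "D = n - 1" "pole_degree z = n - 1"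
  shows "\<exists>\<alpha> \<beta>. (\<forall>a b. Aff a b \<in> poles z \<longrightarrow> b = \<alpha> * a + \<beta>) \<and> (\<forall>f. Inf f \<in> poles z \<longrightarrow> f = \<alpha>)"
proof -
  let ?A = "{a. poly q a = 0}"
  let ?S = "\<lambda>a. \<Sum>b | b ^ n = 1 - a ^ n. pole_order z (Aff a b)" and ?T = "\<Sum>f | f ^ n = -1. pole_order z (Inf f)"
  have finA: "finite ?A" by (rule poly_roots_finite[OF q])
  have one: "n - degree p = 1" using p n_pos by simp
  have low: "order a q \<le> ?S a" if "poly q a = 0" for a
    using affine_fibre_bound[OF that] one by simp
  have lowT: "D - degree q \<le> ?T" using infinite_fibre_bound one by simp
  have tot: "(\<Sum>a\<in>?A. ?S a) + ?T = (\<Sum>a\<in>?A. order a q) + (D - degree q)"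
    using pole_degree_by_fibres eq D(2) sum_order_eq_degree[OF q] by simp
  have lowS: "(\<Sum>a\<in>?A. order a q) \<le> (\<Sum>a\<in>?A. ?S a)" using low by (intro sum_mono) auto
  then have T: "?T \<le> D - degree q" and S: "(\<Sum>a\<in>?A. ?S a) = (\<Sum>a\<in>?A. order a q)"
    using tot lowT by linarith+
  have Sa: "?S a \<le> order a q" if "poly q a = 0" for a
  proof (rule ccontr)
    assume "\<not> ?S a \<le> order a q"
    then have "(\<Sum>a\<in>?A. order a q) < (\<Sum>a\<in>?A. ?S a)"
      using that low finA by (intro sum_strict_mono_ex1) (auto simp: not_le)
    then show False using S by simp
  qed
  \<comment> \<open>Total degree at most \<open>n - 1\<close> makes the coefficient of
    \<open>y^(n-1)\<close> a constant \<open>lead\<close> and that of \<open>y^(n-2)\<close> a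
    linear polynomial \<open>u + w x\<close>. At an affine pole the comparison reads
    \<open>u + w a = b * lead\<close>, at an infinite one \<open>w = f * lead\<close>: both describe
    the line \<open>y = (w x + u) / lead\<close>.\<close>
  define lead where "lead = coeff (coeff p (n - 1)) 0"
  have "coeff p (n - 1) \<noteq> 0" using p p_nonzero(2) by (metis leading_coeff_0_iff)
  then have "degree (coeff p (n - 1)) = 0"
    using D(1) eq(1) unfolding total_degree_le_def by fastforce
  then have c1: "coeff p (n - 1) = [:lead:]" unfolding lead_def by (metis degree_eq_zeroE coeff_pCons_0)
  then have lead: "lead \<noteq> 0" using \<open>coeff p (n - 1) \<noteq> 0\<close> by simp
  have "degree (coeff p (n - 2)) \<le> 1"
    using D(1) eq(1) n2 unfolding total_degree_le_def by (cases "coeff p (n - 2) = 0") fastforce+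
  then obtain u w where c2: "coeff p (n - 2) = [:u, w:]" by (rule degree_le_1_E)
  show ?thesis
  proof (rule exI[of _ "w / lead"], rule exI[of _ "u / lead"], intro conjI allI impI)
    fix a b assume pole: "Aff a b \<in> poles z"
    then have Q: "on_curve n (Aff a b)" and "pole_order z (Aff a b) > 0"
      by (auto simp: poles_def pole_order_def)
    moreover have "poly q a = 0"
    proof (rule ccontr)
      assume "poly q a \<noteq> 0"
      then have "ord_at (Aff a b) (E1 q) = 0" using ord_E1_affine[OF Q q] by (simp add: order_root)
      moreover have "ord_at (Aff a b) (E2 p) \<ge> 0"
        using reduces_E2_affine[OF Q] reduces_ex_iff unfolding ord_at_def by blast
      ultimately show False using pole ord_z[OF Q] by (simp add: poles_def)
    qed
    ultimately have "coeff (specialize a p) (n - 2) = b * coeff (specialize a p) (n - 1)"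
      using Sa by (intro affine_fibre_equality n2) auto
    then show "b = w / lead * a + u / lead"
      using lead by (simp only: coeff_specialize c1 c2) (simp add: field_simps)
  next
    fix f assume "Inf f \<in> poles z"
    then have "on_curve n (Inf f)" "pole_order z (Inf f) > 0"
      by (auto simp: poles_def pole_order_def)
    then have "coeff (top_form D p) (n - 2) = f * coeff (top_form D p) (n - 1)"
      using T by (intro infinite_fibre_equality n2) auto
    moreover have "n - 1 - (n - 2) = 1" using n2 by simp
    then have "coeff (top_form D p) (n - 2) = w" unfolding coeff_top_form eq(1) c2 by simp
    moreover have "coeff (top_form D p) (n - 1) = lead" unfolding coeff_top_form eq(1) c1 by simp
    ultimately have "w = f * lead" by metis
    then show "f = w / lead" using lead by simp
  qed
qed

end

end

text \<open>The larger of \<open>d\<close> and the total degree of \<open>p\<close>; if the latter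
  attains it, some coefficient of the top form is nonzero. It is applied with
  \<open>d = degree q\<close>.\<close>

lemma total_degree_exists:
  obtains D where "total_degree_le D p" "d \<le> D" "D = d \<or> top_form D p \<noteq> 0"
proof -
  let ?I = "{i. coeff p i \<noteq> 0}"
  let ?S = "insert d ((\<lambda>i. i + degree (coeff p i)) ` ?I)"
  have "?I \<subseteq> {..degree p}" by (auto intro: le_degree)
  then have fin: "finite ?S" by (auto intro: finite_subset)
  define D where "D = Max ?S"
  have le: "s \<le> D" if "s \<in> ?S" for s unfolding D_def using fin that by (rule Max_ge)
  have "D \<in> ?S" unfolding D_def using fin by (intro Max_in) auto
  then consider "D = d" | i where "coeff p i \<noteq> 0" "D = i + degree (coeff p i)" by auto
  then have "D = d \<or> top_form D p \<noteq> 0"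
  proof cases
    case (2 i)
    then have "coeff (top_form D p) i \<noteq> 0" by (simp add: coeff_top_form)
    then show ?thesis by auto
  qed simp
  moreover have "total_degree_le D p" using le by (auto simp: total_degree_le_def)
  moreover have "d \<le> D" using le by simp
  ultimately show thesis using that by blast
qed

section \<open>The lower bound for the number of poles, and when it is attained\<close>

lemma finite_poles:
  assumes "z \<in> F"
  shows "finite (poles z)"
proof (cases "z = 0")
  case True
  then have "poles z = {}" by (auto simp: poles_def ord_at_def)
  then show ?thesis by simp
next
  case False
  obtain p q where pq: "q \<noteq> 0" "degree p < n" "z = E2 p / E1 q" "\<And>a. poly q a = 0 \<Longrightarrow> specialize a p \<noteq> 0"
    using F_reduced[OF assms] by metis
  obtain D where D: "total_degree_le D p" "degree q \<le> D" "D = degree q \<or> top_form D p \<noteq> 0"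
    by (rule total_degree_exists)
  show ?thesis using pole_degree_by_fibres[OF pq(3) False pq(1,2,4) D] by simp
qed

text \<open>With \<open>n = k + j + 1\<close> and \<open>D = k + e\<close> the difference
  \<open>D (n - k) - (n - 1)\<close> equals \<open>(k - 1) j + e (j + 1)\<close>. For
  \<open>k \<ge> 1\<close> it is nonnegative, and 0 only if \<open>e = 0\<close> and
  \<open>k = 1\<close> or \<open>j = 0\<close>. For \<open>k = 0\<close> it is positive, since then
  \<open>e \<ge> 1\<close>.\<close>

lemma degree_product_bound:
  fixes k D :: nat
  assumes "k \<le> D" "k < n" "D \<ge> 1"
  shows "n - 1 \<le> D * (n - k)" "D * (n - k) \<le> n - 1 \<Longrightarrow> D = k \<and> (k = 1 \<or> k = n - 1)"
proof -
  obtain j where j: "n = k + Suc j" using assms(2) less_iff_Suc_add by auto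
  obtain e where e: "D = k + e" using assms(1) le_iff_add by blast
  have *: "D * (n - k) = k * j + k + e * Suc j" "n - 1 = k + j" by (simp_all add: j e algebra_simps)
  show "n - 1 \<le> D * (n - k)"
  proof (cases k)
    case 0
    then have "e \<ge> 1" using assms e by simp
    then have "1 * Suc j \<le> e * Suc j" by (intro mult_le_mono1)
    then show ?thesis unfolding * using 0 by simp
  next
    case (Suc k')
    then show ?thesis unfolding * by simp
  qed
  assume le: "D * (n - k) \<le> n - 1"
  show "D = k \<and> (k = 1 \<or> k = n - 1)"
  proof (cases k)
    case 0
    then have "e \<ge> 1" using assms e by simp
    then have "1 * Suc j \<le> e * Suc j" by (intro mult_le_mono1)
    then show ?thesis using le 0 unfolding * by simp
  next
    case (Suc k')
    then have "k' * j + e * Suc j = 0" using le unfolding * by simp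
    then show ?thesis using e Suc j by auto
  qed
qed

theorem pole_degree_ge:
  assumes "z \<in> F" "z \<notin> range \<iota>"
  shows "n - 1 \<le> pole_degree z"
    and "n \<ge> 2 \<Longrightarrow> pole_degree z = n - 1 \<Longrightarrow>
      (\<exists>\<alpha> \<beta> \<gamma> a. z = (\<iota> \<alpha> * x + \<iota> \<beta> * y + \<iota> \<gamma>) / (x - \<iota> a)) \<or>
      (\<exists>\<alpha> \<beta> \<gamma>. z = \<iota> \<alpha> * x + \<iota> \<beta> * y + \<iota> \<gamma>) \<or>
      (\<exists>\<alpha> \<beta>. (\<forall>a b. Aff a b \<in> poles z \<longrightarrow> b = \<alpha> * a + \<beta>) \<and> (\<forall>f. Inf f \<in> poles z \<longrightarrow> f = \<alpha>))"
proof -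
  have z0: "z \<noteq> 0" using assms(2) \<iota>_0 by (metis rangeI)
  obtain p q where pq: "q \<noteq> 0" "degree p < n" "z = E2 p / E1 q" "\<And>a. poly q a = 0 \<Longrightarrow> specialize a p \<noteq> 0"
    using F_reduced[OF assms(1)] by metis
  obtain D where D: "total_degree_le D p" "degree q \<le> D" "D = degree q \<or> top_form D p \<noteq> 0"
    by (rule total_degree_exists)
  note facts = pq(3) z0 pq(1,2,4) D
  have p0: "p \<noteq> 0" using p_nonzero(2)[OF facts(1-5)] .
  have deg: "degree p \<le> D" by (rule degree_p_le_D[OF facts])
  have low_degree: "\<exists>c. coeff p i = [:c:]" if "i + 0 \<ge> D" for i
  proof -
    have "degree (coeff p i) = 0"
      using D(1) that unfolding total_degree_le_def by (cases "coeff p i = 0") fastforce+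
    then show ?thesis by (metis degree_eq_zeroE)
  qed
  have D1: "D \<ge> 1"
  proof (rule ccontr)
    assume "\<not> D \<ge> 1"
    then have D0: "D = 0" by simp
    then obtain c where "q = [:c:]" using D(2) by (metis degree_eq_zeroE le_zero_eq)
    moreover obtain d where "coeff p 0 = [:d:]" using low_degree D0 by blast
    moreover obtain r where "p = [:r:]" using deg D0 by (metis degree_eq_zeroE le_zero_eq)
    ultimately have "z = \<iota> (d * inverse c)" using pq(3) by (simp add: divide_inverse)
    then show False using assms(2) by blast
  qed
  have bound: "D * (n - degree p) \<le> pole_degree z" by (rule pole_degree_bound[OF facts])
  show "n - 1 \<le> pole_degree z"
    using degree_product_bound(1)[OF deg pq(2) D1] bound by simp
  assume n2: "n \<ge> 2" and eq: "pole_degree z = n - 1"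
  then have Dk: "D = degree p" "degree p = 1 \<or> degree p = n - 1"
    using degree_product_bound(2)[OF deg pq(2) D1] bound by auto
  show "(\<exists>\<alpha> \<beta> \<gamma> a. z = (\<iota> \<alpha> * x + \<iota> \<beta> * y + \<iota> \<gamma>) / (x - \<iota> a)) \<or>
      (\<exists>\<alpha> \<beta> \<gamma>. z = \<iota> \<alpha> * x + \<iota> \<beta> * y + \<iota> \<gamma>) \<or>
      (\<exists>\<alpha> \<beta>. (\<forall>a b. Aff a b \<in> poles z \<longrightarrow> b = \<alpha> * a + \<beta>) \<and> (\<forall>f. Inf f \<in> poles z \<longrightarrow> f = \<alpha>))"
  proof (cases "degree p = n - 1")
    case True
    then show ?thesis using poles_collinear[OF facts n2 True] Dk eq by simp
  next
    case False
    then have d1: "degree p = 1" "D = 1" using Dk by auto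
    obtain r0 r1 where p: "p = [:r0, r1:]" 
      using d1(1) by (metis degree_eq_zeroE degree_pCons_eq_if nat.inject One_nat_def pCons_cases zero_neq_one)
    have "\<exists>c. coeff p 1 = [:c:]" using low_degree d1 by simp
    then obtain \<beta> where \<beta>: "r1 = [:\<beta>:]" using p by auto
    have "degree (coeff p 0) \<le> 1"
      using D(1) d1 unfolding total_degree_le_def by (cases "coeff p 0 = 0") auto
    then have "degree r0 \<le> 1" using p by simp
    then obtain \<gamma> \<alpha> where r0: "r0 = [:\<gamma>, \<alpha>:]" by (metis degree_le_1_E)
    have E: "E2 p = \<iota> \<alpha> * x + \<iota> \<beta> * y + \<iota> \<gamma>" unfolding p \<beta> r0 by (simp add: algebra_simps)
    obtain q0 q1 where q: "q = [:q0, q1:]" using D(2) d1 by (metis degree_le_1_E)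
    show ?thesis
    proof (cases "q1 = 0")
      case True
      then have "z = \<iota> (\<alpha> * inverse q0) * x + \<iota> (\<beta> * inverse q0) * y + \<iota> (\<gamma> * inverse q0)"
        using pq(3) E q by (simp add: divide_inverse algebra_simps)
      then show ?thesis by blast
    next
      case False
      define u where "u = x - \<iota> (- q0 * inverse q1)"
      have "E1 q = \<iota> q1 * u" using False q by (simp add: u_def algebra_simps)
      then have "z = (\<iota> (\<alpha> * inverse q1) * x + \<iota> (\<beta> * inverse q1) * y + \<iota> (\<gamma> * inverse q1)) / u"
        using pq(3) E by (simp add: divide_inverse algebra_simps)
      then show ?thesis unfolding u_def by blast
    qed
  qed
qed

end

section \<open>Functions of degree \<open>n - 1\<close> with divisor at the coordinate points\<close>

lemma two_elements:
  assumes "card S \<ge> 2"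
  obtains u w where "u \<in> S" "w \<in> S" "u \<noteq> w"
proof -
  have "finite S" using assms by (metis card.infinite not_numeral_le_zero)
  then show thesis using that assms card_le_Suc0_iff_eq[of S] by fastforce
qed

definition points_a :: "nat \<Rightarrow> point set" where
  "points_a n = Aff 0 ` {b. b ^ n = 1}"

definition points_b :: "nat \<Rightarrow> point set" where
  "points_b n = (\<lambda>a. Aff a 0) ` {a. a ^ n = 1}"

text \<open>The point \<open>(e : 1 : 0)\<close> is \<open>Inf (1/e)\<close>, and inversion permutes
  the \<open>n\<close>-th roots of -1.\<close>

definition points_c :: "nat \<Rightarrow> point set" where
  "points_c n = Inf ` {f. f ^ n = -1}"

definition coordinate_points :: "nat \<Rightarrow> point set" where
  "coordinate_points n = points_a n \<union> points_b n \<union> points_c n"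

lemma finite_card_points:
  assumes "n > 0"
  shows "finite (points_a n)" "finite (points_b n)" "finite (points_c n)"
    "card (points_a n) = n" "card (points_b n) = n" "card (points_c n) = n"
  using assms finite_card_nth_roots[of 1 n] finite_card_nth_roots[of "-1" n]
  by (auto simp: points_a_def points_b_def points_c_def card_image inj_on_def)

lemma finite_coordinate_points: "n > 0 \<Longrightarrow> finite (coordinate_points n)"
  by (simp add: coordinate_points_def finite_card_points)

lemma on_curve_coordinate_points: "n > 0 \<Longrightarrow> Q \<in> coordinate_points n \<Longrightarrow> on_curve n Q"
  by (auto simp: coordinate_points_def points_a_def points_b_def points_c_def)

section \<open>Linear forms and the possible positions of the poles\<close>

context fermat
begin

definition linear_form :: "complex \<Rightarrow> complex \<Rightarrow> complex \<Rightarrow> 'a" where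
  "linear_form \<alpha> \<beta> \<gamma> = \<iota> \<alpha> * x + \<iota> \<beta> * y + \<iota> \<gamma>"

lemma linear_E2: "linear_form \<alpha> \<beta> \<gamma> = E2 [:[:\<gamma>, \<alpha>:], [:\<beta>:]:]"
  by (simp add: linear_form_def algebra_simps)

lemma linear_F [simp]: "linear_form \<alpha> \<beta> \<gamma> \<in> F"
  unfolding linear_E2 by simp

lemma linear_0 [simp]: "linear_form 0 0 0 = 0"
  by (simp add: linear_form_def)

lemma reduces_linear:
  assumes "on_curve n (Aff a b)"
  shows "reduces (expansion (Aff a b) (linear_form \<alpha> \<beta> \<gamma>)) (\<alpha> * a + \<beta> * b + \<gamma>)"
  using reduces_E2_affine[OF assms, of "[:[:\<gamma>, \<alpha>:], [:\<beta>:]:]"] unfolding linear_E2 by (simp add: algebra_simps)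

lemma reduces_linear_infinity:
  assumes "on_curve n (Inf f)"
  shows "reduces (expansion (Inf f) (linear_form \<alpha> \<beta> \<gamma> / x)) (\<alpha> + \<beta> * f)"
proof -
  have eq: "linear_form \<alpha> \<beta> \<gamma> / x = \<iota> \<alpha> + \<iota> \<beta> * (y / x) + \<iota> \<gamma> * inverse x"
    using x_nonzero by (simp add: linear_form_def field_simps)
  have "expansion (Inf f) (linear_form \<alpha> \<beta> \<gamma> / x) = fls_const \<alpha> + fls_const \<beta> * (Y_at (Inf f) / X_at (Inf f)) +
      fls_const \<gamma> * inverse (X_at (Inf f))"
    unfolding eq using assms by simp
  moreover have "reduces \<dots> (\<alpha> + \<beta> * f + \<gamma> * 0)"
    by (intro reduces_add reduces_mult reduces_const reduces_inverse_x[OF assms])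
  ultimately have "reduces (expansion (Inf f) (linear_form \<alpha> \<beta> \<gamma> / x)) (\<alpha> + \<beta> * f + \<gamma> * 0)" by metis
  then show ?thesis by simp
qed

lemma reduces_ord_nonneg: "reduces (expansion Q z) c \<Longrightarrow> ord_at Q z \<ge> 0"
  using reduces_ex_iff by (auto simp: ord_at_def)

lemma reduces_ord_zero: "reduces (expansion Q z) c \<Longrightarrow> c \<noteq> 0 \<Longrightarrow> ord_at Q z = 0"
  using reduces_nonzero by (auto simp: ord_at_def)

lemma reduces_ord_pos: "reduces (expansion Q z) c \<Longrightarrow> ord_at Q z > 0 \<Longrightarrow> c = 0"
  using reduces_ord_zero by force

lemma ord_x_at_a: "on_curve n (Aff 0 b) \<Longrightarrow> ord_at (Aff 0 b) x = 1"
  using ord_x_minus[of 0 b] n_pos by (auto simp: ram_index_def power_0_left)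

lemma poles_inverse: "z \<in> F \<Longrightarrow> poles (inverse z) = {Q. on_curve n Q \<and> ord_at Q z > 0}"
  by (auto simp: poles_def ord_inverse)

text \<open>At affine points with another \<open>x\<close>-coordinate the denominator is a unit. At
  infinity it has a simple pole and the linear form a pole of order at most 1, so the quotient is
  regular.\<close>

lemma poles_linear_fraction:
  "poles (linear_form \<alpha> \<beta> \<gamma> / (x - \<iota> a)) \<subseteq> range (Aff a)"
proof
  fix Q assume pole: "Q \<in> poles (linear_form \<alpha> \<beta> \<gamma> / (x - \<iota> a))"
  then have Q: "on_curve n Q" "ord_at Q (linear_form \<alpha> \<beta> \<gamma> / (x - \<iota> a)) < 0" by (auto simp: poles_def)
  show "Q \<in> range (Aff a)"
  proof (cases Q)
    case (Aff a' b')
    have "a' = a"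
    proof (rule ccontr)
      assume "a' \<noteq> a"
      have oc: "on_curve n (Aff a' b')" using Q Aff by simp
      have "reduces (expansion Q (x - \<iota> a)) (a' - a)"
        using reduces_xy_affine(1)[OF oc] Q Aff by auto
      then have "reduces (expansion Q (linear_form \<alpha> \<beta> \<gamma>) * inverse (expansion Q (x - \<iota> a)))
          ((\<alpha> * a' + \<beta> * b' + \<gamma>) * inverse (a' - a))"
        using reduces_linear[OF oc] Aff \<open>a' \<noteq> a\<close> by (intro reduces_mult reduces_inverse) auto
      also have "expansion Q (linear_form \<alpha> \<beta> \<gamma>) * inverse (expansion Q (x - \<iota> a)) =
          expansion Q (linear_form \<alpha> \<beta> \<gamma> / (x - \<iota> a))"
        using Q(1) by (simp add: divide_inverse)
      finally show False using reduces_ord_nonneg Q(2) by fastforce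
    qed
    then show ?thesis using Aff by simp
  next
    case (Inf f)
    then have oc: "on_curve n (Inf f)" using Q by simp
    have "linear_form \<alpha> \<beta> \<gamma> \<noteq> 0" using Q by (auto simp: ord_at_def)
    moreover have "x - \<iota> a \<noteq> 0" using x_transcendental by auto
    moreover have "ord_at Q (x - \<iota> a) = -1"
      using ord_E1_infinity[OF oc, of "[:-a, 1:]"] Inf by simp
    moreover have "ord_at Q (linear_form \<alpha> \<beta> \<gamma> / x) \<ge> 0"
      using reduces_ord_nonneg[OF reduces_linear_infinity[OF oc]] Inf by simp
    ultimately show ?thesis using Q ord_x_infinity[OF oc] Inf x_nonzero by (simp add: ord_divide)
  qed
qed

lemma poles_linear: "poles (linear_form \<alpha> \<beta> \<gamma>) \<subseteq> points_c n"
proof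
  fix Q assume Q: "Q \<in> poles (linear_form \<alpha> \<beta> \<gamma>)"
  show "Q \<in> points_c n"
  proof (cases Q)
    case (Aff a b)
    then have "on_curve n (Aff a b)" using Q by (simp add: poles_def)
    from reduces_ord_nonneg[OF reduces_linear[OF this]] show ?thesis
      using Q Aff by (simp add: poles_def not_le[symmetric])
  next
    case (Inf f)
    then show ?thesis using Q by (auto simp: poles_def points_c_def)
  qed
qed

text \<open>No formula for \<open>z\<close> accompanies \<open>points_b\<close>: the collinear
  alternative only locates the poles. Lines \<open>y = \<alpha> x + \<beta>\<close> include
  \<open>y = 0\<close> but no vertical line, so \<open>x = 0\<close> arises only from the
  fraction.\<close>

lemma pole_classes:
  assumes n4: "n \<ge> 4" and z: "z \<in> F" "z \<notin> range \<iota>" and deg: "pole_degree z = n - 1"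
    and card: "card (poles z) = n - 1" and sub: "poles z \<subseteq> coordinate_points n"
  shows "poles z \<subseteq> points_b n \<or> (poles z \<subseteq> points_a n \<and> (\<exists>\<alpha> \<beta> \<gamma>. z = linear_form \<alpha> \<beta> \<gamma> / x)) \<or>
    (poles z \<subseteq> points_c n \<and> (\<exists>\<alpha> \<beta> \<gamma>. z = linear_form \<alpha> \<beta> \<gamma>))"
proof -
  have fin: "finite (poles z)" by (rule finite_poles[OF z(1)])
  consider (fraction) \<alpha> \<beta> \<gamma> a where "z = linear_form \<alpha> \<beta> \<gamma> / (x - \<iota> a)"
    | (lin) \<alpha> \<beta> \<gamma> where "z = linear_form \<alpha> \<beta> \<gamma>"
    | (line) \<alpha> \<beta> where "\<And>a b. Aff a b \<in> poles z \<Longrightarrow> b = \<alpha> * a + \<beta>" "\<And>f. Inf f \<in> poles z \<Longrightarrow> f = \<alpha>"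
    using pole_degree_ge(2)[OF z _ deg] n4 unfolding linear_form_def by fastforce
  then show ?thesis
  proof cases
    case (fraction \<alpha> \<beta> \<gamma> a)
    then have sub': "poles z \<subseteq> range (Aff a)" using poles_linear_fraction by blast
    \<comment> \<open>For \<open>a \<noteq> 0\<close> the line \<open>x = a\<close> meets the
      coordinate points at most in \<open>(a : 0 : 1)\<close>, too few for \<open>n - 1\<close>
      poles.\<close>
    have "a = 0"
    proof (rule ccontr)
      assume "a \<noteq> 0"
      then have "poles z \<subseteq> {Aff a 0}"
        using sub sub' by (auto simp: coordinate_points_def points_a_def points_b_def points_c_def)
      then have "card (poles z) \<le> card {Aff a 0}" by (intro card_mono) auto
      then show False using card n4 by simp
    qed
    then have "poles z \<subseteq> points_a n" 
      using sub sub' n4 by (auto simp: coordinate_points_def points_a_def points_b_def points_c_def power_0_left)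
    moreover have "z = linear_form \<alpha> \<beta> \<gamma> / x" using fraction \<open>a = 0\<close> by simp
    ultimately show ?thesis by blast
  next
    case (lin \<alpha> \<beta> \<gamma>)
    then show ?thesis using poles_linear by blast
  next
    case (line \<alpha> \<beta>)
    have "poles z \<subseteq> points_b n"
    proof (rule ccontr)
      assume "\<not> ?thesis"
      then obtain Q0 where Q0: "Q0 \<in> poles z" "Q0 \<in> points_a n \<union> points_c n"
        using sub unfolding coordinate_points_def by blast
      \<comment> \<open>The line \<open>y = 0\<close> contains no point of \<open>points_a\<close>
        or \<open>points_c\<close>, so the pole \<open>Q0\<close> excludes it.\<close>
      have nonzero: "\<alpha> \<noteq> 0 \<or> \<beta> \<noteq> 0"
      proof (rule ccontr)
        assume "\<not> ?thesis"
        then have 0: "\<alpha> = 0" "\<beta> = 0" by auto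
        show False using Q0 line[of 0] line(2) n4 unfolding points_a_def points_c_def
          by (auto simp: 0 power_0_left) (fastforce simp: 0 power_0_left)+
      qed
      have three: "poles z \<subseteq> {Aff 0 \<beta>, Aff (- \<beta> / \<alpha>) 0, Inf \<alpha>}"
      proof
        fix Q assume Q: "Q \<in> poles z"
        then consider b where "Q = Aff 0 b" | a where "Q = Aff a 0" | f where "Q = Inf f"
          using sub unfolding coordinate_points_def points_a_def points_b_def points_c_def by blast
        then show "Q \<in> {Aff 0 \<beta>, Aff (- \<beta> / \<alpha>) 0, Inf \<alpha>}"
        proof cases
          case (1 b)
          then show ?thesis using line(1)[of 0 b] Q by simp
        next
          case (2 a)
          then have "\<alpha> * a + \<beta> = 0" using line(1)[of a 0] Q by simp
          then have "\<alpha> \<noteq> 0" "\<alpha> * a = - \<beta>" using nonzero by (auto simp: eq_neg_iff_add_eq_0)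
          then have "a = - \<beta> / \<alpha>" by (simp add: field_simps)
          then show ?thesis using 2 by simp
        next
          case (3 f)
          then show ?thesis using line(2)[of f] Q by simp
        qed
      qed
      have "card {Aff 0 \<beta>, Aff (- \<beta> / \<alpha>) 0, Inf \<alpha>} \<le> 3"
        by (simp add: card_insert_if)
      then have *: "poles z = {Aff 0 \<beta>, Aff (- \<beta> / \<alpha>) 0, Inf \<alpha>}" "n = 4"
        using card_seteq[OF _ three] card_mono[OF _ three] card n4 by auto
      then have oc: "on_curve n (Aff 0 \<beta>)" "on_curve n (Aff (- \<beta> / \<alpha>) 0)" "on_curve n (Inf \<alpha>)"
        unfolding poles_def by blast+
      then have "\<beta> ^ 4 = 1" "(- \<beta> / \<alpha>) ^ 4 = 1" "\<alpha> ^ 4 = -1" using *(2) by simp_all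
      \<comment> \<open>The three conditions are incompatible: the first and the third give
        \<open>(\<beta> / \<alpha>)^4 = -1\<close>.\<close>
      then show False by (simp add: power_divide)
    qed
    then show ?thesis by blast
  qed
qed

text \<open>Zeros and poles are disjoint, and \<open>2 (n - 1) > n\<close>.\<close>

lemma no_disjoint_pole_sets:
  assumes n4: "n \<ge> 4" and z: "z \<in> F" and card: "card (poles z) = n - 1" "card (poles (inverse z)) = n - 1"
    and sub: "poles z \<subseteq> A" "poles (inverse z) \<subseteq> A" and A: "finite A" "card A = n"
  shows False
proof -
  have "poles z \<inter> poles (inverse z) = {}" using z by (auto simp: poles_def ord_inverse)
  then have "card (poles z \<union> poles (inverse z)) = (n - 1) + (n - 1)"
    using card finite_poles z by (subst card_Un_disjoint) auto
  moreover have "card (poles z \<union> poles (inverse z)) \<le> card A" using sub A by (intro card_mono) auto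
  ultimately show False using A n4 by simp
qed

text \<open>Only \<open>n - 1\<close> of the \<open>n\<close> points on \<open>x = 0\<close> are
  poles, so the linear form vanishes at one of them, \<open>(0 : b0 : 1)\<close>. Two more zeros on
  \<open>y = 0\<close> give \<open>\<alpha> = \<gamma> = 0\<close>, two at infinity give
  \<open>\<alpha> = \<beta> = 0\<close>; combined with \<open>\<beta> b0 + \<gamma> = 0\<close> the
  form is 0.\<close>

lemma no_fraction_with_zeros_in_class:
  assumes n4: "n \<ge> 4" and z: "z = linear_form \<alpha> \<beta> \<gamma> / x" "z \<noteq> 0"
    and card: "card (poles z) = n - 1" "card (poles (inverse z)) = n - 1" and sub: "poles z \<subseteq> points_a n"
    and zeros: "poles (inverse z) \<subseteq> points_a n \<or> poles (inverse z) \<subseteq> points_b n \<or> poles (inverse z) \<subseteq> points_c n"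
  shows False
proof -
  have zF: "z \<in> F" using z by simp
  have l0: "linear_form \<alpha> \<beta> \<gamma> \<noteq> 0" using z by auto
  have "\<exists>b0. b0 ^ n = 1 \<and> \<beta> * b0 + \<gamma> = 0"
  proof (rule ccontr)
    assume no: "\<not> ?thesis"
    then have nz: "\<beta> * b + \<gamma> \<noteq> 0" if "b ^ n = 1" for b using that no by blast
    have "points_a n \<subseteq> poles z"
    proof
      fix Q assume "Q \<in> points_a n"
      then obtain b where b: "Q = Aff 0 b" "b ^ n = 1" by (auto simp: points_a_def)
      then have oc: "on_curve n (Aff 0 b)" using n4 by (simp add: power_0_left)
      have "ord_at Q (linear_form \<alpha> \<beta> \<gamma>) = 0"
        unfolding b by (rule reduces_ord_zero[OF reduces_linear[OF oc]]) (use nz b in simp)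
      then have "ord_at Q z = -1"
        using oc b z l0 x_nonzero ord_x_at_a[OF oc] by (simp add: ord_divide)
      then show "Q \<in> poles z" using oc b by (simp add: poles_def)
    qed
    then have "card (points_a n) \<le> card (poles z)" by (intro card_mono finite_poles zF)
    then show False using card finite_card_points[of n] n4 by simp
  qed
  then obtain b0 where b0: "b0 ^ n = 1" "\<beta> * b0 + \<gamma> = 0" by blast
  have b00: "b0 \<noteq> 0" using b0 n4 by (auto simp: power_0_left)
  have c2: "card (poles (inverse z)) \<ge> 2" using card n4 by simp
  consider "poles (inverse z) \<subseteq> points_a n" | "poles (inverse z) \<subseteq> points_b n" | "poles (inverse z) \<subseteq> points_c n"
    using zeros by blast
  then show False
  proof cases
    case 1
    then show False using no_disjoint_pole_sets[OF n4 zF card sub] finite_card_points[of n] n4 by simp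
  next
    case 2
    obtain Q1 Q2 where Q: "Q1 \<in> poles (inverse z)" "Q2 \<in> poles (inverse z)" "Q1 \<noteq> Q2"
      using two_elements[OF c2] by metis
    obtain a1 a2 where a: "Q1 = Aff a1 0" "Q2 = Aff a2 0" "a1 ^ n = 1" "a2 ^ n = 1"
      using 2 Q(1,2) unfolding points_b_def by blast
    then have "a1 \<noteq> a2" using Q by simp
    have "\<alpha> * a + \<gamma> = 0" if "Aff a 0 \<in> poles (inverse z)" "a ^ n = 1" for a
    proof -
      have oc: "on_curve n (Aff a 0)" using that n4 by (simp add: power_0_left)
      have a0: "a \<noteq> 0" using that n4 by (auto simp: power_0_left)
      have "ord_at (Aff a 0) x = 0"
        by (rule reduces_ord_zero[OF reduces_xy_affine(1)[OF oc] a0])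
      moreover have "ord_at (Aff a 0) z > 0" using that zF by (simp add: poles_inverse)
      ultimately have "ord_at (Aff a 0) (linear_form \<alpha> \<beta> \<gamma>) > 0"
        using oc z l0 x_nonzero by (simp add: ord_divide)
      then show ?thesis using reduces_ord_pos[OF reduces_linear[OF oc]] by fastforce
    qed
    then have "\<alpha> * a1 + \<gamma> = 0" "\<alpha> * a2 + \<gamma> = 0" using Q a by auto
    then have "\<alpha> * (a1 - a2) = 0" by (metis add_right_cancel right_minus_eq right_diff_distrib)
    then have "\<alpha> = 0" "\<gamma> = 0" using \<open>a1 \<noteq> a2\<close> \<open>\<alpha> * a1 + \<gamma> = 0\<close> by auto
    then show False using b0 b00 l0 by simp
  next
    case 3
    obtain Q1 Q2 where Q: "Q1 \<in> poles (inverse z)" "Q2 \<in> poles (inverse z)" "Q1 \<noteq> Q2"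
      using two_elements[OF c2] by metis
    obtain f1 f2 where f: "Q1 = Inf f1" "Q2 = Inf f2"
      using 3 Q(1,2) unfolding points_c_def by blast
    then have "f1 \<noteq> f2" using Q by simp
    have "\<alpha> + \<beta> * f = 0" if "Inf f \<in> poles (inverse z)" for f
    proof -
      have "on_curve n (Inf f)" "ord_at (Inf f) z > 0" using that zF by (simp_all add: poles_inverse)
      then show ?thesis using reduces_ord_pos[OF reduces_linear_infinity] unfolding z by blast
    qed
    then have "\<alpha> + \<beta> * f1 = 0" "\<alpha> + \<beta> * f2 = 0" using Q f by auto
    then have "\<beta> * (f1 - f2) = 0" by (metis add_left_cancel right_minus_eq right_diff_distrib)
    then have "\<alpha> = 0" "\<beta> = 0" using \<open>f1 \<noteq> f2\<close> \<open>\<alpha> + \<beta> * f1 = 0\<close> by auto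
    then show False using b0 l0 by simp
  qed
qed

text \<open>The same argument with \<open>x = 0\<close> and infinity exchanged: some point
  \<open>(1 : f0 : 0)\<close> is not a pole, so \<open>\<alpha> + \<beta> f0 = 0\<close>, and two
  zeros on an affine coordinate line annihilate the form.\<close>

lemma no_linear_with_zeros_in_class:
  assumes n4: "n \<ge> 4" and z: "z = linear_form \<alpha> \<beta> \<gamma>" "z \<noteq> 0"
    and card: "card (poles z) = n - 1" "card (poles (inverse z)) = n - 1" and sub: "poles z \<subseteq> points_c n"
    and zeros: "poles (inverse z) \<subseteq> points_a n \<or> poles (inverse z) \<subseteq> points_b n \<or> poles (inverse z) \<subseteq> points_c n"
  shows False
proof -
  have zF: "z \<in> F" using z by simp
  have "\<exists>f0. f0 ^ n = -1 \<and> \<alpha> + \<beta> * f0 = 0"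
  proof (rule ccontr)
    assume no: "\<not> ?thesis"
    then have nz: "\<alpha> + \<beta> * f \<noteq> 0" if "f ^ n = -1" for f using that no by blast
    have "points_c n \<subseteq> poles z"
    proof
      fix Q assume "Q \<in> points_c n"
      then obtain f where f: "Q = Inf f" "f ^ n = -1" by (auto simp: points_c_def)
      then have oc: "on_curve n (Inf f)" by simp
      have "ord_at Q (z / x) = 0"
        unfolding f z by (rule reduces_ord_zero[OF reduces_linear_infinity[OF oc]]) (use nz f in simp)
      then have "ord_at Q z = -1"
        using oc f z zF x_nonzero ord_x_infinity[OF oc] by (simp add: ord_divide)
      then show "Q \<in> poles z" using oc f by (simp add: poles_def)
    qed
    then have "card (points_c n) \<le> card (poles z)" by (intro card_mono finite_poles zF)
    then show False using card finite_card_points[of n] n4 by simp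
  qed
  then obtain f0 where f0: "f0 ^ n = -1" "\<alpha> + \<beta> * f0 = 0" by blast
  have f00: "f0 \<noteq> 0" using f0 n4 by (auto simp: power_0_left)
  have affine_zero: "\<alpha> * a + \<beta> * b + \<gamma> = 0" if "Aff a b \<in> poles (inverse z)" for a b
    using that zF reduces_ord_pos[OF reduces_linear, of a b] unfolding z
    by (simp add: poles_inverse)
  have c2: "card (poles (inverse z)) \<ge> 2" using card n4 by simp
  consider "poles (inverse z) \<subseteq> points_a n" | "poles (inverse z) \<subseteq> points_b n" | "poles (inverse z) \<subseteq> points_c n"
    using zeros by blast
  then show False
  proof cases
    case 1
    obtain Q1 Q2 where Q: "Q1 \<in> poles (inverse z)" "Q2 \<in> poles (inverse z)" "Q1 \<noteq> Q2"
      using two_elements[OF c2] by metis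
    obtain b1 b2 where b: "Q1 = Aff 0 b1" "Q2 = Aff 0 b2"
      using 1 Q(1,2) unfolding points_a_def by blast
    then have "b1 \<noteq> b2" using Q by simp
    have "\<beta> * b1 + \<gamma> = 0" "\<beta> * b2 + \<gamma> = 0" using Q b affine_zero[of 0] by auto
    then have "\<beta> * (b1 - b2) = 0" by (metis add_right_cancel right_minus_eq right_diff_distrib)
    then have "\<beta> = 0" "\<gamma> = 0" using \<open>b1 \<noteq> b2\<close> \<open>\<beta> * b1 + \<gamma> = 0\<close> by auto
    then show False using f0 z by simp
  next
    case 2
    obtain Q1 Q2 where Q: "Q1 \<in> poles (inverse z)" "Q2 \<in> poles (inverse z)" "Q1 \<noteq> Q2"
      using two_elements[OF c2] by metis
    obtain a1 a2 where a: "Q1 = Aff a1 0" "Q2 = Aff a2 0"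
      using 2 Q(1,2) unfolding points_b_def by blast
    then have "a1 \<noteq> a2" using Q by simp
    have "\<alpha> * a1 + \<gamma> = 0" "\<alpha> * a2 + \<gamma> = 0" using Q a affine_zero[of _ 0] by auto
    then have "\<alpha> * (a1 - a2) = 0" by (metis add_right_cancel right_minus_eq right_diff_distrib)
    then have "\<alpha> = 0" "\<gamma> = 0" using \<open>a1 \<noteq> a2\<close> \<open>\<alpha> * a1 + \<gamma> = 0\<close> by auto
    then show False using f0 f00 z by simp
  next
    case 3
    then show False using no_disjoint_pole_sets[OF n4 zF card sub] finite_card_points[of n] n4 by simp
  qed
qed

lemma inverse_not_constant: "z \<notin> range \<iota> \<Longrightarrow> inverse z \<notin> range \<iota>"
  by (auto simp flip: \<iota>_inverse dest!: arg_cong[of "inverse z" _ inverse])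

lemma no_simple_extremal_function:
  assumes n4: "n \<ge> 4" and z: "z \<in> F" "z \<notin> range \<iota>"
    and deg: "pole_degree z = n - 1" "pole_degree (inverse z) = n - 1"
    and card: "card (poles z) = n - 1" "card (poles (inverse z)) = n - 1"
    and sub: "poles z \<subseteq> coordinate_points n" "poles (inverse z) \<subseteq> coordinate_points n"
  shows False
proof -
  \<comment> \<open>Stated for an arbitrary \<open>w\<close> so that it can be applied to whichever
    of \<open>z\<close> and \<open>1/z\<close> has a pole outside \<open>y = 0\<close>.\<close>
  have main: False
    if w: "w \<in> F" "w \<notin> range \<iota>" "pole_degree w = n - 1" "pole_degree (inverse w) = n - 1"
      "card (poles w) = n - 1" "card (poles (inverse w)) = n - 1"
      "poles w \<subseteq> coordinate_points n" "poles (inverse w) \<subseteq> coordinate_points n"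
      and nb: "\<not> poles w \<subseteq> points_b n" for w
  proof -
    have w0: "w \<noteq> 0" using w(2) \<iota>_0 by (metis rangeI)
    have iw: "inverse w \<in> F" "inverse w \<notin> range \<iota>" using w inverse_not_constant by auto
    have zeros: "poles (inverse w) \<subseteq> points_a n \<or> poles (inverse w) \<subseteq> points_b n \<or> poles (inverse w) \<subseteq> points_c n"
      using pole_classes[OF n4 iw w(4,6,8)] by blast
    show False
      using pole_classes[OF n4 w(1,2,3,5,7)] nb no_fraction_with_zeros_in_class[OF n4 _ w0 w(5,6) _ zeros]
        no_linear_with_zeros_in_class[OF n4 _ w0 w(5,6) _ zeros] by blast
  qed
  have iz: "inverse z \<in> F" "inverse z \<notin> range \<iota>" using z inverse_not_constant by auto
  show False
  proof (cases "poles z \<subseteq> points_b n")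
    case False
    then show False by (rule main[OF z deg card sub])
  next
    case True
    then have "\<not> poles (inverse z) \<subseteq> points_b n"
      using no_disjoint_pole_sets[OF n4 z(1) card True] finite_card_points[of n] n4 by auto
    then show False using main[OF iz] deg card sub by simp
  qed
qed

end

section \<open>Gonality and minimum distance\<close>

context fermat
begin

lemma pole_degree_eq_sum:
  assumes "z \<in> F" "finite A" "poles z \<subseteq> A" "\<And>Q. Q \<in> A \<Longrightarrow> on_curve n Q"
  shows "pole_degree z = (\<Sum>Q\<in>A. nat (- ord_at Q z))"
  unfolding pole_degree_def pole_order_def
  by (rule sum.mono_neutral_left) (use assms in \<open>auto simp: poles_def\<close>)

lemma lattice_norm_bound:
  assumes n4: "n \<ge> 4" and z: "z \<in> F" "z \<notin> range \<iota>"
    and sub: "poles z \<subseteq> coordinate_points n" "poles (inverse z) \<subseteq> coordinate_points n"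
  shows "int (2 * (n - 1)) < (\<Sum>Q\<in>coordinate_points n. (ord_at Q z)\<^sup>2)"
proof (rule ccontr)
  let ?C = "coordinate_points n"
  assume "\<not> ?thesis"
  then have le: "(\<Sum>Q\<in>?C. (ord_at Q z)\<^sup>2) \<le> int (2 * (n - 1))" by simp
  have C: "finite ?C" "\<And>Q. Q \<in> ?C \<Longrightarrow> on_curve n Q"
    using n4 finite_coordinate_points on_curve_coordinate_points by auto
  have iz: "inverse z \<in> F" "inverse z \<notin> range \<iota>" using z inverse_not_constant by auto
  have "int (pole_degree z) + int (pole_degree (inverse z)) =
      (\<Sum>Q\<in>?C. int (nat (- ord_at Q z)) + int (nat (- ord_at Q (inverse z))))"
    using pole_degree_eq_sum[OF z(1) C(1) sub(1) C(2)] pole_degree_eq_sum[OF iz(1) C(1) sub(2) C(2)]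
    by (simp add: sum.distrib)
  also have "\<dots> = (\<Sum>Q\<in>?C. \<bar>ord_at Q z\<bar>)"
    using C z by (intro sum.cong) (auto simp: ord_inverse)
  finally have tot: "int (pole_degree z) + int (pole_degree (inverse z)) = (\<Sum>Q\<in>?C. \<bar>ord_at Q z\<bar>)" .
  have abs_le: "\<bar>k\<bar> \<le> k\<^sup>2" for k :: int
    using mult_left_mono[of 1 "\<bar>k\<bar>" "\<bar>k\<bar>"] by (cases "k = 0") (auto simp: power2_eq_square)
  have "(\<Sum>Q\<in>?C. \<bar>ord_at Q z\<bar>) \<le> (\<Sum>Q\<in>?C. (ord_at Q z)\<^sup>2)"
    by (intro sum_mono abs_le)
  with tot le have "pole_degree z + pole_degree (inverse z) \<le> 2 * (n - 1)"
    and sq: "(\<Sum>Q\<in>?C. (ord_at Q z)\<^sup>2) \<le> int (2 * (n - 1))" by linarith+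
  then have deg: "pole_degree z = n - 1" "pole_degree (inverse z) = n - 1"
    using pole_degree_ge(1)[OF z] pole_degree_ge(1)[OF iz] by linarith+
  have "(\<Sum>Q\<in>?C. (ord_at Q z)\<^sup>2 - \<bar>ord_at Q z\<bar>) = 0"
  proof (rule antisym)
    show "(\<Sum>Q\<in>?C. (ord_at Q z)\<^sup>2 - \<bar>ord_at Q z\<bar>) \<le> 0"
      using sq tot deg by (simp add: sum_subtractf)
    show "0 \<le> (\<Sum>Q\<in>?C. (ord_at Q z)\<^sup>2 - \<bar>ord_at Q z\<bar>)"
      using abs_le by (intro sum_nonneg) simp
  qed
  \<comment> \<open>The terms \<open>k^2 - \<bar>k\<bar>\<close> are nonnegative and sum to 0, so
    each vanishes. Every zero and pole is then simple, and counting them gives the degree.\<close>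
  then have eq0: "(ord_at Q z)\<^sup>2 - \<bar>ord_at Q z\<bar> = 0" if "Q \<in> ?C" for Q
    using that C(1) abs_le by (subst (asm) sum_nonneg_eq_0_iff) auto
  have small: "\<bar>ord_at Q z\<bar> \<le> 1" if "Q \<in> ?C" for Q
  proof (rule ccontr)
    assume gt: "\<not> \<bar>ord_at Q z\<bar> \<le> 1"
    then have "\<bar>ord_at Q z\<bar> * 2 \<le> \<bar>ord_at Q z\<bar> * \<bar>ord_at Q z\<bar>" by (intro mult_left_mono) auto
    also have "\<dots> = (ord_at Q z)\<^sup>2" by (simp add: power2_eq_square)
    finally show False using eq0[OF that] gt by linarith
  qed
  have "card (poles z) = pole_degree z"
  proof -
    have "pole_order z Q = 1" if "Q \<in> poles z" for Q
      using small[of Q] sub(1) that by (auto simp: poles_def pole_order_def)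
    then show ?thesis unfolding pole_degree_def by simp
  qed
  moreover have "card (poles (inverse z)) = pole_degree (inverse z)"
  proof -
    have "pole_order (inverse z) Q = 1" if "Q \<in> poles (inverse z)" for Q
    proof -
      have "\<bar>ord_at Q z\<bar> \<le> 1" "on_curve n Q" "ord_at Q (inverse z) < 0"
        using small[of Q] sub(2) that by (auto simp: poles_def)
      then show ?thesis using z by (simp add: ord_inverse pole_order_def)
    qed
    then show ?thesis unfolding pole_degree_def by simp
  qed
  ultimately show False using no_simple_extremal_function[OF n4 z deg _ _ sub] deg by simp
qed

lemma fun_degree_eq_pole_degree:
  assumes z: "z \<in> F" "z \<noteq> 0"
  shows "fun_degree \<iota> F z = pole_degree (inverse z)"
proof -
  have eq: "{P. place \<iota> F P \<and> val F P z > 0} = place_at ` poles (inverse z)"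
    using z by (auto simp: place_iff poles_inverse val_eq_ord)
  have "fun_degree \<iota> F z = (\<Sum>Q\<in>poles (inverse z). nat (val F (place_at Q) z))"
    unfolding fun_degree_def eq
    by (subst sum.reindex) (auto simp: inj_on_def poles_def intro: place_at_inj)
  also have "\<dots> = (\<Sum>Q\<in>poles (inverse z). pole_order (inverse z) Q)"
    using z by (intro sum.cong) (auto simp: poles_def val_eq_ord pole_order_def ord_inverse)
  finally show ?thesis by (simp add: pole_degree_def)
qed

text \<open>The inverse \<open>y / (x - 1)\<close> is the projection from the point \<open>(1 : 0 : 1)\<close> of the curve.\<close>

lemma projection_pole_degree:
  assumes "n \<ge> 2"
  shows "(x - \<iota> 1) / y \<notin> range \<iota>" "pole_degree ((x - \<iota> 1) / y) \<le> n - 1"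
proof -
  let ?w = "(x - \<iota> 1) / y"
  have x1: "x - \<iota> 1 \<noteq> 0" using x_transcendental by (metis eq_iff_diff_eq_0 rangeI)
  have Q1: "on_curve n (Aff 1 0)" using n_pos by simp
  \<comment> \<open>The order of 0 is 0 by convention, whereas \<open>y\<close> has order 1 at this
    point.\<close>
  have "ord_at (Aff 1 0) 0 = 0" using Q1 by (simp add: ord_at_def)
  then have y0: "y \<noteq> 0" using ord_y_ramified[OF Q1] by (metis zero_neq_one)
  have ord_w: "ord_at Q ?w = ord_at Q (x - \<iota> 1) - ord_at Q y" if "on_curve n Q" for Q
    using that x1 y0 by (subst ord_divide) auto
  have w1: "ord_at (Aff 1 0) ?w = int n - 1"
    using ord_w[OF Q1] ord_x_minus[OF Q1] ord_y_ramified[OF Q1] by (simp add: ram_index_def)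
  then show "?w \<notin> range \<iota>" using assms Q1 by auto
  have ord_at_b: "ord_at (Aff a 0) ?w = -1" if "on_curve n (Aff a 0)" "a \<noteq> 1" for a
  proof -
    have "reduces (expansion (Aff a 0) (x - \<iota> 1)) (a - 1)"
      using reduces_xy_affine(1)[OF that(1)] that by auto
    then have "ord_at (Aff a 0) (x - \<iota> 1) = 0" using that reduces_ord_zero by fastforce
    then show ?thesis using ord_w that ord_y_ramified by simp
  qed
  \<comment> \<open>At infinity numerator and denominator both have a simple pole, and at
    \<open>(1 : 0 : 1)\<close> the zero of \<open>x - 1\<close> of order \<open>n\<close> outweighs
    that of \<open>y\<close>. This leaves the other \<open>n - 1\<close> zeros of
    \<open>y\<close>.\<close>
  have sub: "poles ?w \<subseteq> points_b n - {Aff 1 0}"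
  proof
    fix Q assume Q: "Q \<in> poles ?w"
    then have oc: "on_curve n Q" and neg: "ord_at Q ?w < 0" by (auto simp: poles_def)
    show "Q \<in> points_b n - {Aff 1 0}"
    proof (cases Q)
      case (Inf f)
      have f: "on_curve n (Inf f)" using oc Inf by simp
      then have "f \<noteq> 0" using n_pos by (auto simp: power_0_left)
      then have "ord_at Q (y / x) = 0" using reduces_ord_zero[OF reduces_slope[OF f]] Inf by simp
      then have "ord_at Q y = ord_at Q x" using oc y0 x_nonzero by (simp add: ord_divide)
      moreover have "ord_at Q (x - \<iota> 1) = -1" using ord_E1_infinity[OF f, of "[:-1, 1:]"] Inf by simp
      ultimately show ?thesis using neg ord_w[OF oc] ord_x_infinity[OF f] Inf by simp
    next
      case (Aff a b)
      have "b = 0"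
      proof (rule ccontr)
        assume b: "b \<noteq> 0"
        then have a: "a \<noteq> 1" using oc Aff by auto
        have oc': "on_curve n (Aff a b)" using oc Aff by simp
        have "reduces (expansion (Aff a b) (x - \<iota> 1)) (a - 1)"
          using reduces_xy_affine(1)[OF oc'] oc' by auto
        then have "ord_at Q (x - \<iota> 1) = 0" using a Aff reduces_ord_zero by fastforce
        moreover have "ord_at Q y = 0" using reduces_ord_zero[OF reduces_xy_affine(2)[OF oc'] b] Aff by simp
        ultimately show False using neg ord_w[OF oc] by simp
      qed
      moreover have "Q \<noteq> Aff 1 0" using neg w1 assms by auto
      moreover have "a ^ n = 1" using oc Aff \<open>b = 0\<close> n_pos by (simp add: power_0_left)
      ultimately show ?thesis using Aff by (auto simp: points_b_def)
    qed
  qed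
  have fin: "finite (points_b n - {Aff 1 0})" using finite_card_points[OF n_pos] by simp
  have "pole_degree ?w = (\<Sum>Q\<in>poles ?w. 1)"
    unfolding pole_degree_def
  proof (rule sum.cong)
    fix Q assume Q: "Q \<in> poles ?w"
    then obtain a where "Q = Aff a 0" "a \<noteq> 1" using sub by (auto simp: points_b_def)
    then show "pole_order ?w Q = 1" using ord_at_b Q by (simp add: pole_order_def poles_def)
  qed simp
  also have "\<dots> = card (poles ?w)" by simp
  also have "\<dots> \<le> card (points_b n - {Aff 1 0})" by (rule card_mono[OF fin sub])
  also have "\<dots> = n - 1"
    using finite_card_points[OF n_pos] by (subst card_Diff_singleton) (auto simp: points_b_def)
  finally show "pole_degree ?w \<le> n - 1" .
qed

lemma gonality_eq:
  assumes "n \<ge> 2"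
  shows "gonality \<iota> F = n - 1"
proof -
  have lower: "n - 1 \<le> fun_degree \<iota> F z" if "z \<in> F - range \<iota>" for z
  proof -
    have "z \<noteq> 0" using that \<iota>_0 by (metis DiffD2 rangeI)
    then show ?thesis
      using that fun_degree_eq_pole_degree[of z] pole_degree_ge(1)[of "inverse z"] inverse_not_constant[of z]
      by auto
  qed
  let ?z = "inverse ((x - \<iota> 1) / y)"
  have z: "?z \<in> F - range \<iota>"
    using inverse_not_constant[OF projection_pole_degree(1)[OF assms]]
    by (intro DiffI F_inverse F_divide F_diff F_x F_y F_constants)
  then have "?z \<noteq> 0" using \<iota>_0 by (metis DiffD2 rangeI)
  then have "fun_degree \<iota> F ?z = pole_degree ((x - \<iota> 1) / y)"
    using z fun_degree_eq_pole_degree[of ?z] by (metis DiffD1 inverse_inverse_eq)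
  then have "fun_degree \<iota> F ?z = n - 1"
    using projection_pole_degree(2)[OF assms] lower[OF z] by simp
  then show ?thesis unfolding gonality_def using lower z by (intro Least_equality) (metis, blast)
qed

section \<open>Homogeneous coordinates of a place\<close>

lemma in_place_at_iff:
  assumes "on_curve n Q" "z \<in> F"
  shows "z - \<iota> c \<in> place_at Q \<longleftrightarrow> reduces (expansion Q z) c"
proof
  assume "z - \<iota> c \<in> place_at Q"
  then have "reduces (expansion Q z - fls_const c) 0" using assms by (simp add: place_at_def)
  from reduces_add[OF this reduces_const[of c]] show "reduces (expansion Q z) c" by simp
next
  assume "reduces (expansion Q z) c"
  from reduces_diff[OF this reduces_const[of c]] show "z - \<iota> c \<in> place_at Q"
    using assms by (simp add: place_at_def)
qed

lemma centred_at_place_at: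
  assumes "on_curve n Q" "(a, b, c) \<noteq> (0, 0, 0)"
  shows "centred_at \<iota> x y F (place_at Q) (a, b, c) \<longleftrightarrow>
    (\<exists>t\<in>F. reduces (expansion Q t * X_at Q) a \<and> reduces (expansion Q t * Y_at Q) b \<and> reduces (expansion Q t) c)"
  using assms in_place_at_iff[OF assms(1)] unfolding centred_at_def by auto

lemma centred_at_affine:
  assumes Q: "on_curve n Q" and ab: "on_curve n (Aff a b)"
  shows "centred_at \<iota> x y F (place_at Q) (a, b, 1) \<longleftrightarrow> Q = Aff a b"
proof
  assume "centred_at \<iota> x y F (place_at Q) (a, b, 1)"
  then obtain t where t: "t \<in> F" "reduces (expansion Q t * X_at Q) a" "reduces (expansion Q t * Y_at Q) b"
    "reduces (expansion Q t) 1"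
    using centred_at_place_at[OF Q] by auto
  then have nz: "expansion Q t \<noteq> 0" using reduces_nonzero by fastforce
  have "reduces (inverse (expansion Q t)) (inverse 1)" using t by (intro reduces_inverse) auto
  then have "reduces (inverse (expansion Q t) * (expansion Q t * X_at Q)) (inverse 1 * a)"
    "reduces (inverse (expansion Q t) * (expansion Q t * Y_at Q)) (inverse 1 * b)"
    using t by (auto intro!: reduces_mult simp del: inverse_1)
  then have XY: "reduces (X_at Q) a" "reduces (Y_at Q) b"
    using nz by (simp_all add: mult.assoc[symmetric])
  show "Q = Aff a b"
  proof (cases Q)
    case (Aff a' b')
    then have "reduces (X_at Q) a'" "reduces (Y_at Q) b'"
      using parametrizes_at[OF Q] by auto
    then show ?thesis using XY reduces_unique Aff by metis
  next
    case (Inf f)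
    then have "fls_subdegree (X_at Q) = -1" using parametrizes_at[OF Q] by simp
    then show ?thesis using XY reduces_ex_iff[of "X_at Q"] by fastforce
  qed
next
  assume "Q = Aff a b"
  then have "reduces (X_at Q) a" "reduces (Y_at Q) b" using parametrizes_at[OF Q] by auto
  then show "centred_at \<iota> x y F (place_at Q) (a, b, 1)"
    using centred_at_place_at[OF Q] Q by (auto intro!: bexI[of _ 1])
qed

lemma centred_at_infinity:
  assumes Q: "on_curve n Q" and e: "e ^ n = -1"
  shows "centred_at \<iota> x y F (place_at Q) (e, 1, 0) \<longleftrightarrow> Q = Inf (inverse e)"
proof
  have e0: "e \<noteq> 0" using e n_pos by (auto simp: power_0_left)
  assume "centred_at \<iota> x y F (place_at Q) (e, 1, 0)"
  then obtain t where t: "t \<in> F" "reduces (expansion Q t * X_at Q) e" "reduces (expansion Q t * Y_at Q) 1"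
    "reduces (expansion Q t) 0"
    using centred_at_place_at[OF Q] by auto
  then have nz: "expansion Q t \<noteq> 0" "X_at Q \<noteq> 0" using reduces_nonzero[OF t(2) e0] by auto
  show "Q = Inf (inverse e)"
  proof (cases Q)
    \<comment> \<open>At an affine point \<open>x\<close> is finite while \<open>t\<close> vanishes,
      so \<open>t x\<close> would reduce to 0 and not to \<open>e\<close>.\<close>
    case (Aff a b)
    then have "reduces (X_at Q) a" using parametrizes_at[OF Q] by auto
    then have "reduces (expansion Q t * X_at Q) (0 * a)" using t by (intro reduces_mult)
    then show ?thesis using t(2) reduces_unique e0 by fastforce
  next
    case (Inf f)
    have "reduces ((expansion Q t * Y_at Q) * inverse (expansion Q t * X_at Q)) (1 * inverse e)"
      using t e0 by (intro reduces_mult reduces_inverse)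
    also have "(expansion Q t * Y_at Q) * inverse (expansion Q t * X_at Q) = Y_at Q / X_at Q"
      using nz by (simp add: field_simps)
    finally have "f = inverse e" using parametrizes_at[OF Q] Inf reduces_unique by fastforce
    then show ?thesis using Inf by simp
  qed
next
  have e0: "e \<noteq> 0" using e n_pos by (auto simp: power_0_left)
  assume Inf: "Q = Inf (inverse e)"
  then have oc: "on_curve n (Inf (inverse e))" using Q by simp
  note X = reduces_inverse_x[OF oc, folded Inf]
  have XY: "reduces (X_at Q / Y_at Q) e"
    using reduces_inverse[OF X(3)] e0 by simp
  then have Y0: "Y_at Q \<noteq> 0" using reduces_unique[of 0 0 e] e0 by auto
  have "reduces (inverse (X_at Q) * (X_at Q / Y_at Q)) (0 * e)" by (intro reduces_mult X XY)
  then have "reduces (inverse (Y_at Q)) 0" using X(1) by (simp add: field_simps)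
  then show "centred_at \<iota> x y F (place_at Q) (e, 1, 0)"
    \<comment> \<open>Scaling by \<open>t = 1/y\<close> turns \<open>(x : y : 1)\<close> into
      \<open>(x/y : 1 : 1/y)\<close>, which reduces to \<open>(e : 1 : 0)\<close>.\<close>
    using centred_at_place_at[OF Q] Q XY Y0 by (auto intro!: bexI[of _ "inverse y"] simp: field_simps)
qed

end

lemma powers_of_primitive_root:
  assumes n: "n > 0" and \<zeta>: "primitive_root_of_unity n \<zeta>"
  shows "(\<lambda>j. \<zeta> ^ j) ` {..<n} = {b. b ^ n = 1}"
proof -
  have \<zeta>n: "\<zeta> ^ n = 1" and prim: "\<And>k. 0 < k \<Longrightarrow> k < n \<Longrightarrow> \<zeta> ^ k \<noteq> 1"
    using \<zeta> by (auto simp: primitive_root_of_unity_def)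
  then have \<zeta>0: "\<zeta> \<noteq> 0" using n by (auto simp: power_0_left)
  have "inj_on (\<lambda>j. \<zeta> ^ j) {..<n}"
  proof (rule linorder_inj_onI)
    fix i j assume ij: "i < j" "i \<in> {..<n}" "j \<in> {..<n}"
    have "\<zeta> ^ j = \<zeta> ^ i * \<zeta> ^ (j - i)" using ij by (simp flip: power_add)
    then show "\<zeta> ^ i \<noteq> \<zeta> ^ j" using prim[of "j - i"] ij \<zeta>0 by auto
  qed auto
  then have "card ((\<lambda>j. \<zeta> ^ j) ` {..<n}) = n" by (simp add: card_image)
  moreover have "(\<lambda>j. \<zeta> ^ j) ` {..<n} \<subseteq> {b. b ^ n = 1}"
  proof clarify
    fix j
    have "(\<zeta> ^ j) ^ n = (\<zeta> ^ n) ^ j" by (simp only: power_mult[symmetric] mult.commute)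
    then show "(\<zeta> ^ j) ^ n = 1" by (simp add: \<zeta>n)
  qed
  ultimately show ?thesis using finite_card_nth_roots[of 1 n] n by (intro card_subset_eq) auto
qed

lemma multiples_of_root:
  fixes \<epsilon> :: complex
  assumes "n > 0" "\<epsilon> ^ n = -1"
  shows "(\<lambda>b. \<epsilon> * b) ` {b. b ^ n = 1} = {e. e ^ n = -1}"
proof
  show "(\<lambda>b. \<epsilon> * b) ` {b. b ^ n = 1} \<subseteq> {e. e ^ n = -1}"
    using assms by (auto simp: power_mult_distrib)
  show "{e. e ^ n = -1} \<subseteq> (\<lambda>b. \<epsilon> * b) ` {b. b ^ n = 1}"
  proof
    fix e :: complex assume e: "e \<in> {e. e ^ n = -1}"
    have "\<epsilon> \<noteq> 0" using assms by (auto simp: power_0_left)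
    then have "e = \<epsilon> * (e / \<epsilon>)" "(e / \<epsilon>) ^ n = 1" using e assms by (simp_all add: power_divide)
    then show "e \<in> (\<lambda>b. \<epsilon> * b) ` {b. b ^ n = 1}" by blast
  qed
qed

lemma fermat_points_eq:
  assumes "n > 0" "primitive_root_of_unity n \<zeta>" "\<epsilon> ^ n = -1"
  shows "fermat_points n \<zeta> \<epsilon> = {(0, b, 1) | b. b ^ n = 1} \<union> {(a, 0, 1) | a. a ^ n = 1} \<union> {(e, 1, 0) | e. e ^ n = -1}"
proof -
  note pow = powers_of_primitive_root[OF assms(1,2)]
  have "fermat_points n \<zeta> \<epsilon> = (\<lambda>b. (0, b, 1)) ` (\<lambda>j. \<zeta> ^ j) ` {..<n} \<union> (\<lambda>a. (a, 0, 1)) ` (\<lambda>j. \<zeta> ^ j) ` {..<n}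
      \<union> (\<lambda>e. (e, 1, 0)) ` (\<lambda>b. \<epsilon> * b) ` (\<lambda>j. \<zeta> ^ j) ` {..<n}"
    unfolding fermat_points_def by (auto simp: image_iff)
  then show ?thesis unfolding pow multiples_of_root[OF assms(1,3)] by auto
qed

section \<open>The lattice and its minimum distance\<close>

context fermat
begin

lemma fermat_places_eq:
  assumes "primitive_root_of_unity n \<zeta>" "\<epsilon> ^ n = -1"
  shows "fermat_places n \<zeta> \<epsilon> \<iota> x y F = place_at ` coordinate_points n"
proof -
  have "(\<exists>p\<in>fermat_points n \<zeta> \<epsilon>. centred_at \<iota> x y F (place_at Q) p) \<longleftrightarrow> Q \<in> coordinate_points n"
    if Q: "on_curve n Q" for Q
  proof -
    have a: "b ^ n = 1 \<Longrightarrow> centred_at \<iota> x y F (place_at Q) (0, b, 1) \<longleftrightarrow> Q = Aff 0 b" for b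
      using n_pos by (intro centred_at_affine[OF Q]) simp
    have b: "a ^ n = 1 \<Longrightarrow> centred_at \<iota> x y F (place_at Q) (a, 0, 1) \<longleftrightarrow> Q = Aff a 0" for a
      using n_pos by (intro centred_at_affine[OF Q]) simp
    have c: "e ^ n = -1 \<Longrightarrow> centred_at \<iota> x y F (place_at Q) (e, 1, 0) \<longleftrightarrow> Q = Inf (inverse e)" for e
      by (rule centred_at_infinity[OF Q])
    let ?cen = "centred_at \<iota> x y F (place_at Q)"
    have "inverse e ^ n = -1" if "e ^ n = -1" for e :: complex
      using that by (simp add: power_inverse)
    then have c': "(\<exists>e. e ^ n = -1 \<and> Q = Inf (inverse e)) \<longleftrightarrow> (\<exists>f. f ^ n = -1 \<and> Q = Inf f)"
      by (metis inverse_inverse_eq)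
    have "(\<exists>p\<in>fermat_points n \<zeta> \<epsilon>. ?cen p) \<longleftrightarrow> (\<exists>b. b ^ n = 1 \<and> ?cen (0, b, 1)) \<or>
        (\<exists>a. a ^ n = 1 \<and> ?cen (a, 0, 1)) \<or> (\<exists>e. e ^ n = -1 \<and> ?cen (e, 1, 0))"
      unfolding fermat_points_eq[OF n_pos assms] by blast
    also have "\<dots> \<longleftrightarrow> (\<exists>b. b ^ n = 1 \<and> Q = Aff 0 b) \<or> (\<exists>a. a ^ n = 1 \<and> Q = Aff a 0) \<or>
        (\<exists>f. f ^ n = -1 \<and> Q = Inf f)"
      unfolding c'[symmetric] by (intro arg_cong2[of _ _ _ _ "(\<or>)"] ex_cong1 conj_cong refl a b c)
    also have "\<dots> \<longleftrightarrow> Q \<in> coordinate_points n"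
      unfolding coordinate_points_def points_a_def points_b_def points_c_def by blast
    finally show ?thesis .
  qed
  then show ?thesis
    unfolding fermat_places_def place_iff using on_curve_coordinate_points[OF n_pos] by blast
qed

lemma fermat_lattice_norm:
  assumes "\<epsilon> ^ n = -1" "primitive_root_of_unity n \<zeta>" and z: "z \<in> F" "z \<noteq> 0"
  defines "S \<equiv> fermat_places n \<zeta> \<epsilon> \<iota> x y F"
  shows "L2_set (\<lambda>P. if P \<in> S then real_of_int (val F P z) else 0) S =
    sqrt (real_of_int (\<Sum>Q\<in>coordinate_points n. (ord_at Q z)\<^sup>2))"
proof -
  have S: "S = place_at ` coordinate_points n" unfolding S_def by (rule fermat_places_eq[OF assms(2,1)])
  have inj: "inj_on place_at (coordinate_points n)"
    using place_at_inj on_curve_coordinate_points[OF n_pos] by (auto simp: inj_on_def)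
  have "(\<Sum>P\<in>S. (if P \<in> S then real_of_int (val F P z) else 0)\<^sup>2) = (\<Sum>P\<in>S. (real_of_int (val F P z))\<^sup>2)"
    by (intro sum.cong) auto
  also have "\<dots> = (\<Sum>Q\<in>coordinate_points n. (real_of_int (val F (place_at Q) z))\<^sup>2)"
    unfolding S by (subst sum.reindex[OF inj]) simp
  also have "\<dots> = (\<Sum>Q\<in>coordinate_points n. (real_of_int (ord_at Q z))\<^sup>2)"
    using on_curve_coordinate_points[OF n_pos] z by (intro sum.cong) (auto simp: val_eq_ord)
  finally show ?thesis by (simp add: L2_set_def)
qed

lemma S_unit_poles:
  assumes "\<epsilon> ^ n = -1" "primitive_root_of_unity n \<zeta>" "z \<in> S_units \<iota> F (fermat_places n \<zeta> \<epsilon> \<iota> x y F)"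
  shows "z \<in> F" "z \<noteq> 0" "poles z \<subseteq> coordinate_points n" "poles (inverse z) \<subseteq> coordinate_points n"
proof -
  show z: "z \<in> F" "z \<noteq> 0" using assms(3) by (auto simp: S_units_def)
  have "Q \<in> coordinate_points n" if "on_curve n Q" "ord_at Q z \<noteq> 0" for Q
  proof -
    have "place_at Q \<in> place_at ` coordinate_points n"
      using assms(3) that z place_place_at[OF that(1)] val_eq_ord[OF that(1)]
      unfolding S_units_def fermat_places_eq[OF assms(2,1)] by auto
    then show ?thesis using place_at_inj that on_curve_coordinate_points[OF n_pos] by blast
  qed
  then show "poles z \<subseteq> coordinate_points n" "poles (inverse z) \<subseteq> coordinate_points n"
    unfolding poles_inverse[OF z(1)] by (auto simp: poles_def)
qed

text \<open>Supplies a nonzero lattice vector, so that the set of lengths in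
  \<open>min_distance\<close> is not empty.\<close>

lemma x_S_unit:
  assumes "\<epsilon> ^ n = -1" "primitive_root_of_unity n \<zeta>"
  shows "x \<in> S_units \<iota> F (fermat_places n \<zeta> \<epsilon> \<iota> x y F)"
  unfolding S_units_def fermat_places_eq[OF assms(2,1)]
proof (safe)
  fix P assume "place \<iota> F P" and v: "val F P x \<noteq> 0"
  then obtain Q where Q: "on_curve n Q" "P = place_at Q" using place_iff by blast
  then have "ord_at Q x \<noteq> 0" using v val_eq_ord x_nonzero by auto
  have "Q \<in> coordinate_points n"
  proof (cases Q)
    case (Aff a b)
    then have "a = 0" using Q \<open>ord_at Q x \<noteq> 0\<close> reduces_ord_zero[OF reduces_xy_affine(1)] by blast
    then show ?thesis using Aff Q n_pos by (auto simp: coordinate_points_def points_a_def power_0_left)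
  next
    case (Inf f)
    then show ?thesis using Q by (auto simp: coordinate_points_def points_c_def)
  qed
  then show "P \<in> place_at ` coordinate_points n" using Q by blast
qed (use x_nonzero in auto)

text \<open>A \<open>LEAST\<close> over the reals is meaningful only if a minimum exists. The
  squared lengths are natural numbers, so a least one exists, and the minimum distance is its square
  root.\<close>

lemma min_distance_gt:
  assumes n4: "n \<ge> 4" and eps: "\<epsilon> ^ n = -1" and zeta: "primitive_root_of_unity n \<zeta>"
  shows "min_distance (fermat_places n \<zeta> \<epsilon> \<iota> x y F) (fermat_lattice n \<zeta> \<epsilon> \<iota> x y F) > sqrt (2 * real (n - 1))"
proof -
  define S where "S = fermat_places n \<zeta> \<epsilon> \<iota> x y F"
  define vec where "vec = (\<lambda>z P. if P \<in> S then real_of_int (val F P z) else 0)"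
  define Len where "Len = (\<lambda>k. \<exists>z\<in>S_units \<iota> F S. vec z \<noteq> (\<lambda>_. 0) \<and> int k = (\<Sum>Q\<in>coordinate_points n. (ord_at Q z)\<^sup>2))"
  have S: "S = place_at ` coordinate_points n" unfolding S_def by (rule fermat_places_eq[OF zeta eps])
  have norm: "L2_set (vec z) S = sqrt (real_of_int (\<Sum>Q\<in>coordinate_points n. (ord_at Q z)\<^sup>2))"
    if "z \<in> S_units \<iota> F S" for z
    unfolding vec_def S_def using that by (intro fermat_lattice_norm eps zeta) (auto simp: S_units_def)
  have lengths: "(\<exists>v\<in>fermat_lattice n \<zeta> \<epsilon> \<iota> x y F. v \<noteq> (\<lambda>_. 0) \<and> r = L2_set v S) \<longleftrightarrow> (\<exists>k. Len k \<and> r = sqrt (real k))" for r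
  proof -
    have "(\<exists>v\<in>fermat_lattice n \<zeta> \<epsilon> \<iota> x y F. v \<noteq> (\<lambda>_. 0) \<and> r = L2_set v S) \<longleftrightarrow>
      (\<exists>z\<in>S_units \<iota> F S. vec z \<noteq> (\<lambda>_. 0) \<and> r = L2_set (vec z) S)"
      unfolding fermat_lattice_def function_field_lattice_def S_def[symmetric] vec_def by blast
    also have "\<dots> \<longleftrightarrow> (\<exists>k. Len k \<and> r = sqrt (real k))"
    proof
      assume "\<exists>z\<in>S_units \<iota> F S. vec z \<noteq> (\<lambda>_. 0) \<and> r = L2_set (vec z) S"
      then obtain z where z: "z \<in> S_units \<iota> F S" "vec z \<noteq> (\<lambda>_. 0)" "r = L2_set (vec z) S" by blast
      let ?k = "nat (\<Sum>Q\<in>coordinate_points n. (ord_at Q z)\<^sup>2)"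
      have k: "int ?k = (\<Sum>Q\<in>coordinate_points n. (ord_at Q z)\<^sup>2)" by (simp add: sum_nonneg)
      then have "r = sqrt (real ?k)" using z norm by (metis of_int_of_nat_eq)
      then show "\<exists>k. Len k \<and> r = sqrt (real k)" unfolding Len_def using z k by blast
    next
      assume "\<exists>k. Len k \<and> r = sqrt (real k)"
      then show "\<exists>z\<in>S_units \<iota> F S. vec z \<noteq> (\<lambda>_. 0) \<and> r = L2_set (vec z) S"
        unfolding Len_def using norm by (metis of_int_of_nat_eq)
    qed
    finally show ?thesis .
  qed
  have big: "2 * (n - 1) < k" if k: "Len k" for k
  proof -
    obtain z where z: "z \<in> S_units \<iota> F S" "vec z \<noteq> (\<lambda>_. 0)" "int k = (\<Sum>Q\<in>coordinate_points n. (ord_at Q z)\<^sup>2)"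
      using k unfolding Len_def by blast
    note zf = S_unit_poles[OF eps zeta z(1)[unfolded S_def]]
    \<comment> \<open>A constant has order 0 everywhere and would give the zero vector.\<close>
    have "z \<notin> range \<iota>"
    proof
      assume "z \<in> range \<iota>"
      then have "vec z P = 0" for P
        using on_curve_coordinate_points[OF n_pos] zf(1,2) by (auto simp: vec_def S val_eq_ord)
      then show False using z(2) by auto
    qed
    from lattice_norm_bound[OF n4 zf(1) this zf(3,4)] show ?thesis unfolding z(3)[symmetric] by simp
  qed
  have "Len (nat (\<Sum>Q\<in>coordinate_points n. (ord_at Q x)\<^sup>2))"
  proof -
    have oc: "on_curve n (Aff 0 1)" "Aff 0 1 \<in> coordinate_points n"
      using n_pos by (auto simp: power_0_left coordinate_points_def points_a_def)
    then have "vec x (place_at (Aff 0 1)) = 1"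
      using ord_x_at_a[OF oc(1)] x_nonzero by (auto simp: vec_def S val_eq_ord)
    then have "vec x \<noteq> (\<lambda>_. 0)" by (metis zero_neq_one)
    then show ?thesis unfolding Len_def using x_S_unit[OF eps zeta] S_def by (auto simp: sum_nonneg)
  qed
  then have L: "Len (LEAST k. Len k)" by (rule LeastI)
  have "min_distance S (fermat_lattice n \<zeta> \<epsilon> \<iota> x y F) = sqrt (real (LEAST k. Len k))"
    unfolding min_distance_def lengths
    by (rule Least_equality) (use L in \<open>auto intro: Least_le\<close>)
  also have "\<dots> > sqrt (2 * real (n - 1))" using big[OF L] by (simp flip: of_nat_mult)
  finally show ?thesis by (simp only: S_def)
qed

end

theorem theorem3p2:
  fixes n :: nat and \<iota> :: "complex \<Rightarrow> 'a::field" and x y :: 'a and F :: "'a set"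
    and \<zeta> \<epsilon> :: complex
  assumes "n \<ge> 4"
    and "fermat_function_field n \<iota> x y F"
    and "primitive_root_of_unity n \<zeta>"
    and "\<epsilon> ^ n = -1"
  shows "min_distance (fermat_places n \<zeta> \<epsilon> \<iota> x y F) (fermat_lattice n \<zeta> \<epsilon> \<iota> x y F)
           > sqrt (2 * real (gonality \<iota> F))
         \<and> gonality \<iota> F = n - 1"
proof -
  have emb: "field_embedding \<iota>" and tr: "transcendental_over \<iota> x"
    and eq: "x ^ n + y ^ n = 1" and F: "F = adjoin \<iota> {x, y}"
    using assms(2) by (auto simp: fermat_function_field_def)
  interpret constant_field \<iota> by unfold_locales (rule emb)
  interpret K: fermat \<iota> n x y
    by unfold_locales (use assms(1) tr transcendental_over_iff eq in auto)
  have F': "F = K.F" using F K.adjoin_eq_F by simp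
  have "gonality \<iota> K.F = n - 1" using assms(1) by (intro K.gonality_eq) simp
  with K.min_distance_gt[OF assms(1,4,3)] show ?thesis unfolding F' by simp
qed

end
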